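(* Let $\mu$ be a probability measure on $\mathbf{R}^d$ and let $a>0$. The following are equivalent: (1) There exist constants $r_o,b\ge 0$ such that for every integer $n\ge1$, every measurable $A\subset(\mathbf{R}^d)^n$ with $\mu^n(A)\ge 1/2$ and every $r\ge r_o$, \[\mu^n(A+rB_2)\ge 1-b\,e^{-a(r-r_o)^2},\] where $B_2$ is the Euclidean unit ball of $(\mathbf{R}^d)^n$. (2) $\mu$ satisfies $\mathbf{T}_2(1/a)$, i.e. $\mathcal{T}_2(\nu,\mu)\le \frac1a\,H(\nu\,|\,\mu)$ for every probability measure $\nu$ on $\mathbf{R}^d$.
   Context: $\mu^n$ denotes the $n$-fold product measure. For probability measures $\nu,\mu$ on $\mathbf{R}^d$, $\mathcal{T}_2(\nu,\mu)=\inf_\pi\int|x-y|_2^2\,d\pi(x,y)$, the infimum over all couplings $\pi$ of $\nu$ and $\mu$ (probability measures on $\mathbf{R}^d\times\mathbf{R}^d$ with marginals $\nu$ and $\mu$). The relative entropy is $H(\nu\,|\,\mu)=\int\log\frac{d\nu}{d\mu}\,d\nu$ if $\nu\ll\mu$ and $+\infty$ otherwise. *)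

theory Defs
  imports "HOL-Probability.Probability"
begin

definition l2dist :: "nat \<Rightarrow> (nat \<Rightarrow> 'a::euclidean_space) \<Rightarrow> (nat \<Rightarrow> 'a) \<Rightarrow> real" where
  "l2dist n x y = sqrt (\<Sum>i<n. (norm (x i - y i))\<^sup>2)"

definition prodn :: "nat \<Rightarrow> 'a measure \<Rightarrow> (nat \<Rightarrow> 'a) measure" where
  "prodn n \<mu> = PiM {..<n} (\<lambda>_. \<mu>)"

definition enlarge :: "nat \<Rightarrow> (nat \<Rightarrow> 'a::euclidean_space) set \<Rightarrow> real \<Rightarrow> (nat \<Rightarrow> 'a) set" where
  "enlarge n A r = {x \<in> PiE {..<n} (\<lambda>_. UNIV). \<exists>y\<in>A. l2dist n x y \<le> r}"

definition couplings :: "'a::euclidean_space measure \<Rightarrow> 'a measure \<Rightarrow> ('a \<times> 'a) measure set" where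
  "couplings \<nu> \<mu> = {\<pi>. sets \<pi> = sets (borel \<Otimes>\<^sub>M borel) \<and>
        distr \<pi> borel fst = \<nu> \<and> distr \<pi> borel snd = \<mu>}"

definition T2 :: "'a::euclidean_space measure \<Rightarrow> 'a measure \<Rightarrow> ennreal" where
  "T2 \<nu> \<mu> = (INF \<pi>\<in>couplings \<nu> \<mu>. \<integral>\<^sup>+ p. ennreal ((dist (fst p) (snd p))\<^sup>2) \<partial>\<pi>)"

text \<open>Relative entropy H(nu | mu) = int log (dnu/dmu) dnu if nu << mu, +infinity otherwise.
  The integral is the extended integral (positive part minus negative part).\<close>
definition rel_entropy :: "'a measure \<Rightarrow> 'a measure \<Rightarrow> ereal" where
  "rel_entropy \<nu> \<mu> =
     (if absolutely_continuous \<mu> \<nu> \<and> sets \<nu> = sets \<mu> then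
        (let f = (\<lambda>x. ln (enn2real (RN_deriv \<mu> \<nu> x))) in
          enn2ereal (\<integral>\<^sup>+ x. ennreal (f x) \<partial>\<nu>) - enn2ereal (\<integral>\<^sup>+ x. ennreal (- f x) \<partial>\<nu>))
      else \<infinity>)"

end

theory Submission
  imports Defs "HOL-Real_Asymp.Real_Asymp"
begin

text \<open>
  From transport to concentration: testing the transport inequality on \<open>d\<nu> = exp (a Qg) / Z d\<mu>\<close>, where
  \<open>Qg x = inf\<^sub>y (g y + |x - y|\<^sup>2)\<close>, gives \<open>\<integral> exp (a Qg) d\<mu> \<le> exp (a \<integral> g d\<mu>)\<close>, a form that tensorizes by Fubini.
  On the product, \<open>Q (t h) \<ge> t h - t\<^sup>2 / 4\<close> for a 1-Lipschitz \<open>h\<close>, which yields Gaussian deviations with constant \<open>a\<close>;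
  applied to the distance from \<open>A\<close> and its negative they give concentration with \<open>r\<^sub>o = sqrt (ln 2 / a)\<close> and \<open>b = 1\<close>.

  From concentration to transport: let \<open>H\<close> be the relative entropy of \<open>\<nu>\<close>. By the weak law of large numbers the points
  \<open>x\<close> that are typical for \<open>\<nu>\<^sup>n\<close> have \<open>\<mu>\<^sup>n\<close>-measure about \<open>exp (- n H)\<close>, which exceeds the measure of the complement of
  \<open>A + r B\<^sub>2\<close> for \<open>r\<close> slightly larger than \<open>sqrt (n H / a)\<close> and \<open>A\<close> the set of points typical for \<open>\<mu>\<^sup>n\<close>. So some typical
  \<open>x\<close> lies within \<open>r\<close> of some typical \<open>y\<close>, and the pairs \<open>(x\<^sub>k, y\<^sub>k)\<close> almost couple \<open>\<nu>\<close> and \<open>\<mu>\<close> at cost \<open>r\<^sup>2 / n\<close>.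
  Spreading each pair over small cells turns them into an exact coupling of nearly the same cost.
\<close>

section \<open>Analytic sets are universally measurable\<close>

text \<open>The same \<open>a\<close> stands on both sides, so neither direction may lose a factor.
  Towards transport this is saved by the dimension-free form: \<open>r\<^sub>o\<close> and
  \<open>b\<close> are fixed while the relevant radius grows like \<open>sqrt n\<close>, so they
  disappear after division by \<open>n\<close>. Towards concentration only the elementary half of
  Kantorovich duality enters, with the pair \<open>Qg\<close>, \<open>g\<close>, and the entropy of
  the tilted measure cancels the integral of \<open>Qg\<close> exactly. Two obstacles shape the
  rest. The quadratic cost is unbounded, so a coupling that is right up to a small mass may still be
  expensive; concentration for \<open>n = 1\<close> gives Gaussian tails, and finite entropy carries
  a second moment over from \<mu> to \<nu>, which makes the leftover mass cheap. And an enlargement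
  is a projection of a Borel set, so its measure has to be read in the completion; this is why
  analytic sets and Choquet's capacity argument come in.\<close>

definition souslin :: "'b::topological_space set \<Rightarrow> bool" where
  "souslin A \<longleftrightarrow> (\<exists>F::('b \<times> (nat \<Rightarrow> nat)) set. closed F \<and> A = fst ` F)"

lemma souslin_closed:
  assumes "closed A" shows "souslin A"
  unfolding souslin_def
  by (rule exI[of _ "A \<times> UNIV"]) (use assms in \<open>auto intro: closed_Times\<close>)

lemma closed_coordinate_eq: "closed {p :: 'b::topological_space \<times> (nat \<Rightarrow> nat). snd p i \<in> S}"
proof -
  have "continuous_on UNIV (\<lambda>p :: 'b \<times> (nat \<Rightarrow> nat). snd p i)"
    by (rule continuous_on_product_then_coordinatewise[OF continuous_on_snd[OF continuous_on_id]])
  moreover have "closed S"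
    unfolding closed_def by (rule discrete_topology_class.open_discrete)
  ultimately have "closed ((\<lambda>p :: 'b \<times> (nat \<Rightarrow> nat). snd p i) -` S)"
    using closed_vimage by blast
  then show ?thesis by (simp add: vimage_def)
qed

lemma closed_reindex:
  fixes F :: "('b::topological_space \<times> (nat \<Rightarrow> nat)) set" and h :: "nat \<Rightarrow> nat"
  assumes "closed F"
  shows "closed {p. (fst p, \<lambda>j. snd p (h j)) \<in> F}"
proof -
  have "continuous_on UNIV (\<lambda>p :: 'b \<times> (nat \<Rightarrow> nat). (fst p, \<lambda>j. snd p (h j)))"
    by (intro continuous_intros continuous_on_coordinatewise_then_product
        continuous_on_product_then_coordinatewise[OF continuous_on_snd])
  then have "closed ((\<lambda>p :: 'b \<times> (nat \<Rightarrow> nat). (fst p, \<lambda>j. snd p (h j))) -` F)"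
    using assms closed_vimage by blast
  then show ?thesis by (simp add: vimage_def)
qed

text \<open>Entry 0 of the sequence names the set, and the shifted sequence is the witness for
  it.\<close>

lemma souslin_UN:
  fixes A :: "nat \<Rightarrow> 'b::topological_space set"
  assumes "\<And>i. souslin (A i)"
  shows "souslin (\<Union>i. A i)"
proof -
  obtain F where F: "\<And>i. closed (F i :: ('b \<times> (nat \<Rightarrow> nat)) set)" "\<And>i. A i = fst ` F i"
    using assms unfolding souslin_def by metis
  define G where "G = {p. (fst p, \<lambda>j. snd p (Suc j)) \<in> F (snd p 0)}"
  \<comment> \<open>The named index varies with the point, so membership in
    \<open>F (snd p 0)\<close> is rewritten as one closed condition for each \<open>i\<close>:
    another index is named, or the witness is good.\<close>
  have "G = (\<Inter>i. {p. snd p 0 \<in> -{i}} \<union> {p. (fst p, \<lambda>j. snd p (Suc j)) \<in> F i})"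
    by (auto simp: G_def)
  then have "closed G"
    by (simp only:) (intro closed_INT ballI closed_Un closed_coordinate_eq closed_reindex F)
  moreover have "(\<Union>i. A i) = fst ` G"
  proof (intro equalityI subsetI)
    fix x assume "x \<in> (\<Union>i. A i)"
    then obtain i s where "(x, s) \<in> F i" by (auto simp: F)
    then have "(x, case_nat i s) \<in> G" by (simp add: G_def)
    then show "x \<in> fst ` G" by force
  qed (force simp: G_def F)
  ultimately show ?thesis unfolding souslin_def by blast
qed

text \<open>One sequence codes a witness for every \<open>i\<close> at once, the one for
  \<open>i\<close> along the pairs \<open>prod_encode (i, j)\<close>.\<close>

lemma souslin_INT:
  fixes A :: "nat \<Rightarrow> 'b::topological_space set"
  assumes "\<And>i. souslin (A i)"
  shows "souslin (\<Inter>i. A i)"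
proof -
  obtain F where F: "\<And>i. closed (F i :: ('b \<times> (nat \<Rightarrow> nat)) set)" "\<And>i. A i = fst ` F i"
    using assms unfolding souslin_def by metis
  define G where "G = (\<Inter>i. {p. (fst p, \<lambda>j. snd p (prod_encode (i, j))) \<in> F i})"
  have "closed G"
    unfolding G_def by (intro closed_INT ballI closed_reindex F)
  moreover have "(\<Inter>i. A i) = fst ` G"
  proof (intro equalityI subsetI)
    fix x assume "x \<in> (\<Inter>i. A i)"
    then have "\<exists>s. (x, s) \<in> F i" for i by (force simp: F)
    then obtain s where "\<And>i. (x, s i) \<in> F i" by metis
    then have "(x, \<lambda>n. case prod_decode n of (i, j) \<Rightarrow> s i j) \<in> G" by (simp add: G_def)
    then show "x \<in> fst ` G" by force
  qed (force simp: G_def F)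
  ultimately show ?thesis unfolding souslin_def by blast
qed

text \<open>In a metric space an open set is the union of the closed sets of points at distance at
  least \<open>1 / Suc n\<close> from the complement. The whole space is split off because the
  distance to the empty set is \<open>0\<close> by convention.\<close>

lemma souslin_open:
  fixes A :: "'b::metric_space set"
  assumes "open A" shows "souslin A"
proof (cases "A = UNIV")
  case False
  then have ne: "-A \<noteq> {}" by auto
  have "A = (\<Union>n. {x. infdist x (-A) \<ge> 1 / Suc n})"
  proof (intro equalityI subsetI)
    fix x assume "x \<in> A"
    then have "infdist x (-A) > 0"
      using in_closed_iff_infdist_zero[of "-A" x] ne assms
      by (simp add: closed_Compl less_le infdist_nonneg)
    then obtain n where "1 / Suc n < infdist x (-A)"
      by (metis nat_approx_posE)
    then show "x \<in> (\<Union>n. {x. infdist x (-A) \<ge> 1 / Suc n})" by (auto intro!: exI[of _ n])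
  next
    fix x assume "x \<in> (\<Union>n. {x. infdist x (-A) \<ge> 1 / Suc n})"
    then obtain n where "infdist x (-A) \<ge> 1 / Suc n" by auto
    moreover have "1 / real (Suc n) > 0" by simp
    ultimately have "infdist x (-A) \<noteq> 0" by linarith
    then show "x \<in> A" using infdist_zero[of x "-A"] by blast
  qed
  moreover have "souslin {x. infdist x (-A) \<ge> c}" for c
    by (intro souslin_closed closed_Collect_le continuous_intros)
  then have "souslin (\<Union>n. {x. infdist x (-A) \<ge> 1 / Suc n})" by (intro souslin_UN)
  ultimately show ?thesis by simp
qed (simp add: souslin_closed)

text \<open>Complements of analytic sets need not be analytic, so the induction carries
  \<open>A\<close> and its complement together; complementation then only swaps the two.\<close>

lemma souslin_borel:
  fixes A :: "'b::metric_space set"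
  assumes "A \<in> sets borel" shows "souslin A"
proof -
  have "A \<in> sigma_sets UNIV {S. open S}"
    using assms by (simp add: borel_def)
  then have "souslin A \<and> souslin (-A)"
  proof induct
    case (Union a)
    then show ?case by (auto simp: Compl_UN intro!: souslin_UN souslin_INT)
  qed (auto simp: souslin_open souslin_closed closed_Compl Compl_eq_Diff_UNIV[symmetric])
  then show ?thesis ..
qed

section \<open>Inner approximation of analytic sets by closed sets\<close>

text \<open>Coordinate \<open>i\<close> is bounded by \<open>m i\<close> from term
  \<open>i + 1\<close> on. The finitely many earlier terms go into the maximum \<open>B i\<close>,
  so the whole sequence lies in a product of finite sets, compact by Tychonoff.\<close>

lemma bounded_coordinates_subseq:
  fixes s :: "nat \<Rightarrow> nat \<Rightarrow> nat"
  assumes "\<And>i k. i < k \<Longrightarrow> s k i \<le> m i"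
  obtains l r where "strict_mono (r :: nat \<Rightarrow> nat)" "(s \<circ> r) \<longlonglongrightarrow> l"
proof -
  define B where "B i = Max (insert (m i) ((\<lambda>k. s k i) ` {..i}))" for i
  have sB: "s k i \<le> B i" for k i
  proof (cases "i < k")
    case True
    then have "s k i \<le> m i" by (rule assms)
    also have "\<dots> \<le> B i" unfolding B_def by (intro Max_ge) auto
    finally show ?thesis .
  next
    case False
    then show ?thesis unfolding B_def by (intro Max_ge) auto
  qed
  have "compactin (product_topology (\<lambda>_. euclidean) UNIV) (PiE UNIV (\<lambda>i. {..B i}))"
    by (subst compactin_PiE) (auto intro: finite_imp_compact)
  then have "compact (PiE UNIV (\<lambda>i. {..B i}))"
    by (simp add: euclidean_product_topology)
  then have "seq_compact (PiE UNIV (\<lambda>i. {..B i}))"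
    by (rule compact_imp_seq_compact)
  moreover have "\<forall>k. s k \<in> PiE UNIV (\<lambda>i. {..B i})" using sB by (auto simp: PiE_UNIV_domain)
  ultimately show ?thesis
    using that unfolding seq_compact_def by blast
qed

text \<open>Choquet's capacity argument: bounding the coordinates of the Baire space one at a time loses no outer
  measure above \<open>t\<close>, and in the limit the bounded sequences form a compact set.\<close>

lemma closed_inner_approx_souslin:
  fixes F :: "('b::metric_space \<times> (nat \<Rightarrow> nat)) set"
  assumes M: "finite_measure M" "sets M = sets borel" and "closed F"
    and t: "t < outer_measure_of M (fst ` F)"
  obtains D where "closed D" "D \<subseteq> fst ` F" "t \<le> emeasure M D"
proof -
  interpret finite_measure M by fact
  have sp: "space M = UNIV" using M(2) sets_eq_imp_space_eq by fastforce
  have "\<exists>S. \<forall>k. (t < outer_measure_of M (fst ` S k) \<and> (k = 0 \<longrightarrow> S k = F)) \<and>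
      (\<exists>j. S (Suc k) = S k \<inter> {p. snd p k \<le> j})"
  proof (rule dependent_nat_choice, goal_cases)
    case 1 then show ?case using t by auto
  next
    case (2 S k)
    define A where "A j = fst ` (S \<inter> {p. snd p k \<le> j})" for j
    have inc: "incseq A" unfolding A_def incseq_def by (auto intro!: image_mono)
    \<comment> \<open>Continuity from below holds for the outer measure of arbitrary increasing
      sets, measurable or not. The inequality with \<open>t\<close> is kept strict so that it
      already holds at some finite \<open>j\<close>.\<close>
    have "(SUP j. outer_measure_of M (A j)) = outer_measure_of M (\<Union>j. A j)"
      using inc by (intro SUP_outer_measure_of_incseq) (auto simp: sp)
    also have "(\<Union>j. A j) = fst ` S" by (force simp: A_def)
    finally have "t < (SUP j. outer_measure_of M (A j))" using 2 by simp
    then obtain j where "t < outer_measure_of M (A j)" by (auto simp: less_SUP_iff)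
    then show ?case unfolding A_def by auto
  qed
  then obtain S where S: "\<And>k. t < outer_measure_of M (fst ` S k)" "S 0 = F"
    "\<And>k. \<exists>j. S (Suc k) = S k \<inter> {p. snd p k \<le> j}" by blast
  then obtain m where m: "\<And>k. S (Suc k) = S k \<inter> {p. snd p k \<le> m k}" by metis
  have S_eq: "S k = F \<inter> {p. \<forall>i<k. snd p i \<le> m i}" for k
    by (induction k) (auto simp: S m less_Suc_eq)
  \<comment> \<open>Closures give measurable sets with continuity from above. They add no point
    outside the projection: points close to \<open>x\<close> have witnesses with more and more
    bounded coordinates, and these have a convergent subsequence.\<close>
  define D where "D = (\<Inter>k. closure (fst ` S k))"
  have "closed D" unfolding D_def by auto
  moreover have "D \<subseteq> fst ` F"
  proof
    fix x assume "x \<in> D"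
    then have "x \<in> closure (fst ` S k)" for k by (auto simp: D_def)
    then have "\<exists>p\<in>S k. dist (fst p) x < 1 / Suc k" for k
      unfolding closure_approachable by (metis (no_types, lifting) imageE of_nat_0_less_iff zero_less_Suc zero_less_divide_1_iff)
    then obtain p where p: "\<And>k. p k \<in> S k" "\<And>k. dist (fst (p k)) x < 1 / Suc k" by metis
    have "(\<lambda>k. fst (p k)) \<longlonglongrightarrow> x"
    proof (rule metric_LIMSEQ_I)
      fix e :: real assume "e > 0"
      then obtain N where N: "1 / real (Suc N) < e" by (metis nat_approx_posE)
      have "dist (fst (p k)) x < e" if "k \<ge> N" for k
      proof -
        have "1 / real (Suc k) \<le> 1 / real (Suc N)" using that by (intro divide_left_mono) auto
        then show ?thesis using p(2)[of k] N by linarith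
      qed
      then show "\<exists>N. \<forall>k\<ge>N. dist (fst (p k)) x < e" by blast
    qed
    moreover have "snd (p k) i \<le> m i" if "i < k" for i k
      using p(1)[of k] that by (auto simp: S_eq)
    then obtain l r where r: "strict_mono (r :: nat \<Rightarrow> nat)" "((\<lambda>k. snd (p k)) \<circ> r) \<longlonglongrightarrow> l"
      by (rule bounded_coordinates_subseq)
    ultimately have "(\<lambda>k. (fst (p (r k)), snd (p (r k)))) \<longlonglongrightarrow> (x, l)"
      using LIMSEQ_subseq_LIMSEQ[of "\<lambda>k. fst (p k)" x r] by (intro tendsto_Pair) (simp_all add: o_def)
    moreover have "\<forall>k. (fst (p (r k)), snd (p (r k))) \<in> F" using p(1) by (simp add: S_eq)
    ultimately have "(x, l) \<in> F" using closed_sequentially[OF \<open>closed F\<close>, of "\<lambda>k. (fst (p (r k)), snd (p (r k)))"] by simp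
    then show "x \<in> fst ` F" by force
  qed
  moreover have "t \<le> emeasure M D"
  proof -
    have "(\<lambda>k. emeasure M (closure (fst ` S k))) \<longlonglongrightarrow> emeasure M (\<Inter>k. closure (fst ` S k))"
      by (intro Lim_emeasure_decseq) (auto simp: M decseq_def S_eq intro!: closure_mono image_mono)
    moreover have "t \<le> emeasure M (closure (fst ` S k))" for k
    proof -
      have "t < outer_measure_of M (fst ` S k)" by (rule S)
      also have "\<dots> \<le> outer_measure_of M (closure (fst ` S k))"
        by (intro outer_measure_of_mono closure_subset)
      finally show ?thesis by (simp add: M)
    qed
    ultimately show ?thesis unfolding D_def by (meson LIMSEQ_le_const)
  qed
  ultimately show ?thesis by (rule that)
qed

text \<open>A measurable hull \<open>E\<close> and closed subsets of \<open>A\<close> whose measures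
  approach that of \<open>E\<close> squeeze \<open>A\<close> up to a null set.\<close>

lemma souslin_in_completion:
  fixes A :: "'b::metric_space set"
  assumes M: "finite_measure M" "sets M = sets borel" and "souslin A"
  shows "A \<in> sets (completion M)"
proof -
  interpret finite_measure M by fact
  have sp: "space M = UNIV" using M(2) sets_eq_imp_space_eq by fastforce
  obtain F :: "('b \<times> (nat \<Rightarrow> nat)) set" where F: "closed F" "A = fst ` F"
    using \<open>souslin A\<close> unfolding souslin_def by blast
  obtain E where E: "E \<in> sets M" "A \<subseteq> E" "outer_measure_of M A = emeasure M E"
    using outer_measure_of_attain[of A M] sp by auto
  have "\<exists>D. closed D \<and> D \<subseteq> A \<and> measure M E - 1 / Suc n \<le> measure M D" for n
  proof (cases "measure M E - 1 / Suc n < 0")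
    \<comment> \<open>A negative bound is met by the empty set; \<open>ennreal\<close> would round
      it up to \<open>0\<close>, where strictness may fail.\<close>
    case True
    then show ?thesis by (intro exI[of _ "{}"]) auto
  next
    case False
    have "ennreal (measure M E - 1 / Suc n) < ennreal (measure M E)"
      using False by (intro ennreal_lessI) (auto simp: not_less intro: less_le_trans[of 0 "1 / real (Suc n)"])
    then have "ennreal (measure M E - 1 / Suc n) < outer_measure_of M (fst ` F)"
      using E F by (simp add: emeasure_eq_measure)
    from closed_inner_approx_souslin[OF M F(1) this] obtain D where
      "closed D" "D \<subseteq> fst ` F" "ennreal (measure M E - 1 / Suc n) \<le> emeasure M D" by blast
    then show ?thesis using F(2) False by (auto simp: emeasure_eq_measure)
  qed
  then obtain D where D: "\<And>n. closed (D n)" "\<And>n. D n \<subseteq> A" "\<And>n. measure M E - 1 / Suc n \<le> measure M (D n)"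
    by metis
  have DM: "(\<Union>n. D n) \<in> sets M" by (auto simp: M D)
  have "measure M (E - (\<Union>n. D n)) \<le> 0"
  proof (rule field_le_epsilon)
    fix e :: real assume "e > 0"
    then obtain n where n: "1 / real (Suc n) < e" by (metis nat_approx_posE)
    have Dn: "D n \<in> sets M" by (simp add: M D)
    have "measure M (E - (\<Union>n. D n)) \<le> measure M (E - D n)"
      using E Dn by (intro finite_measure_mono) auto
    also have "\<dots> = measure M E - measure M (D n)"
      using E D(2)[of n] Dn by (intro finite_measure_Diff) auto
    also have "\<dots> \<le> 0 + e" using D(3)[of n] n by linarith
    finally show "measure M (E - (\<Union>n. D n)) \<le> 0 + e" .
  qed
  then have "measure M (E - (\<Union>n. D n)) = 0" by (intro antisym) simp_all
  then have "E - (\<Union>n. D n) \<in> null_sets M"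
    using E(1) DM by (intro null_setsI) (auto simp: emeasure_eq_measure)
  then show ?thesis
    by (rule sets_completionI[rotated 2, OF _ DM, where N="A - (\<Union>n. D n)"]) (use D E in auto)
qed

section \<open>Infimal convolution and tensorization\<close>

lemma l2dist_L2_set: "l2dist n x y = L2_set (\<lambda>i. norm (x i - y i)) {..<n}"
  by (simp add: l2dist_def L2_set_def)

lemma l2dist_nonneg [simp]: "0 \<le> l2dist n x y"
  by (simp add: l2dist_def sum_nonneg)

lemma l2dist_self [simp]: "l2dist n x x = 0"
  by (simp add: l2dist_def)

lemma l2dist_commute: "l2dist n x y = l2dist n y x"
  by (simp add: l2dist_def norm_minus_commute)

lemma l2dist_triangle: "l2dist n x z \<le> l2dist n x y + l2dist n y z"
proof -
  have "l2dist n x z \<le> L2_set (\<lambda>i. norm (x i - y i) + norm (y i - z i)) {..<n}"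
    unfolding l2dist_L2_set
    by (intro L2_set_mono norm_ge_zero norm_diff_triangle_le[OF order_refl order_refl])
  also have "\<dots> \<le> l2dist n x y + l2dist n y z"
    unfolding l2dist_L2_set by (rule L2_set_triangle_ineq)
  finally show ?thesis .
qed

lemma l2dist_sq: "(l2dist n x y)\<^sup>2 = (\<Sum>i<n. (norm (x i - y i))\<^sup>2)"
  by (simp add: l2dist_def sum_nonneg)

text \<open>The distance is a parameter because \<open>l2dist n\<close> is only a pseudometric: it
  ignores the entries from \<open>n\<close> on. For symmetric \<open>d\<close> the one-sided
  inequality is the usual Lipschitz condition.\<close>

definition bdd_lipschitz :: "('b \<Rightarrow> 'b \<Rightarrow> real) \<Rightarrow> ('b \<Rightarrow> real) \<Rightarrow> bool" where
  "bdd_lipschitz d f \<longleftrightarrow> (\<exists>B. \<forall>x. \<bar>f x\<bar> \<le> B) \<and> (\<exists>L\<ge>0. \<forall>x y. f x \<le> f y + L * d x y)"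

lemma bdd_lipschitzI:
  assumes "\<And>x. \<bar>f x\<bar> \<le> B" "L \<ge> 0" "\<And>x y. f x \<le> f y + L * d x y"
  shows "bdd_lipschitz d f"
  using assms unfolding bdd_lipschitz_def by metis

text \<open>The Hopf-Lax or Moreau envelope for the cost \<open>d\<^sup>2\<close>. For bounded
  \<open>f\<close>, the difference \<open>inf_conv d f x - f y\<close> is at most the cost of
  \<open>(x, y)\<close>, so the two functions are an admissible pair in Kantorovich duality.\<close>

definition inf_conv :: "('b \<Rightarrow> 'b \<Rightarrow> real) \<Rightarrow> ('b \<Rightarrow> real) \<Rightarrow> 'b \<Rightarrow> real" where
  "inf_conv d f x = (INF y. f y + (d x y)\<^sup>2)"

lemma inf_conv_le:
  assumes "bdd_lipschitz d f"
  shows "inf_conv d f x \<le> f y + (d x y)\<^sup>2"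
proof -
  obtain B where B: "\<And>x. \<bar>f x\<bar> \<le> B" using assms unfolding bdd_lipschitz_def by metis
  have "-B \<le> f y + (d x y)\<^sup>2" for y using B[of y] zero_le_power2[of "d x y"] by linarith
  then show ?thesis
    unfolding inf_conv_def by (intro cINF_lower bdd_belowI2[where m="-B"]) auto
qed

lemma le_inf_conv: "(\<And>y. c \<le> f y + (d x y)\<^sup>2) \<Longrightarrow> c \<le> inf_conv d f x"
  unfolding inf_conv_def by (intro cINF_greatest) auto

text \<open>The squared distance is not Lipschitz, but moving \<open>y\<close> along with
  \<open>x\<close> leaves it unchanged. This is what \<open>translate\<close> provides, and the
  constant \<open>L\<close> of \<open>f\<close> is preserved.\<close>

lemma bdd_lipschitz_inf_conv:
  assumes f: "bdd_lipschitz d f"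
    and refl: "\<And>x. d x x = 0"
    and translate: "\<And>x x' y. \<exists>y'. d x' y' = d x y \<and> d y' y \<le> d x' x"
  shows "bdd_lipschitz d (inf_conv d f)"
proof -
  obtain B L where BL: "\<And>x. \<bar>f x\<bar> \<le> B" "L \<ge> 0" "\<And>x y. f x \<le> f y + L * d x y"
    using f unfolding bdd_lipschitz_def by metis
  show ?thesis
  proof (rule bdd_lipschitzI)
    fix x
    have "-B \<le> inf_conv d f x"
    proof (rule le_inf_conv)
      fix y show "-B \<le> f y + (d x y)\<^sup>2"
        using BL(1)[of y] zero_le_power2[of "d x y"] by linarith
    qed
    moreover have "inf_conv d f x \<le> B" using inf_conv_le[OF f, of x x] BL(1)[of x] by (simp add: refl)
    ultimately show "\<bar>inf_conv d f x\<bar> \<le> B" by linarith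
  next
    fix x' x
    have "inf_conv d f x' - L * d x' x \<le> inf_conv d f x"
    proof (rule le_inf_conv)
      fix y
      obtain y' where y': "d x' y' = d x y" "d y' y \<le> d x' x" using translate by blast
      have "inf_conv d f x' \<le> f y' + (d x' y')\<^sup>2" by (rule inf_conv_le[OF f])
      also have "f y' \<le> f y + L * d y' y" by (rule BL)
      also have "L * d y' y \<le> L * d x' x" using y' BL by (intro mult_left_mono) auto
      finally show "inf_conv d f x' - L * d x' x \<le> f y + (d x y)\<^sup>2" using y' by simp
    qed
    then show "inf_conv d f x' \<le> inf_conv d f x + L * d x' x" by simp
  qed fact
qed

lemma bdd_lipschitz_inf_conv_dist:
  fixes f :: "'a::real_normed_vector \<Rightarrow> real"
  assumes "bdd_lipschitz dist f" shows "bdd_lipschitz dist (inf_conv dist f)"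
proof (rule bdd_lipschitz_inf_conv[OF assms])
  fix x x' y :: 'a
  show "\<exists>y'. dist x' y' = dist x y \<and> dist y' y \<le> dist x' x"
    by (rule exI[of _ "y + (x' - x)"]) (simp add: dist_norm)
qed simp

lemma bdd_lipschitz_inf_conv_l2dist:
  assumes "bdd_lipschitz (l2dist n) f" shows "bdd_lipschitz (l2dist n) (inf_conv (l2dist n) f)"
proof (rule bdd_lipschitz_inf_conv[OF assms])
  fix x x' y :: "nat \<Rightarrow> 'a"
  show "\<exists>y'. l2dist n x' y' = l2dist n x y \<and> l2dist n y' y \<le> l2dist n x' x"
    by (rule exI[of _ "\<lambda>i. y i + (x' i - x i)"]) (simp add: l2dist_def)
qed simp

section \<open>Measurability of Lipschitz functions\<close>

lemma bdd_lipschitz_dist_measurable: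
  assumes "bdd_lipschitz dist f" shows "f \<in> borel_measurable borel"
proof -
  obtain B L where BL: "L \<ge> 0" "\<And>x y. f x \<le> f y + L * dist x y"
    using assms unfolding bdd_lipschitz_def by metis
  have "L-lipschitz_on UNIV f"
  proof (rule lipschitz_onI)
    fix x y show "dist (f x) (f y) \<le> L * dist x y"
      using BL(2)[of x y] BL(2)[of y x] by (simp add: dist_real_def dist_commute abs_le_iff)
  qed fact
  then show ?thesis
    by (intro borel_measurable_continuous_onI) (rule lipschitz_on_continuous_on)
qed

lemma space_prodn: "sets \<mu> = sets borel \<Longrightarrow> space (prodn n \<mu>) = PiE {..<n} (\<lambda>_. UNIV)"
  by (auto simp: prodn_def space_PiM dest: sets_eq_imp_space_eq)

text \<open>The product measure lives on functions that are \<open>undefined\<close> outside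
  \<open>{..<n}\<close>. This map compares its sigma-algebra with the Borel sets of the full
  function space, where topological arguments apply.\<close>

lemma id_measurable_prodn:
  fixes \<mu> :: "'a::euclidean_space measure"
  assumes "sets \<mu> = sets borel"
  shows "(\<lambda>x. x) \<in> measurable (prodn n \<mu>) (borel :: (nat \<Rightarrow> 'a) measure)"
proof (rule measurable_coordinatewise_then_product)
  fix i
  show "(\<lambda>x. x i) \<in> borel_measurable (prodn n \<mu>)"
  proof (cases "i < n")
    case True
    then have "(\<lambda>x. x i) \<in> measurable (prodn n \<mu>) \<mu>"
      unfolding prodn_def by (intro measurable_component_singleton) auto
    then show ?thesis using assms measurable_cong_sets by blast
  next
    case False
    then have undef: "x i = undefined" if "x \<in> space (prodn n \<mu>)" for x
      using PiE_arb[of x "{..<n}" "\<lambda>_. UNIV" i] that by (simp add: space_prodn[OF assms])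
    have "(\<lambda>_. undefined) \<in> borel_measurable (prodn n \<mu>)" by (rule measurable_const) simp
    then show ?thesis by (subst measurable_cong[OF undef])
  qed
qed

lemma continuous_on_l2dist: "continuous_on UNIV (\<lambda>x. l2dist n x y)"
  unfolding l2dist_def
  by (intro continuous_intros continuous_on_product_coordinates)

text \<open>\<open>l2dist n x y\<close> tends to \<open>0\<close> as \<open>x\<close> tends to
  \<open>y\<close> in the product topology, so a function that is Lipschitz for this pseudometric is
  continuous there.\<close>

lemma bdd_lipschitz_l2dist_measurable:
  fixes \<mu> :: "'a::euclidean_space measure"
  assumes f: "bdd_lipschitz (l2dist n) f" and \<mu>: "sets \<mu> = sets borel"
  shows "f \<in> borel_measurable (prodn n \<mu>)"
proof -
  obtain B L where BL: "L \<ge> 0" "\<And>x y. f x \<le> f y + L * l2dist n x y"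
    using f unfolding bdd_lipschitz_def by metis
  have "(f \<longlongrightarrow> f y) (at y)" for y
  proof -
    have "((\<lambda>x. L * l2dist n x y) \<longlongrightarrow> L * l2dist n y y) (at y)"
      using continuous_on_l2dist[of n y] unfolding continuous_on_def by (intro tendsto_intros) blast
    moreover have "dist (f x) (f y) \<le> L * l2dist n x y" for x
      using BL(2)[of x y] BL(2)[of y x] by (simp add: dist_real_def l2dist_commute[of n y x] abs_le_iff)
    ultimately have "((\<lambda>x. dist (f x) (f y)) \<longlongrightarrow> 0) (at y)"
      by (intro tendsto_sandwich[of "\<lambda>_. 0" "\<lambda>x. dist (f x) (f y)" "at y" "\<lambda>x. L * l2dist n x y"]) auto
    then show ?thesis by (subst tendsto_dist_iff)
  qed
  then have "f \<in> borel_measurable borel"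
    by (intro borel_measurable_continuous_onI) (auto simp: continuous_on_def)
  from measurable_compose[OF id_measurable_prodn[OF \<mu>] this] show ?thesis .
qed

section \<open>Tensorization over the coordinates\<close>

lemma prob_space_prodn: "prob_space \<mu> \<Longrightarrow> prob_space (prodn n \<mu>)"
  unfolding prodn_def by (rule prob_space_PiM)

text \<open>Fubini works if one takes the infimal convolution in the last coordinate first.\<close>

lemma exp_inf_conv_prodn:
  fixes \<mu> :: "'a::euclidean_space measure" and f :: "(nat \<Rightarrow> 'a) \<Rightarrow> real"
  assumes \<mu>: "prob_space \<mu>" "sets \<mu> = sets borel" and a: "a > 0"
    and one: "\<And>g. bdd_lipschitz dist g \<Longrightarrow>
      (\<integral>\<^sup>+x. ennreal (exp (a * inf_conv dist g x)) \<partial>\<mu>) \<le> ennreal (exp (a * (\<integral>x. g x \<partial>\<mu>)))"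
    and f: "bdd_lipschitz (l2dist n) f"
  shows "(\<integral>\<^sup>+x. ennreal (exp (a * inf_conv (l2dist n) f x)) \<partial>prodn n \<mu>)
    \<le> ennreal (exp (a * (\<integral>x. f x \<partial>prodn n \<mu>)))"
  using f
proof (induction n arbitrary: f)
  case 0
  obtain B L where BL: "L \<ge> 0" "\<And>x y. f x \<le> f y + L * l2dist 0 x y"
    using 0 unfolding bdd_lipschitz_def by metis
  \<comment> \<open>For \<open>n = 0\<close> the distance vanishes identically, so a Lipschitz
    function is constant.\<close>
  have eq: "f x = f (\<lambda>_. undefined)" for x
    using BL(2)[of x "\<lambda>_. undefined"] BL(2)[of "\<lambda>_. undefined" x] by (simp add: l2dist_def)
  interpret P: prob_space "prodn 0 \<mu>" by (rule prob_space_prodn) fact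
  have "inf_conv (l2dist 0) f x \<le> f (\<lambda>_. undefined)" for x
    using inf_conv_le[OF 0, of x x] eq[of x] by simp
  then have "(\<integral>\<^sup>+x. ennreal (exp (a * inf_conv (l2dist 0) f x)) \<partial>prodn 0 \<mu>)
      \<le> (\<integral>\<^sup>+x. ennreal (exp (a * f (\<lambda>_. undefined))) \<partial>prodn 0 \<mu>)"
    using a by (intro nn_integral_mono ennreal_leI) simp
  also have "\<dots> = ennreal (exp (a * f (\<lambda>_. undefined)))" by (simp add: P.emeasure_space_1)
  also have "f (\<lambda>_. undefined) = (\<integral>x. f x \<partial>prodn 0 \<mu>)"
    by (subst (2) eq) (simp add: P.prob_space)
  finally show ?case .
next
  case (Suc n)
  interpret mu: prob_space \<mu> by fact
  interpret P: prob_space "prodn n \<mu>" by (rule prob_space_prodn) fact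
  interpret PS: prob_space "prodn (Suc n) \<mu>" by (rule prob_space_prodn) fact
  interpret PP: pair_prob_space "prodn n \<mu>" \<mu> ..
  interpret S: product_sigma_finite "\<lambda>_::nat. \<mu>" by standard
  have ins: "prodn (Suc n) \<mu> = PiM (insert n {..<n}) (\<lambda>_. \<mu>)"
    by (simp add: prodn_def lessThan_Suc)
  have upd: "(\<lambda>(x, t). x(n := t)) \<in> measurable (prodn n \<mu> \<Otimes>\<^sub>M \<mu>) (prodn (Suc n) \<mu>)"
    unfolding ins unfolding prodn_def by (rule measurable_add_dim)
  note fSuc = Suc.prems
  obtain B L where BL: "\<And>x. \<bar>f x\<bar> \<le> B" "L \<ge> 0" "\<And>x y. f x \<le> f y + L * l2dist (Suc n) x y"
    using fSuc unfolding bdd_lipschitz_def by metis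
  have fx: "bdd_lipschitz dist (\<lambda>t. f (x(n := t)))" for x
  proof (rule bdd_lipschitzI[OF BL(1) BL(2)])
    fix s t
    have "l2dist (Suc n) (x(n := s)) (x(n := t)) = dist s t"
      by (simp add: l2dist_def dist_norm)
    then show "f (x(n := s)) \<le> f (x(n := t)) + L * dist s t" using BL(3)[of "x(n := s)" "x(n := t)"] by simp
  qed
  have upd_dist: "l2dist (Suc n) (x(n := t)) (y(n := t)) = l2dist n x y" for x y t
    by (simp add: l2dist_def)
  have ft: "bdd_lipschitz (l2dist n) (\<lambda>x. f (x(n := t)))" for t
    by (intro bdd_lipschitzI[OF BL(1) BL(2)]) (metis BL(3) upd_dist)
  \<comment> \<open>\<open>G t\<close> convolves in the last coordinate with the others frozen;
    \<open>F\<close> averages the others out. The induction hypothesis is used for each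
    \<open>G t\<close>, the one-dimensional inequality for \<open>F\<close>.\<close>
  define G where "G t x = inf_conv dist (\<lambda>t. f (x(n := t))) t" for t x
  define F where "F t = (\<integral>x. f (x(n := t)) \<partial>prodn n \<mu>)" for t
  have int_ft: "integrable (prodn n \<mu>) (\<lambda>x. f (x(n := t)))" for t
    using BL(1) by (intro P.integrable_const_bound[where B=B] bdd_lipschitz_l2dist_measurable ft \<mu>) auto
  have G: "bdd_lipschitz (l2dist n) (G t)" for t
  proof (rule bdd_lipschitzI[of _ B L])
    fix x
    have "-B \<le> G t x" unfolding G_def
    proof (rule le_inf_conv)
      fix y show "-B \<le> f (x(n := y)) + (dist t y)\<^sup>2"
        using BL(1)[of "x(n := y)"] zero_le_power2[of "dist t y"] by linarith
    qed
    moreover have "G t x \<le> B"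
      using inf_conv_le[OF fx, of x t t] BL(1)[of "x(n := t)"] unfolding G_def by simp
    ultimately show "\<bar>G t x\<bar> \<le> B" by linarith
  next
    fix x x'
    have "G t x - L * l2dist n x x' \<le> G t x'"
      unfolding G_def[of t x']
    proof (rule le_inf_conv)
      fix s
      have "G t x \<le> f (x(n := s)) + (dist t s)\<^sup>2" unfolding G_def by (rule inf_conv_le[OF fx])
      then show "G t x - L * l2dist n x x' \<le> f (x'(n := s)) + (dist t s)\<^sup>2"
        using BL(3)[of "x(n := s)" "x'(n := s)"] by (simp add: upd_dist)
    qed
    then show "G t x \<le> G t x' + L * l2dist n x x'" by simp
  qed (rule BL)
  have int_G: "integrable (prodn n \<mu>) (G t)" for t
  proof -
    obtain B' where "\<And>x. \<bar>G t x\<bar> \<le> B'" using G unfolding bdd_lipschitz_def by metis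
    then show ?thesis
      by (intro P.integrable_const_bound[where B=B'] bdd_lipschitz_l2dist_measurable G \<mu>) auto
  qed
  have F: "bdd_lipschitz dist F"
  proof (rule bdd_lipschitzI[of _ B L])
    fix t
    have "\<bar>F t\<bar> \<le> (\<integral>x. \<bar>f (x(n := t))\<bar> \<partial>prodn n \<mu>)" unfolding F_def by (rule integral_abs_bound)
    also have "\<dots> \<le> (\<integral>x. B \<partial>prodn n \<mu>)" by (intro integral_mono integrable_abs int_ft BL) simp
    finally show "\<bar>F t\<bar> \<le> B" by (simp add: P.prob_space)
  next
    fix s t
    have "F s \<le> (\<integral>x. f (x(n := t)) + L * dist s t \<partial>prodn n \<mu>)"
      unfolding F_def
    proof (intro integral_mono int_ft Bochner_Integration.integrable_add)
      fix x show "f (x(n := s)) \<le> f (x(n := t)) + L * dist s t"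
        using BL(3)[of "x(n := s)" "x(n := t)"] by (simp add: l2dist_def dist_norm)
    qed simp
    also have "\<dots> = F t + L * dist s t"
      unfolding F_def by (subst Bochner_Integration.integral_add[OF int_ft]) (auto simp: P.prob_space)
    finally show "F s \<le> F t + L * dist s t" .
  qed (rule BL)
  \<comment> \<open>The squared distance on \<open>Suc n\<close> coordinates is the sum of the two
    squared distances, so the joint infimum may be taken in two stages.\<close>
  have QG: "inf_conv (l2dist (Suc n)) f (x(n := t)) \<le> inf_conv (l2dist n) (G t) x" for x t
  proof (rule le_inf_conv)
    fix x'
    have "inf_conv (l2dist (Suc n)) f (x(n := t)) - (l2dist n x x')\<^sup>2 \<le> G t x'"
      unfolding G_def
    proof (rule le_inf_conv)
      fix t'
      have "(l2dist (Suc n) (x(n := t)) (x'(n := t')))\<^sup>2 = (l2dist n x x')\<^sup>2 + (dist t t')\<^sup>2"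
        by (simp add: l2dist_sq dist_norm)
      then show "inf_conv (l2dist (Suc n)) f (x(n := t)) - (l2dist n x x')\<^sup>2 \<le> f (x'(n := t')) + (dist t t')\<^sup>2"
        using inf_conv_le[OF fSuc, of "x(n := t)" "x'(n := t')"] by linarith
    qed
    then show "inf_conv (l2dist (Suc n)) f (x(n := t)) \<le> G t x' + (l2dist n x x')\<^sup>2" by simp
  qed
  \<comment> \<open>The integral of an infimum is at most the infimum of the integrals, which is the
    direction that the chain of estimates requires.\<close>
  have GF: "(\<integral>x. G t x \<partial>prodn n \<mu>) \<le> inf_conv dist F t" for t
  proof (rule le_inf_conv)
    fix t'
    have "(\<integral>x. G t x \<partial>prodn n \<mu>) \<le> (\<integral>x. f (x(n := t')) + (dist t t')\<^sup>2 \<partial>prodn n \<mu>)"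
    proof (intro integral_mono int_G Bochner_Integration.integrable_add int_ft)
      fix x show "G t x \<le> f (x(n := t')) + (dist t t')\<^sup>2"
        unfolding G_def by (rule inf_conv_le[OF fx])
    qed simp
    also have "\<dots> = F t' + (dist t t')\<^sup>2"
      unfolding F_def by (subst Bochner_Integration.integral_add[OF int_ft]) (auto simp: P.prob_space)
    finally show "(\<integral>x. G t x \<partial>prodn n \<mu>) \<le> F t' + (dist t t')\<^sup>2" .
  qed
  have fm: "f \<in> borel_measurable (prodn (Suc n) \<mu>)"
    by (intro bdd_lipschitz_l2dist_measurable fSuc \<mu>)
  have int_f: "integrable (prodn (Suc n) \<mu>) f"
    using BL(1) by (intro PS.integrable_const_bound[where B=B] fm) auto
  have "(\<integral>\<^sup>+x. ennreal (exp (a * inf_conv (l2dist (Suc n)) f x)) \<partial>prodn (Suc n) \<mu>)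
    = (\<integral>\<^sup>+t. (\<integral>\<^sup>+x. ennreal (exp (a * inf_conv (l2dist (Suc n)) f (x(n := t)))) \<partial>prodn n \<mu>) \<partial>\<mu>)"
  proof -
    have "inf_conv (l2dist (Suc n)) f \<in> borel_measurable (prodn (Suc n) \<mu>)"
      by (intro bdd_lipschitz_l2dist_measurable bdd_lipschitz_inf_conv_l2dist fSuc \<mu>)
    then show ?thesis
      unfolding ins unfolding prodn_def by (intro S.product_nn_integral_insert_rev) auto
  qed
  also have "\<dots> \<le> (\<integral>\<^sup>+t. (\<integral>\<^sup>+x. ennreal (exp (a * inf_conv (l2dist n) (G t) x)) \<partial>prodn n \<mu>) \<partial>\<mu>)"
    using a by (intro nn_integral_mono ennreal_leI) (simp add: QG)
  also have "\<dots> \<le> (\<integral>\<^sup>+t. ennreal (exp (a * (\<integral>x. G t x \<partial>prodn n \<mu>))) \<partial>\<mu>)"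
    by (intro nn_integral_mono Suc.IH G)
  also have "\<dots> \<le> (\<integral>\<^sup>+t. ennreal (exp (a * inf_conv dist F t)) \<partial>\<mu>)"
    using a by (intro nn_integral_mono ennreal_leI) (simp add: GF)
  also have "\<dots> \<le> ennreal (exp (a * (\<integral>t. F t \<partial>\<mu>)))" by (rule one[OF F])
  also have "(\<integral>t. F t \<partial>\<mu>) = (\<integral>x. f x \<partial>prodn (Suc n) \<mu>)"
  proof -
    have "integrable (prodn n \<mu> \<Otimes>\<^sub>M \<mu>) (\<lambda>(x, t). f (x(n := t)))"
      using BL(1) measurable_compose[OF upd fm]
      by (intro PP.integrable_const_bound[where B=B]) (auto simp: split_beta')
    then have "(\<integral>t. F t \<partial>\<mu>) = (\<integral>x. (\<integral>t. f (x(n := t)) \<partial>\<mu>) \<partial>prodn n \<mu>)"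
      unfolding F_def by (rule PP.Fubini_integral)
    also have "\<dots> = (\<integral>x. f x \<partial>prodn (Suc n) \<mu>)"
      using S.product_integral_insert[of "{..<n}" n f] int_f unfolding ins by (simp add: prodn_def)
    finally show ?thesis .
  qed
  finally show ?case .
qed

text \<open>Chernoff's method with parameter \<open>t = 2 * s\<close>, the maximizer of
  \<open>t * s - t\<^sup>2 / 4\<close>. The maximum is \<open>s\<^sup>2\<close>, so the exponent is
  \<open>a * s\<^sup>2\<close> without loss.\<close>

lemma deviation_above_mean:
  fixes \<mu> :: "'a::euclidean_space measure"
  assumes \<mu>: "prob_space \<mu>" "sets \<mu> = sets borel" and a: "a > 0"
    and one: "\<And>g. bdd_lipschitz dist g \<Longrightarrow>
      (\<integral>\<^sup>+x. ennreal (exp (a * inf_conv dist g x)) \<partial>\<mu>) \<le> ennreal (exp (a * (\<integral>x. g x \<partial>\<mu>)))"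
    and bd: "\<And>x. \<bar>h x\<bar> \<le> B" and lip: "\<And>x y. h x \<le> h y + l2dist n x y" and s: "s \<ge> 0"
  shows "measure (prodn n \<mu>) {x \<in> space (prodn n \<mu>). (\<integral>x. h x \<partial>prodn n \<mu>) + s \<le> h x} \<le> exp (- a * s\<^sup>2)"
proof -
  interpret P: prob_space "prodn n \<mu>" by (rule prob_space_prodn) fact
  let ?P = "prodn n \<mu>"
  define m where "m = (\<integral>x. h x \<partial>?P)"
  have hm: "h \<in> borel_measurable ?P"
    by (intro bdd_lipschitz_l2dist_measurable \<mu> bdd_lipschitzI[of h B 1]) (use bd lip in auto)
  have bl: "bdd_lipschitz (l2dist n) (\<lambda>x. 2 * s * h x)"
  proof (rule bdd_lipschitzI[of _ "2 * s * B" "2 * s"])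
    fix x show "\<bar>2 * s * h x\<bar> \<le> 2 * s * B" using bd[of x] s by (simp add: abs_mult mult_left_mono)
  next
    fix x y show "2 * s * h x \<le> 2 * s * h y + 2 * s * l2dist n x y"
      using mult_left_mono[OF lip[of x y], of "2 * s"] s by (simp add: algebra_simps)
  qed (use s in simp)
  let ?E = "{x \<in> space ?P. m + s \<le> h x}"
  have E: "?E \<in> sets ?P" using hm by measurable
  \<comment> \<open>Completing the square: a competitor at distance \<open>l\<close> costs
    \<open>l\<^sup>2\<close> and gains at most \<open>2 * s * l\<close>, so the infimum drops by at
    most \<open>s\<^sup>2\<close>.\<close>
  have low: "2 * s * h x - s\<^sup>2 \<le> inf_conv (l2dist n) (\<lambda>x. 2 * s * h x) x" for x
  proof (rule le_inf_conv)
    fix y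
    have "2 * s * h x \<le> 2 * s * h y + 2 * s * l2dist n x y"
      using mult_left_mono[OF lip[of x y], of "2 * s"] s by (simp add: algebra_simps)
    moreover have "0 \<le> (s - l2dist n x y)\<^sup>2" by simp
    ultimately show "2 * s * h x - s\<^sup>2 \<le> 2 * s * h y + (l2dist n x y)\<^sup>2"
      by (simp add: power2_diff)
  qed
  have "ennreal (exp (a * (2 * s * m + s\<^sup>2)) * measure ?P ?E)
      = (\<integral>\<^sup>+x. ennreal (exp (a * (2 * s * m + s\<^sup>2))) * indicator ?E x \<partial>?P)"
    using E by (simp add: nn_integral_cmult_indicator P.emeasure_eq_measure ennreal_mult)
  also have "\<dots> \<le> (\<integral>\<^sup>+x. ennreal (exp (a * inf_conv (l2dist n) (\<lambda>x. 2 * s * h x) x)) \<partial>?P)"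
  proof (intro nn_integral_mono)
    fix x
    show "ennreal (exp (a * (2 * s * m + s\<^sup>2))) * indicator ?E x
        \<le> ennreal (exp (a * inf_conv (l2dist n) (\<lambda>x. 2 * s * h x) x))"
    proof (cases "x \<in> ?E")
      case True
      then have "2 * s * (m + s) \<le> 2 * s * h x" using s by (intro mult_left_mono) auto
      then have "2 * s * m + s\<^sup>2 \<le> 2 * s * h x - s\<^sup>2" by (simp add: algebra_simps power2_eq_square)
      then have "2 * s * m + s\<^sup>2 \<le> inf_conv (l2dist n) (\<lambda>x. 2 * s * h x) x"
        using low[of x] by linarith
      then show ?thesis using True a by (simp add: ennreal_leI mult_left_mono)
    qed simp
  qed
  also have "\<dots> \<le> ennreal (exp (a * (\<integral>x. 2 * s * h x \<partial>?P)))"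
    by (rule exp_inf_conv_prodn[OF \<mu> a one bl])
  finally have "exp (a * (2 * s * m + s\<^sup>2)) * measure ?P ?E \<le> exp (a * (2 * s * m))"
    by (simp add: m_def)
  then have "measure ?P ?E \<le> exp (a * (2 * s * m)) / exp (a * (2 * s * m + s\<^sup>2))"
    by (simp add: field_simps)
  also have "\<dots> = exp (- a * s\<^sup>2)"
    by (simp add: exp_diff[symmetric] algebra_simps)
  finally show ?thesis unfolding m_def .
qed

section \<open>From transport to concentration\<close>

text \<open>The second components stay in the compact set \<open>Z\<close>, so a subsequence of them
  converges and lifts the limit point of the projection.\<close>

lemma closed_projection_compact:
  fixes F :: "('b::first_countable_topology \<times> 'c::first_countable_topology) set"
  assumes "closed F" "compact Z" "\<And>x z. (x, z) \<in> F \<Longrightarrow> z \<in> Z"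
  shows "closed (fst ` F)"
  unfolding closed_sequential_limits
proof (intro allI impI, elim conjE)
  fix X x assume X: "\<forall>n. X n \<in> fst ` F" "X \<longlonglongrightarrow> x"
  then have "\<exists>z. (X n, z) \<in> F" for n by force
  then obtain z where z: "\<And>n. (X n, z n) \<in> F" by metis
  then have "\<forall>n. z n \<in> Z" using assms(3) by blast
  moreover have "seq_compact Z" by (rule compact_imp_seq_compact) fact
  ultimately obtain l r where r: "strict_mono (r :: nat \<Rightarrow> nat)" "(z \<circ> r) \<longlonglongrightarrow> l"
    unfolding seq_compact_def by metis
  have "(\<lambda>n. (X (r n), z (r n))) \<longlonglongrightarrow> (x, l)"
    using LIMSEQ_subseq_LIMSEQ[OF X(2) r(1)] r(2) by (intro tendsto_Pair) (simp_all add: o_def)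
  then have "(x, l) \<in> F"
    using closed_sequentially[OF \<open>closed F\<close>, of "\<lambda>n. (X (r n), z (r n))"] z by simp
  then show "x \<in> fst ` F" by force
qed

text \<open>These are the displacements by which an enlargement moves points. Every entry has norm
  at most \<open>r\<close>, so they form a closed part of a product of closed balls, compact by
  Tychonoff.\<close>

lemma compact_l2_shifts:
  "compact {z :: nat \<Rightarrow> 'a::euclidean_space. (\<forall>i\<ge>n. z i = 0) \<and> l2dist n z (\<lambda>_. 0) \<le> r}" (is "compact ?Z")
proof -
  have "compactin (product_topology (\<lambda>_. euclidean) UNIV) (PiE UNIV (\<lambda>_::nat. cball (0::'a) r))"
    by (subst compactin_PiE) auto
  then have K: "compact (PiE UNIV (\<lambda>_::nat. cball (0::'a) r))"
    by (simp add: euclidean_product_topology)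
  have "closed {z :: nat \<Rightarrow> 'a. z i = 0}" for i
    by (intro closed_Collect_eq continuous_intros continuous_on_product_coordinates)
  moreover have "closed {z :: nat \<Rightarrow> 'a. l2dist n z (\<lambda>_. 0) \<le> r}"
    by (intro closed_Collect_le continuous_on_l2dist continuous_on_const)
  ultimately have cl: "closed ((\<Inter>i\<in>{n..}. {z :: nat \<Rightarrow> 'a. z i = 0}) \<inter> {z. l2dist n z (\<lambda>_. 0) \<le> r})"
    by (intro closed_Int closed_INT ballI)
  have Z: "?Z = PiE UNIV (\<lambda>_::nat. cball (0::'a) r) \<inter>
      ((\<Inter>i\<in>{n..}. {z :: nat \<Rightarrow> 'a. z i = 0}) \<inter> {z. l2dist n z (\<lambda>_. 0) \<le> r})"
  proof -
    have "norm (z i) \<le> r" if "\<forall>i\<ge>n. z i = 0" "l2dist n z (\<lambda>_. 0) \<le> r" for z :: "nat \<Rightarrow> 'a" and i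
    proof (cases "i < n")
      case True
      have "norm (z i - 0) \<le> l2dist n z (\<lambda>_. 0)"
        unfolding l2dist_L2_set using True by (intro member_le_L2_set) auto
      then show ?thesis using that by simp
    next
      case False
      have "0 \<le> r" using that(2) l2dist_nonneg[of n z "\<lambda>_. 0"] by linarith
      then show ?thesis using that False by simp
    qed
    then show ?thesis by (auto simp: PiE_UNIV_domain)
  qed
  show ?thesis unfolding Z by (rule compact_Int_closed[OF K cl])
qed

text \<open>An enlargement by closed balls of a Borel set is analytic but need not be Borel. Measurability in the completion
  is essential: \<^const>\<open>measure\<close> is \<open>0\<close> on non-measurable sets, so the lower bound would fail otherwise.\<close>

lemma enlarge_in_completion:
  fixes \<mu> :: "'a::euclidean_space measure"
  assumes \<mu>: "prob_space \<mu>" "sets \<mu> = sets borel" and A: "A \<in> sets (prodn n \<mu>)"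
  shows "enlarge n A r \<in> sets (completion (prodn n \<mu>))"
proof -
  interpret P: prob_space "prodn n \<mu>" by (rule prob_space_prodn) fact
  have sp: "space (prodn n \<mu>) = PiE {..<n} (\<lambda>_. UNIV)" by (rule space_prodn) fact
  \<comment> \<open>The cylinder over \<open>A\<close> in the full function space, free in the
    entries from \<open>n\<close> on; there points can be translated without leaving the
    space.\<close>
  define B where "B = (\<lambda>x. restrict x {..<n}) -` A"
  have B: "B \<in> sets borel"
  proof -
    have "(\<lambda>x. restrict x {..<n}) \<in> measurable borel (prodn n \<mu>)"
      unfolding prodn_def using \<mu>
      by (intro measurable_restrict) (auto intro!: borel_measurable_continuous_onI continuous_on_product_coordinates
          simp: measurable_cong_sets[OF refl \<mu>(2)])
    from measurable_sets[OF this A] show ?thesis by (simp add: B_def)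
  qed
  define Z where "Z = {z :: nat \<Rightarrow> 'a. (\<forall>i\<ge>n. z i = 0) \<and> l2dist n z (\<lambda>_. 0) \<le> r}"
  define E where "E = {x. \<exists>z\<in>Z. (\<lambda>i. x i + z i) \<in> B}"
  have enl: "enlarge n A r = E \<inter> space (prodn n \<mu>)"
  proof (intro equalityI subsetI IntI)
    fix x assume x: "x \<in> enlarge n A r"
    then obtain y where y: "y \<in> A" "l2dist n x y \<le> r" by (auto simp: enlarge_def)
    have yE: "y \<in> PiE {..<n} (\<lambda>_. UNIV)" using sets.sets_into_space[OF A] y(1) sp by auto
    define z where "z i = (if i < n then y i - x i else 0)" for i
    have "l2dist n z (\<lambda>_. 0) = l2dist n x y" by (simp add: l2dist_def z_def norm_minus_commute)
    then have "z \<in> Z" using y by (simp add: Z_def z_def)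
    moreover have "restrict (\<lambda>i. x i + z i) {..<n} = y"
      using yE by (auto simp: z_def restrict_def PiE_def extensional_def)
    ultimately show "x \<in> E" using y(1) unfolding E_def B_def by auto
  next
    fix x assume "x \<in> enlarge n A r" then show "x \<in> space (prodn n \<mu>)" by (simp add: enlarge_def sp)
  next
    fix x assume x: "x \<in> E \<inter> space (prodn n \<mu>)"
    then obtain z where z: "z \<in> Z" "restrict (\<lambda>i. x i + z i) {..<n} \<in> A" by (auto simp: E_def B_def)
    have "l2dist n x (restrict (\<lambda>i. x i + z i) {..<n}) = l2dist n z (\<lambda>_. 0)"
      by (simp add: l2dist_def)
    then have "l2dist n x (restrict (\<lambda>i. x i + z i) {..<n}) \<le> r" using z(1) by (simp add: Z_def)
    then show "x \<in> enlarge n A r" using x z(2) unfolding enlarge_def sp by blast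
  qed
  have "souslin E"
  proof -
    obtain F :: "((nat \<Rightarrow> 'a) \<times> (nat \<Rightarrow> nat)) set" where F: "closed F" "B = fst ` F"
      using souslin_borel[OF B] unfolding souslin_def by metis
    \<comment> \<open>\<open>H\<close> is closed, and its last components lie in the compact set of
      displacements. Projecting these away keeps it closed; the remaining projection is along the
      Baire space, which makes \<open>E\<close> analytic.\<close>
    define H where "H = {p :: ((nat \<Rightarrow> 'a) \<times> (nat \<Rightarrow> nat)) \<times> (nat \<Rightarrow> 'a).
      snd p \<in> Z \<and> (\<lambda>i. fst (fst p) i + snd p i, snd (fst p)) \<in> F}"
    have cont: "continuous_on UNIV (\<lambda>p :: ((nat \<Rightarrow> 'a) \<times> (nat \<Rightarrow> nat)) \<times> (nat \<Rightarrow> 'a).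
        (\<lambda>i. fst (fst p) i + snd p i, snd (fst p)))"
      by (intro continuous_on_Pair continuous_on_coordinatewise_then_product continuous_on_add
          continuous_on_product_then_coordinatewise[OF continuous_on_fst[OF continuous_on_fst[OF continuous_on_id]]]
          continuous_on_product_then_coordinatewise[OF continuous_on_snd[OF continuous_on_id]]
          continuous_on_snd[OF continuous_on_fst[OF continuous_on_id]])
    have Z: "compact Z" unfolding Z_def by (rule compact_l2_shifts)
    have "H = snd -` Z \<inter> (\<lambda>p. (\<lambda>i. fst (fst p) i + snd p i, snd (fst p))) -` F"
      by (auto simp: H_def)
    then have "closed H"
      using closed_Int[OF closed_vimage_snd[OF compact_imp_closed[OF Z]] closed_vimage[OF F(1) cont]] by simp
    have HZ: "z \<in> Z" if "(x, z) \<in> H" for x z using that by (simp add: H_def)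
    have "closed (fst ` H)"
      using closed_projection_compact[OF \<open>closed H\<close> Z HZ] by simp
    moreover have "E = fst ` fst ` H"
    proof (intro equalityI subsetI)
      fix x assume "x \<in> E"
      then obtain z s where "z \<in> Z" "((\<lambda>i. x i + z i), s) \<in> F" unfolding E_def F by auto
      then have "((x, s), z) \<in> H" by (simp add: H_def)
      then show "x \<in> fst ` fst ` H" by force
    next
      fix x assume "x \<in> fst ` fst ` H"
      then obtain p where p: "x = fst p" "p \<in> fst ` H" by (rule imageE)
      from p(2) obtain q where q: "p = fst q" "q \<in> H" by (rule imageE)
      from q p(1) have "snd q \<in> Z" and "(\<lambda>i. x i + snd q i, snd p) \<in> F" by (simp_all add: H_def)
      then have "(\<lambda>i. x i + snd q i) \<in> B" unfolding F(2) by (intro image_eqI[of _ fst "(\<lambda>i. x i + snd q i, snd p)"]) simp_all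
      with \<open>snd q \<in> Z\<close> show "x \<in> E" unfolding E_def by (intro CollectI bexI)
    qed
    ultimately show ?thesis unfolding souslin_def by blast
  qed
  \<comment> \<open>Universal measurability concerns Borel measures, so the product measure is
    pushed to the Borel sets of the function space and the decomposition of \<open>E\<close> is
    pulled back.\<close>
  define M' where "M' = distr (prodn n \<mu>) (borel :: (nat \<Rightarrow> 'a) measure) (\<lambda>x. x)"
  have idm: "(\<lambda>x. x) \<in> measurable (prodn n \<mu>) (borel :: (nat \<Rightarrow> 'a) measure)"
    by (rule id_measurable_prodn) fact
  have "prob_space M'" unfolding M'_def by (rule P.prob_space_distr[OF idm])
  then have "finite_measure M'" by (rule prob_space.finite_measure)
  then have "E \<in> sets (completion M')"
    using \<open>souslin E\<close> by (intro souslin_in_completion) (auto simp: M'_def)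
  then obtain S N N' where SN: "S \<in> sets M'" "N' \<in> null_sets M'" "N \<subseteq> N'" "E = S \<union> N"
    by (rule sets_completionE)
  let ?O = "space (prodn n \<mu>)"
  have S': "S \<inter> ?O \<in> sets (prodn n \<mu>)"
    using measurable_sets[OF idm, of S] SN(1) by (simp add: M'_def)
  have N': "N' \<inter> ?O \<in> null_sets (prodn n \<mu>)"
    using SN(2) null_sets_distr_iff[OF idm, of N'] by (simp add: M'_def)
  have "E \<inter> ?O = (S \<inter> ?O) \<union> (N \<inter> ?O)" using SN(4) by auto
  then show ?thesis
    unfolding enl by (rule sets_completionI[OF _ _ N' S']) (use SN(3) in auto)
qed

section \<open>Entropy of tilted measures and duality\<close>

lemma nn_integral_parts:
  assumes "integrable M (f :: _ \<Rightarrow> real)"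
  shows "enn2ereal (\<integral>\<^sup>+x. ennreal (f x) \<partial>M) - enn2ereal (\<integral>\<^sup>+x. ennreal (- f x) \<partial>M) = ereal (\<integral>x. f x \<partial>M)"
proof -
  have "(\<integral>\<^sup>+x. ennreal (f x) \<partial>M) \<noteq> \<infinity>" "(\<integral>\<^sup>+x. ennreal (- f x) \<partial>M) \<noteq> \<infinity>"
    using assms by (auto simp: real_integrable_def)
  then obtain p q where "(\<integral>\<^sup>+x. ennreal (f x) \<partial>M) = ennreal p" "p \<ge> 0" "(\<integral>\<^sup>+x. ennreal (- f x) \<partial>M) = ennreal q" "q \<ge> 0"
    by (metis ennreal_cases infinity_ennreal_def)
  then show ?thesis
    by (simp add: real_lebesgue_integral_def[OF assms] enn2ereal_ennreal)
qed

text \<open>\<open>RN_deriv\<close> is determined only \<mu>-almost everywhere; absolute continuity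
  turns this into equality \<nu>-almost everywhere, which is all that the two integrals see.\<close>

lemma rel_entropy_density_exp:
  fixes h :: "'a \<Rightarrow> real"
  assumes \<mu>: "prob_space \<mu>" and h: "h \<in> borel_measurable \<mu>"
    and \<nu>: "\<nu> = density \<mu> (\<lambda>x. ennreal (exp (h x)))" and int: "integrable \<nu> h"
  shows "rel_entropy \<nu> \<mu> = ereal (\<integral>x. h x \<partial>\<nu>)"
proof -
  interpret mu: prob_space \<mu> by fact
  let ?f = "\<lambda>x. ln (enn2real (RN_deriv \<mu> \<nu> x))"
  have ac: "absolutely_continuous \<mu> \<nu>"
    unfolding \<nu> using h by (intro absolutely_continuousI_density) auto
  have "AE x in \<mu>. ennreal (exp (h x)) = RN_deriv \<mu> \<nu> x"
    using h \<nu> by (intro mu.RN_deriv_unique) auto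
  then have "AE x in \<mu>. ?f x = h x"
  proof eventually_elim
    case (elim x)
    show ?case by (simp add: elim[symmetric])
  qed
  then have eq: "AE x in \<nu>. ?f x = h x"
    using absolutely_continuous_AE[OF _ ac] \<nu> by simp
  have "rel_entropy \<nu> \<mu> = enn2ereal (\<integral>\<^sup>+x. ennreal (?f x) \<partial>\<nu>) - enn2ereal (\<integral>\<^sup>+x. ennreal (- ?f x) \<partial>\<nu>)"
    using ac \<nu> by (simp add: rel_entropy_def)
  also have "(\<integral>\<^sup>+x. ennreal (?f x) \<partial>\<nu>) = (\<integral>\<^sup>+x. ennreal (h x) \<partial>\<nu>)"
    by (intro nn_integral_cong_AE) (use eq in \<open>eventually_elim, simp\<close>)
  also have "(\<integral>\<^sup>+x. ennreal (- ?f x) \<partial>\<nu>) = (\<integral>\<^sup>+x. ennreal (- h x) \<partial>\<nu>)"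
    by (intro nn_integral_cong_AE) (use eq in \<open>eventually_elim, simp\<close>)
  finally show ?thesis by (simp add: nn_integral_parts[OF int])
qed

text \<open>\<open>couplings\<close> prescribes only the marginals; the total mass is that of the
  first one.\<close>

lemma couplings_prob_space:
  assumes "\<pi> \<in> couplings \<nu> \<mu>" "prob_space \<nu>"
  shows "prob_space \<pi>"
proof (rule prob_spaceI)
  have "fst \<in> measurable \<pi> borel"
    using assms by (auto simp: couplings_def intro!: measurable_cong_sets[THEN equalityD2, THEN subsetD, OF _ refl measurable_fst])
  moreover have "emeasure (distr \<pi> borel fst) UNIV = 1"
    using assms prob_space.emeasure_space_1[of \<nu>]
    by (auto simp: couplings_def)
  ultimately show "emeasure \<pi> (space \<pi>) = 1" by (simp add: emeasure_distr)
qed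

lemma ennreal_integral_le:
  fixes f :: "'a \<Rightarrow> real"
  assumes "integrable M f"
  shows "ennreal (\<integral>x. f x \<partial>M) \<le> (\<integral>\<^sup>+x. ennreal (f x) \<partial>M)"
proof -
  have "ennreal (\<integral>x. f x \<partial>M) \<le> ennreal (\<integral>x. max 0 (f x) \<partial>M)"
    using assms by (intro ennreal_leI integral_mono) auto
  also have "\<dots> = (\<integral>\<^sup>+x. ennreal (max 0 (f x)) \<partial>M)"
    using assms by (intro nn_integral_eq_integral[symmetric]) auto
  also have "\<dots> = (\<integral>\<^sup>+x. ennreal (f x) \<partial>M)"
    by (intro nn_integral_cong) (simp add: max_def ennreal_neg)
  finally show ?thesis .
qed

lemma ereal_le_enn2ereal:
  assumes "ennreal c \<le> t" shows "ereal c \<le> enn2ereal t"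
proof (cases "c \<ge> 0")
  case True
  then show ?thesis using assms by (simp add: less_eq_ennreal.rep_eq enn2ereal_ennreal)
next
  case False
  then have "ereal c \<le> 0" by simp
  then show ?thesis using enn2ereal_nonneg[of t] by (rule order_trans)
qed

text \<open>The elementary half of Kantorovich duality: integrate
  \<open>inf_conv dist g x - g y \<le> (dist x y)\<^sup>2\<close> against any coupling.\<close>

lemma inf_conv_integral_le_T2:
  fixes \<mu> :: "'a::euclidean_space measure"
  assumes \<mu>: "prob_space \<mu>" "sets \<mu> = sets borel" and \<nu>: "prob_space \<nu>" "sets \<nu> = sets borel"
    and g: "bdd_lipschitz dist g"
  shows "ennreal ((\<integral>x. inf_conv dist g x \<partial>\<nu>) - (\<integral>x. g x \<partial>\<mu>)) \<le> T2 \<nu> \<mu>"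
  unfolding T2_def
proof (rule INF_greatest)
  fix \<pi> assume \<pi>: "\<pi> \<in> couplings \<nu> \<mu>"
  then have sets: "sets \<pi> = sets (borel \<Otimes>\<^sub>M borel)" and d: "distr \<pi> borel fst = \<nu>" "distr \<pi> borel snd = \<mu>"
    by (auto simp: couplings_def)
  interpret P: prob_space \<pi> by (rule couplings_prob_space) fact+
  have [measurable]: "fst \<in> measurable \<pi> borel" "snd \<in> measurable \<pi> borel"
    by (simp_all add: measurable_cong_sets[OF sets refl])
  have Q: "bdd_lipschitz dist (inf_conv dist g)" by (rule bdd_lipschitz_inf_conv_dist) fact
  have [measurable]: "g \<in> borel_measurable borel" "inf_conv dist g \<in> borel_measurable borel"
    using g Q by (auto intro: bdd_lipschitz_dist_measurable)
  obtain B C where BC: "\<And>x. \<bar>g x\<bar> \<le> B" "\<And>x. \<bar>inf_conv dist g x\<bar> \<le> C"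
    using g Q unfolding bdd_lipschitz_def by metis
  have ig: "integrable \<pi> (\<lambda>p. g (snd p))" "integrable \<pi> (\<lambda>p. inf_conv dist g (fst p))"
    by (rule P.integrable_const_bound[where B=B], use BC in auto)
      (rule P.integrable_const_bound[where B=C], use BC in auto)
  have "(\<integral>x. inf_conv dist g x \<partial>\<nu>) - (\<integral>x. g x \<partial>\<mu>)
      = (\<integral>p. inf_conv dist g (fst p) \<partial>\<pi>) - (\<integral>p. g (snd p) \<partial>\<pi>)"
    by (subst d[symmetric])+ (simp add: integral_distr)
  also have "\<dots> = (\<integral>p. inf_conv dist g (fst p) - g (snd p) \<partial>\<pi>)"
    using ig by simp
  also have "ennreal \<dots> \<le> (\<integral>\<^sup>+p. ennreal (inf_conv dist g (fst p) - g (snd p)) \<partial>\<pi>)"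
    using ig by (intro ennreal_integral_le) auto
  also have "\<dots> \<le> (\<integral>\<^sup>+p. ennreal ((dist (fst p) (snd p))\<^sup>2) \<partial>\<pi>)"
  proof (intro nn_integral_mono ennreal_leI)
    fix p :: "'a \<times> 'a"
    show "inf_conv dist g (fst p) - g (snd p) \<le> (dist (fst p) (snd p))\<^sup>2"
      using inf_conv_le[OF g, of "fst p" "snd p"] by linarith
  qed
  finally show "ennreal ((\<integral>x. inf_conv dist g x \<partial>\<nu>) - (\<integral>x. g x \<partial>\<mu>))
    \<le> (\<integral>\<^sup>+p. ennreal ((dist (fst p) (snd p))\<^sup>2) \<partial>\<pi>)" .
qed

text \<open>The entropy of the tilted measure is \<open>a\<close> times the \<nu>-integral of
  \<open>Qg\<close>, minus \<open>ln Z\<close>. With the factor \<open>1 / a\<close> the integral of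
  \<open>Qg\<close> has coefficient 1 on both sides of the transport inequality and cancels; what
  remains bounds \<open>ln Z\<close> by \<open>a\<close> times the \<mu>-integral of
  \<open>g\<close>. This is the Bobkov-Goetze dual form.\<close>

lemma T2_imp_exp_inf_conv:
  fixes \<mu> :: "'a::euclidean_space measure"
  assumes \<mu>: "prob_space \<mu>" "sets \<mu> = sets borel" and a: "a > 0"
    and T2: "\<And>\<nu>. prob_space \<nu> \<Longrightarrow> sets \<nu> = sets borel \<Longrightarrow> enn2ereal (T2 \<nu> \<mu>) \<le> ereal (1 / a) * rel_entropy \<nu> \<mu>"
    and g: "bdd_lipschitz dist g"
  shows "(\<integral>\<^sup>+x. ennreal (exp (a * inf_conv dist g x)) \<partial>\<mu>) \<le> ennreal (exp (a * (\<integral>x. g x \<partial>\<mu>)))"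
proof -
  interpret mu: prob_space \<mu> by fact
  let ?Q = "inf_conv dist g"
  have Q: "bdd_lipschitz dist ?Q" by (rule bdd_lipschitz_inf_conv_dist) fact
  have Qb: "?Q \<in> borel_measurable borel" by (rule bdd_lipschitz_dist_measurable) fact
  then have [measurable]: "?Q \<in> borel_measurable \<mu>" using measurable_cong_sets[OF \<mu>(2) refl] by blast
  obtain C where C: "\<And>x. \<bar>?Q x\<bar> \<le> C" using Q unfolding bdd_lipschitz_def by metis
  define Z where "Z = (\<integral>x. exp (a * ?Q x) \<partial>\<mu>)"
  have iexp: "integrable \<mu> (\<lambda>x. exp (a * ?Q x))"
  proof (rule mu.integrable_const_bound[where B="exp (a * C)"])
    have "?Q x \<le> C" for x using C[of x] by linarith
    then show "AE x in \<mu>. norm (exp (a * ?Q x)) \<le> exp (a * C)"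
      using a by simp
  qed measurable
  have "exp (- a * C) \<le> exp (a * ?Q x)" for x
    using mult_left_mono[of "-C" "?Q x" a] C[of x] a by simp
  then have "(\<integral>x. exp (- a * C) \<partial>\<mu>) \<le> Z"
    unfolding Z_def by (intro integral_mono iexp) simp_all
  then have Z: "Z > 0" using less_le_trans[of 0 "exp (- a * C)" Z] by (simp add: mu.prob_space)
  define h where "h x = a * ?Q x - ln Z" for x
  have hm [measurable]: "h \<in> borel_measurable \<mu>" unfolding h_def by measurable
  define \<nu> where "\<nu> = density \<mu> (\<lambda>x. ennreal (exp (h x)))"
  have exph: "exp (h x) = exp (a * ?Q x) / Z" for x using Z by (simp add: h_def exp_diff)
  have "prob_space \<nu>"
  proof (rule prob_spaceI)
    have "emeasure \<nu> (space \<nu>) = (\<integral>\<^sup>+x. ennreal (exp (h x)) \<partial>\<mu>)"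
      unfolding \<nu>_def by (simp add: emeasure_density cong: nn_integral_cong)
    also have "\<dots> = ennreal (\<integral>x. exp (h x) \<partial>\<mu>)"
      using iexp Z by (intro nn_integral_eq_integral) (auto simp: exph)
    also have "(\<integral>x. exp (h x) \<partial>\<mu>) = 1" using Z by (simp add: exph Z_def[symmetric])
    finally show "emeasure \<nu> (space \<nu>) = 1" by simp
  qed
  then interpret nu: prob_space \<nu> .
  have \<nu>s: "sets \<nu> = sets borel" by (simp add: \<nu>_def \<mu>)
  have [measurable]: "?Q \<in> borel_measurable \<nu>" using Qb measurable_cong_sets[OF \<nu>s refl] by blast
  have iQ: "integrable \<nu> ?Q" using C by (intro nu.integrable_const_bound[where B=C]) auto
  then have ih: "integrable \<nu> h" unfolding h_def by simp
  have "ennreal ((\<integral>x. ?Q x \<partial>\<nu>) - (\<integral>x. g x \<partial>\<mu>)) \<le> T2 \<nu> \<mu>"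
    by (rule inf_conv_integral_le_T2) fact+
  then have "ereal ((\<integral>x. ?Q x \<partial>\<nu>) - (\<integral>x. g x \<partial>\<mu>)) \<le> enn2ereal (T2 \<nu> \<mu>)"
    by (rule ereal_le_enn2ereal)
  also have "\<dots> \<le> ereal (1 / a) * rel_entropy \<nu> \<mu>" by (rule T2) fact+
  also have "rel_entropy \<nu> \<mu> = ereal (\<integral>x. h x \<partial>\<nu>)"
    by (rule rel_entropy_density_exp[OF \<mu>(1) hm \<nu>_def ih])
  also have "(\<integral>x. h x \<partial>\<nu>) = a * (\<integral>x. ?Q x \<partial>\<nu>) - ln Z"
    unfolding h_def using iQ by (simp add: nu.prob_space)
  finally have "(\<integral>x. ?Q x \<partial>\<nu>) - (\<integral>x. g x \<partial>\<mu>) \<le> (1 / a) * (a * (\<integral>x. ?Q x \<partial>\<nu>) - ln Z)"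
    by simp
  then have "ln Z \<le> a * (\<integral>x. g x \<partial>\<mu>)" using a by (simp add: field_simps)
  then have "Z \<le> exp (a * (\<integral>x. g x \<partial>\<mu>))" using Z by (metis exp_le_cancel_iff exp_ln)
  moreover have "(\<integral>\<^sup>+x. ennreal (exp (a * ?Q x)) \<partial>\<mu>) = ennreal Z"
    unfolding Z_def using iexp by (intro nn_integral_eq_integral) auto
  ultimately show ?thesis by (simp add: ennreal_leI)
qed

section \<open>Concentration around sets of measure one half\<close>

lemma T2_imp_concentration:
  fixes \<mu> :: "'a::euclidean_space measure"
  assumes \<mu>: "prob_space \<mu>" "sets \<mu> = sets borel" and a: "a > 0"
    and T2: "\<And>\<nu>. prob_space \<nu> \<Longrightarrow> sets \<nu> = sets borel \<Longrightarrow> enn2ereal (T2 \<nu> \<mu>) \<le> ereal (1 / a) * rel_entropy \<nu> \<mu>"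
    and A: "A \<in> sets (prodn n \<mu>)" "measure (prodn n \<mu>) A \<ge> 1/2"
    and r: "r \<ge> sqrt (ln 2 / a)"
  shows "measure (completion (prodn n \<mu>)) (enlarge n A r) \<ge> 1 - exp (- a * (r - sqrt (ln 2 / a))\<^sup>2)"
proof -
  interpret P: prob_space "prodn n \<mu>" by (rule prob_space_prodn) fact
  let ?P = "prodn n \<mu>"
  have one: "(\<integral>\<^sup>+x. ennreal (exp (a * inf_conv dist g x)) \<partial>\<mu>) \<le> ennreal (exp (a * (\<integral>x. g x \<partial>\<mu>)))"
    if "bdd_lipschitz dist g" for g
    using T2_imp_exp_inf_conv[OF \<mu> a T2 that] by blast
  have r0: "r \<ge> 0" using r a by (meson divide_nonneg_pos ln_ge_zero one_le_numeral order_trans real_sqrt_ge_zero)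
  have ne: "A \<noteq> {}" using A(2) by auto
  \<comment> \<open>The distance to \<open>A\<close>, cut off at \<open>r\<close>: the cut makes it
    bounded, as the deviation inequality requires, and leaves the event \<open>r \<le> h x\<close>
    unchanged.\<close>
  define h where "h x = min r (INF y\<in>A. l2dist n x y)" for x
  have bb: "bdd_below ((\<lambda>y. l2dist n x y) ` A)" for x by (rule bdd_belowI2[where m=0]) simp
  have inf0: "0 \<le> (INF y\<in>A. l2dist n x y)" for x by (intro cINF_greatest ne) simp
  have bd: "\<bar>h x\<bar> \<le> r" for x unfolding h_def using inf0[of x] r0 by auto
  have lip: "h x \<le> h y + l2dist n x y" for x y
  proof -
    have "(INF z\<in>A. l2dist n x z) - l2dist n x y \<le> (INF z\<in>A. l2dist n y z)"
    proof (rule cINF_greatest[OF ne])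
      fix z assume "z \<in> A"
      then have "(INF z\<in>A. l2dist n x z) \<le> l2dist n x z" by (intro cINF_lower bb)
      then show "(INF z\<in>A. l2dist n x z) - l2dist n x y \<le> l2dist n y z"
        using l2dist_triangle[of n x z y] by linarith
    qed
    then show ?thesis unfolding h_def using l2dist_nonneg[of n x y] by linarith
  qed
  have hm [measurable]: "h \<in> borel_measurable ?P"
    by (intro bdd_lipschitz_l2dist_measurable \<mu> bdd_lipschitzI[of h r 1]) (use bd lip in auto)
  define m where "m = (\<integral>x. h x \<partial>?P)"
  have h0: "h x \<ge> 0" for x unfolding h_def using inf0[of x] r0 by auto
  have m0: "m \<ge> 0" unfolding m_def by (intro Bochner_Integration.integral_nonneg h0)
  have hA: "h x = 0" if "x \<in> A" for x
  proof -
    have "(INF z\<in>A. l2dist n x z) \<le> l2dist n x x" by (intro cINF_lower bb that)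
    then show ?thesis using h0[of x] unfolding h_def by simp
  qed
  \<comment> \<open>On \<open>A\<close> the function \<open>- h\<close> is \<open>0\<close> and
    exceeds its mean \<open>- m\<close> by \<open>m\<close>. As \<open>A\<close> has measure at
    least \<open>1/2\<close>, so has this deviation event, which forces
    \<open>m \<le> sqrt (ln 2 / a)\<close>.\<close>
  have "measure ?P A \<le> measure ?P {x \<in> space ?P. (\<integral>x. - h x \<partial>?P) + m \<le> - h x}"
    using sets.sets_into_space[OF A(1)] hA by (intro P.finite_measure_mono) (auto simp: m_def)
  also have "\<dots> \<le> exp (- a * m\<^sup>2)"
  proof (rule deviation_above_mean[OF \<mu> a one, of "\<lambda>x. - h x" r n m])
    show "- h x \<le> - h y + l2dist n x y" for x y using lip[of y x] by (simp add: l2dist_commute)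
    show "\<bar>- h x\<bar> \<le> r" for x using bd[of x] by simp
    show "0 \<le> m" by (rule m0)
  qed
  finally have "1/2 \<le> exp (- a * m\<^sup>2)" using A(2) by simp
  then have "ln (1/2) \<le> ln (exp (- a * m\<^sup>2))" by (subst ln_le_cancel_iff) auto
  then have "ln (1/2) \<le> - a * m\<^sup>2" by simp
  then have "m\<^sup>2 \<le> ln 2 / a" using a by (simp add: ln_div field_simps)
  then have m: "m \<le> sqrt (ln 2 / a)" using m0 by (simp add: real_le_rsqrt)
  have "measure ?P {x \<in> space ?P. m + (r - m) \<le> h x} \<le> exp (- a * (r - m)\<^sup>2)"
    unfolding m_def
  proof (rule deviation_above_mean[OF \<mu> a one bd lip])
    show "0 \<le> r - (\<integral>x. h x \<partial>?P)" using m r unfolding m_def by linarith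
  qed
  also have "\<dots> \<le> exp (- a * (r - sqrt (ln 2 / a))\<^sup>2)"
    using m r a by (simp add: power_mono)
  finally have le: "measure ?P {x \<in> space ?P. r \<le> h x} \<le> exp (- a * (r - sqrt (ln 2 / a))\<^sup>2)"
    by simp
  \<comment> \<open>Strictly below \<open>r\<close>, a point of \<open>A\<close> within
    \<open>r\<close> exists even if the infimum is not attained.\<close>
  have sub: "space ?P - {x \<in> space ?P. r \<le> h x} \<subseteq> enlarge n A r"
  proof
    fix x assume x: "x \<in> space ?P - {x \<in> space ?P. r \<le> h x}"
    then have "(INF y\<in>A. l2dist n x y) < r" by (auto simp: h_def)
    then obtain y where "y \<in> A" "l2dist n x y < r" using cINF_less_iff[OF ne bb] by auto
    then show "x \<in> enlarge n A r" using x space_prodn[OF \<mu>(2), of n] by (force simp: enlarge_def)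
  qed
  have "1 - measure ?P {x \<in> space ?P. r \<le> h x} = measure ?P (space ?P - {x \<in> space ?P. r \<le> h x})"
    by (intro P.prob_compl[symmetric]) measurable
  also have "\<dots> = measure (completion ?P) (space ?P - {x \<in> space ?P. r \<le> h x})"
    by (intro measure_completion[symmetric]) measurable
  also have "\<dots> \<le> measure (completion ?P) (enlarge n A r)"
  proof (intro finite_measure.finite_measure_mono sub enlarge_in_completion \<mu> A)
    show "finite_measure (completion ?P)"
      by (rule finite_measureI) (simp add: P.emeasure_space_1)
  qed
  finally show ?thesis using le by linarith
qed

section \<open>Law of large numbers on product spaces\<close>

lemma component_measurable_prodn: "i < n \<Longrightarrow> (\<lambda>x. x i) \<in> measurable (prodn n \<mu>) \<mu>"
  unfolding prodn_def by (rule measurable_component_singleton) simp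

lemma distr_component_prodn:
  "prob_space \<mu> \<Longrightarrow> i < n \<Longrightarrow> distr (prodn n \<mu>) \<mu> (\<lambda>x. x i) = \<mu>"
  unfolding prodn_def using distr_PiM_component[of "{..<n}" "\<lambda>_. \<mu>" i] by simp

lemma measurable_sum_prodn:
  fixes g :: "'a \<Rightarrow> real"
  assumes "g \<in> borel_measurable \<mu>"
  shows "(\<lambda>x. \<Sum>i<n. g (x i)) \<in> borel_measurable (prodn n \<mu>)"
  using assms by (intro borel_measurable_sum) (auto intro: measurable_compose[OF component_measurable_prodn])

lemma
  fixes g :: "'a \<Rightarrow> real"
  assumes \<mu>: "prob_space \<mu>" and g: "integrable \<mu> g" and i: "i < n"
  shows integrable_component_prodn: "integrable (prodn n \<mu>) (\<lambda>x. g (x i))"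
    and integral_component_prodn: "(\<integral>x. g (x i) \<partial>prodn n \<mu>) = (\<integral>x. g x \<partial>\<mu>)"
proof -
  have "integrable (distr (prodn n \<mu>) \<mu> (\<lambda>x. x i)) g"
    using g by (simp add: distr_component_prodn[OF \<mu> i])
  then show "integrable (prodn n \<mu>) (\<lambda>x. g (x i))"
    by (rule integrable_distr[OF component_measurable_prodn[OF i]])
  have "(\<integral>x. g x \<partial>\<mu>) = (\<integral>x. g x \<partial>distr (prodn n \<mu>) \<mu> (\<lambda>x. x i))"
    by (simp add: distr_component_prodn[OF \<mu> i])
  also have "\<dots> = (\<integral>x. g (x i) \<partial>prodn n \<mu>)"
    using g by (intro integral_distr component_measurable_prodn i) auto
  finally show "(\<integral>x. g (x i) \<partial>prodn n \<mu>) = (\<integral>x. g x \<partial>\<mu>)" by simp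
qed

lemma indep_vars_prodn:
  fixes g :: "'a \<Rightarrow> real"
  assumes \<mu>: "prob_space \<mu>" and g: "g \<in> borel_measurable \<mu>" and n: "n > 0"
  shows "prob_space.indep_vars (prodn n \<mu>) (\<lambda>_. borel) (\<lambda>i x. g (x i)) {..<n}"
proof -
  interpret P: prob_space "prodn n \<mu>" by (rule prob_space_prodn) fact
  have "P.indep_vars (\<lambda>_. \<mu>) (\<lambda>i x. x i) {..<n}"
  proof (subst P.indep_vars_iff_distr_eq_PiM')
    show "{..<n} \<noteq> {}" using n by auto
    show "(\<lambda>x. x i) \<in> measurable (prodn n \<mu>) \<mu>" if "i \<in> {..<n}" for i
      using that component_measurable_prodn by blast
    have "distr (prodn n \<mu>) (PiM {..<n} (\<lambda>_. \<mu>)) (\<lambda>x. \<lambda>i\<in>{..<n}. x i) = distr (prodn n \<mu>) (prodn n \<mu>) (\<lambda>x. x)"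
      by (intro distr_cong) (auto simp: prodn_def space_PiM PiE_restrict)
    also have "\<dots> = prodn n \<mu>" by (rule distr_id2) simp
    also have "\<dots> = PiM {..<n} (\<lambda>i. distr (prodn n \<mu>) \<mu> (\<lambda>x. x i))"
      unfolding prodn_def
      by (intro PiM_cong) (auto simp: distr_component_prodn[OF \<mu>, unfolded prodn_def])
    finally show "distr (prodn n \<mu>) (PiM {..<n} (\<lambda>_. \<mu>)) (\<lambda>x. \<lambda>i\<in>{..<n}. x i) =
      PiM {..<n} (\<lambda>i. distr (prodn n \<mu>) \<mu> (\<lambda>x. x i))" .
  qed
  from P.indep_vars_compose2[OF this, where Y="\<lambda>_. g" and N="\<lambda>_. borel"] g show ?thesis by simp
qed

text \<open>Hoeffding's inequality for variables in \<open>{-b..b}\<close> gives even an exponential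
  rate.\<close>

lemma prodn_law_of_large_numbers_bounded:
  fixes g :: "'a \<Rightarrow> real"
  assumes \<mu>: "prob_space \<mu>" and g: "g \<in> borel_measurable \<mu>" and bd: "\<And>x. \<bar>g x\<bar> \<le> b" and b: "b > 0" and e: "e > 0"
  shows "(\<lambda>n. measure (prodn n \<mu>) {x \<in> space (prodn n \<mu>). real n * ((\<integral>x. g x \<partial>\<mu>) + e) \<le> (\<Sum>i<n. g (x i))}) \<longlonglongrightarrow> 0"
proof (rule Lim_null_comparison)
  have "norm (measure (prodn n \<mu>) {x \<in> space (prodn n \<mu>). real n * ((\<integral>x. g x \<partial>\<mu>) + e) \<le> (\<Sum>i<n. g (x i))})
      \<le> exp (- (e\<^sup>2 / (2 * b\<^sup>2)) * real n)" if n: "n > 0" for n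
  proof -
    interpret mu: prob_space \<mu> by fact
    interpret P: prob_space "prodn n \<mu>" by (rule prob_space_prodn) fact
    have ig: "integrable \<mu> g" using bd by (intro mu.integrable_const_bound[where B=b] g) auto
    interpret I: indep_interval_bounded_random_variables "prodn n \<mu>" "{..<n}" "\<lambda>i x. g (x i)" "\<lambda>_. -b" "\<lambda>_. b"
    proof
      show "P.indep_vars (\<lambda>_. borel) (\<lambda>i x. g (x i)) {..<n}" by (rule indep_vars_prodn[OF \<mu> g n])
      show "AE x in prodn n \<mu>. g (x i) \<in> {-b..b}" for i
      proof (rule AE_I2)
        fix x show "g (x i) \<in> {-b..b}" using bd[of "x i"] by auto
      qed
    qed auto
    interpret H: Hoeffding_ineq "prodn n \<mu>" "{..<n}" "\<lambda>i x. g (x i)" "\<lambda>_. -b" "\<lambda>_. b" "real n * (\<integral>x. g x \<partial>\<mu>)"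
      by unfold_locales (simp_all add: integral_component_prodn[OF \<mu> ig])
    have "P.prob {x \<in> space (prodn n \<mu>). real n * (\<integral>x. g x \<partial>\<mu>) + real n * e \<le> (\<Sum>i<n. g (x i))}
        \<le> exp (-2 * (real n * e)\<^sup>2 / (\<Sum>i<n. (b - -b)\<^sup>2))"
      using b e n by (intro H.Hoeffding_ineq_ge) auto
    also have "-2 * (real n * e)\<^sup>2 / (\<Sum>i<n. (b - -b)\<^sup>2) = - (e\<^sup>2 / (2 * b\<^sup>2)) * real n"
      using b n by (simp add: field_simps power2_eq_square)
    finally show ?thesis by (simp add: algebra_simps)
  qed
  then show "eventually (\<lambda>n. norm (measure (prodn n \<mu>) {x \<in> space (prodn n \<mu>). real n * ((\<integral>x. g x \<partial>\<mu>) + e) \<le> (\<Sum>i<n. g (x i))})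
      \<le> exp (- (e\<^sup>2 / (2 * b\<^sup>2)) * real n)) sequentially"
    by (rule eventually_mono[OF eventually_gt_at_top[of 0]])
  have "e\<^sup>2 / (2 * b\<^sup>2) > 0" using b e by simp
  then have "filterlim (\<lambda>n. - (e\<^sup>2 / (2 * b\<^sup>2)) * real n) at_bot sequentially"
    by (intro filterlim_tendsto_neg_mult_at_bot[OF tendsto_const] filterlim_real_sequentially) auto
  then show "(\<lambda>n. exp (- (e\<^sup>2 / (2 * b\<^sup>2)) * real n)) \<longlonglongrightarrow> 0"
    by (rule filterlim_compose[OF exp_at_bot])
qed

text \<open>Truncation reduces the weak law to the bounded case; the tail is controlled by Markov's inequality.\<close>

lemma prodn_law_of_large_numbers:
  fixes g :: "'a \<Rightarrow> real"
  assumes \<mu>: "prob_space \<mu>" and g: "integrable \<mu> g" and e: "e > 0"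
  shows "(\<lambda>n. measure (prodn n \<mu>) {x \<in> space (prodn n \<mu>). real n * ((\<integral>x. g x \<partial>\<mu>) + e) \<le> (\<Sum>i<n. g (x i))}) \<longlonglongrightarrow> 0"
proof (rule tendstoI)
  fix d :: real assume d: "d > 0"
  interpret mu: prob_space \<mu> by fact
  have [measurable]: "g \<in> borel_measurable \<mu>" using g by auto
  define t where "t k x = max (- real (Suc k)) (min (real (Suc k)) (g x))" for k x
  have tm [measurable]: "t k \<in> borel_measurable \<mu>" for k unfolding t_def by measurable
  have tb: "\<bar>t k x\<bar> \<le> real (Suc k)" for k x unfolding t_def by auto
  have it: "integrable \<mu> (t k)" for k
    using tb by (intro mu.integrable_const_bound[where B="real (Suc k)"] tm) auto
  have lim: "(\<lambda>k. \<integral>x. \<bar>g x - t k x\<bar> \<partial>\<mu>) \<longlonglongrightarrow> (\<integral>x. 0 \<partial>\<mu>)"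
  proof (rule integral_dominated_convergence[where w="\<lambda>x. \<bar>g x\<bar>"])
    show "AE x in \<mu>. (\<lambda>k. \<bar>g x - t k x\<bar>) \<longlonglongrightarrow> 0"
    proof (rule AE_I2)
      fix x
      obtain N :: nat where N: "\<bar>g x\<bar> \<le> real N" using real_arch_simple by blast
      have "\<bar>g x - t k x\<bar> = 0" if "k \<ge> N" for k using N that unfolding t_def by auto
      then show "(\<lambda>k. \<bar>g x - t k x\<bar>) \<longlonglongrightarrow> 0"
        by (intro tendsto_eventually eventually_sequentiallyI[of N]) auto
    qed
    show "AE x in \<mu>. norm \<bar>g x - t k x\<bar> \<le> \<bar>g x\<bar>" for k unfolding t_def by (intro AE_I2) auto
  qed (use g in auto)
  \<comment> \<open>The error \<open>e\<close> is shared in thirds by the truncated sum, the shift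
    of the mean and the tail. The first bound on \<theta> limits the shift; the second makes
    Markov's inequality at level \<open>n * e / 3\<close> give at most \<open>d / 2\<close>.\<close>
  define \<theta> where "\<theta> = min (e / 3) (d * e / 6)"
  have "\<theta> > 0" using d e by (simp add: \<theta>_def)
  then have "eventually (\<lambda>k. (\<integral>x. \<bar>g x - t k x\<bar> \<partial>\<mu>) < \<theta>) sequentially"
    using order_tendstoD(2)[OF lim] by simp
  then obtain k where k: "(\<integral>x. \<bar>g x - t k x\<bar> \<partial>\<mu>) < \<theta>" by (auto simp: eventually_sequentially)
  have idiff: "integrable \<mu> (\<lambda>x. \<bar>g x - t k x\<bar>)" using g it by auto
  have "(\<integral>x. t k x \<partial>\<mu>) - (\<integral>x. g x \<partial>\<mu>) = (\<integral>x. t k x - g x \<partial>\<mu>)" using g it by simp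
  also have "\<dots> \<le> (\<integral>x. \<bar>g x - t k x\<bar> \<partial>\<mu>)" using g it idiff by (intro integral_mono) auto
  finally have means: "(\<integral>x. t k x \<partial>\<mu>) \<le> (\<integral>x. g x \<partial>\<mu>) + e / 3" using k by (simp add: \<theta>_def)
  have lim2: "(\<lambda>n. measure (prodn n \<mu>) {x \<in> space (prodn n \<mu>). real n * ((\<integral>x. t k x \<partial>\<mu>) + e / 3) \<le> (\<Sum>i<n. t k (x i))}) \<longlonglongrightarrow> 0"
    by (rule prodn_law_of_large_numbers_bounded[OF \<mu> tm tb]) (use e in auto)
  have "eventually (\<lambda>n. measure (prodn n \<mu>) {x \<in> space (prodn n \<mu>). real n * ((\<integral>x. t k x \<partial>\<mu>) + e / 3) \<le> (\<Sum>i<n. t k (x i))} < d / 2) sequentially"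
    using order_tendstoD(2)[OF lim2, of "d / 2"] d by simp
  with eventually_gt_at_top[of 0]
  show "eventually (\<lambda>n. dist (measure (prodn n \<mu>) {x \<in> space (prodn n \<mu>). real n * ((\<integral>x. g x \<partial>\<mu>) + e) \<le> (\<Sum>i<n. g (x i))}) 0 < d) sequentially"
  proof eventually_elim
    case (elim n)
    interpret P: prob_space "prodn n \<mu>" by (rule prob_space_prodn) fact
    let ?P = "prodn n \<mu>"
    let ?A = "{x \<in> space ?P. real n * ((\<integral>x. t k x \<partial>\<mu>) + e / 3) \<le> (\<Sum>i<n. t k (x i))}"
    let ?B = "{x \<in> space ?P. real n * (e / 3) \<le> (\<Sum>i<n. \<bar>g (x i) - t k (x i)\<bar>)}"
    have sm: "(\<lambda>x. \<Sum>i<n. t k (x i)) \<in> borel_measurable ?P" "(\<lambda>x. \<Sum>i<n. \<bar>g (x i) - t k (x i)\<bar>) \<in> borel_measurable ?P"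
      using measurable_sum_prodn[OF tm[of k], of n] measurable_sum_prodn[OF borel_measurable_integrable[OF idiff], of n]
      by simp_all
    have ib: "integrable ?P (\<lambda>x. \<Sum>i<n. \<bar>g (x i) - t k (x i)\<bar>)"
      by (intro Bochner_Integration.integrable_sum integrable_component_prodn[OF \<mu> idiff]) auto
    have "{x \<in> space ?P. real n * ((\<integral>x. g x \<partial>\<mu>) + e) \<le> (\<Sum>i<n. g (x i))} \<subseteq> ?A \<union> ?B"
    proof (rule subsetI, rule ccontr)
      fix x assume x: "x \<in> {x \<in> space ?P. real n * ((\<integral>x. g x \<partial>\<mu>) + e) \<le> (\<Sum>i<n. g (x i))}" and nx: "x \<notin> ?A \<union> ?B"
      have "(\<Sum>i<n. g (x i)) \<le> (\<Sum>i<n. t k (x i) + \<bar>g (x i) - t k (x i)\<bar>)" by (intro sum_mono) auto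
      also have "\<dots> = (\<Sum>i<n. t k (x i)) + (\<Sum>i<n. \<bar>g (x i) - t k (x i)\<bar>)" by (rule sum.distrib)
      also have "\<dots> < real n * ((\<integral>x. t k x \<partial>\<mu>) + e / 3) + real n * (e / 3)" using x nx by auto
      also have "\<dots> = real n * ((\<integral>x. t k x \<partial>\<mu>) + 2 * e / 3)" by (simp add: algebra_simps)
      also have "\<dots> \<le> real n * ((\<integral>x. g x \<partial>\<mu>) + e)" using means by (intro mult_left_mono) auto
      finally show False using x by simp
    qed
    then have "measure ?P {x \<in> space ?P. real n * ((\<integral>x. g x \<partial>\<mu>) + e) \<le> (\<Sum>i<n. g (x i))} \<le> measure ?P (?A \<union> ?B)"
      using sm by (intro P.finite_measure_mono) auto
    also have "\<dots> \<le> measure ?P ?A + measure ?P ?B" using sm by (intro measure_Un_le) auto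
    also have "measure ?P ?B \<le> (\<integral>x. (\<Sum>i<n. \<bar>g (x i) - t k (x i)\<bar>) \<partial>?P) / (real n * (e / 3))"
      using e elim by (intro integral_Markov_inequality_measure[OF ib, of "{}"]) (auto intro!: sum_nonneg)
    also have "(\<integral>x. (\<Sum>i<n. \<bar>g (x i) - t k (x i)\<bar>) \<partial>?P) = real n * (\<integral>x. \<bar>g x - t k x\<bar> \<partial>\<mu>)"
      by (subst Bochner_Integration.integral_sum) (simp_all add: integrable_component_prodn[OF \<mu> idiff] integral_component_prodn[OF \<mu> idiff])
    also have "\<dots> / (real n * (e / 3)) = (\<integral>x. \<bar>g x - t k x\<bar> \<partial>\<mu>) * 3 / e" using elim by simp
    also have "\<dots> \<le> (d * e / 6) * 3 / e" using k e by (intro divide_right_mono mult_right_mono) (auto simp: \<theta>_def)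
    also have "\<dots> = d / 2" using e by simp
    finally have "measure ?P {x \<in> space ?P. real n * ((\<integral>x. g x \<partial>\<mu>) + e) \<le> (\<Sum>i<n. g (x i))} < d"
      using elim by linarith
    then show ?case by simp
  qed
qed

text \<open>The error is relative to the mass of \<open>C\<close>, because the frequencies later
  have to be dominated by a multiple of the measure, cell by cell. For a null set this leaves the
  law of large numbers no room; instead almost surely no sample hits \<open>C\<close>, and the
  strict inequality \<open>0 < 0\<close> fails.\<close>

lemma prodn_frequency_bound:
  assumes \<mu>: "prob_space \<mu>" and C: "C \<in> sets \<mu>" and \<eta>: "\<eta> > 0"
  shows "(\<lambda>n. measure (prodn n \<mu>) {x \<in> space (prodn n \<mu>). real n * ((1 + \<eta>) * measure \<mu> C) < (\<Sum>i<n. indicat_real C (x i))}) \<longlonglongrightarrow> 0"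
proof (cases "measure \<mu> C = 0")
  case True
  interpret mu: prob_space \<mu> by fact
  have "AE x in \<mu>. x \<notin> C" using C True by (intro AE_not_in null_setsI) (auto simp: mu.emeasure_eq_measure)
  then have AE: "AE x in prodn n \<mu>. \<forall>i<n. x i \<notin> C" for n
  proof -
    have "AE x in prodn n \<mu>. \<forall>i\<in>{..<n}. x i \<notin> C"
      unfolding prodn_def using \<mu>
      by (intro AE_finite_allI AE_PiM_component) (simp_all add: \<open>AE x in \<mu>. x \<notin> C\<close>)
    then show ?thesis by (rule eventually_mono) auto
  qed
  have "measure (prodn n \<mu>) {x \<in> space (prodn n \<mu>). real n * ((1 + \<eta>) * measure \<mu> C) < (\<Sum>i<n. indicat_real C (x i))} = 0" for n
  proof -
    interpret P: prob_space "prodn n \<mu>" by (rule prob_space_prodn) fact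
    have "AE x in prodn n \<mu>. x \<notin> {x \<in> space (prodn n \<mu>). real n * ((1 + \<eta>) * measure \<mu> C) < (\<Sum>i<n. indicat_real C (x i))}"
      using AE[of n] by eventually_elim (simp add: True)
    moreover have "{x \<in> space (prodn n \<mu>). real n * ((1 + \<eta>) * measure \<mu> C) < (\<Sum>i<n. indicat_real C (x i))} \<in> sets (prodn n \<mu>)"
      using measurable_sum_prodn[of "indicat_real C" \<mu> n] C by measurable
    ultimately show ?thesis by (simp add: P.prob_eq_0)
  qed
  then show ?thesis by simp
next
  case False
  interpret mu: prob_space \<mu> by fact
  have pos: "\<eta> * measure \<mu> C > 0" using False \<eta> by (simp add: zero_less_measure_iff)
  have "integrable \<mu> (indicat_real C)"
    using C by (intro mu.integrable_const_bound[where B=1]) (auto simp: indicator_def)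
  from prodn_law_of_large_numbers[OF \<mu> this pos]
  have lim: "(\<lambda>n. measure (prodn n \<mu>) {x \<in> space (prodn n \<mu>). real n * ((1 + \<eta>) * measure \<mu> C) \<le> (\<Sum>i<n. indicat_real C (x i))}) \<longlonglongrightarrow> 0"
    using C by (simp add: algebra_simps)
  show ?thesis
  proof (rule Lim_null_comparison[OF _ lim], rule always_eventually, rule allI)
    fix n
    interpret P: prob_space "prodn n \<mu>" by (rule prob_space_prodn) fact
    show "norm (measure (prodn n \<mu>) {x \<in> space (prodn n \<mu>). real n * ((1 + \<eta>) * measure \<mu> C) < (\<Sum>i<n. indicat_real C (x i))})
      \<le> measure (prodn n \<mu>) {x \<in> space (prodn n \<mu>). real n * ((1 + \<eta>) * measure \<mu> C) \<le> (\<Sum>i<n. indicat_real C (x i))}"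
      using measurable_sum_prodn[of "indicat_real C" \<mu> n] C by (auto intro!: P.finite_measure_mono)
  qed
qed

section \<open>Change of measure on the product\<close>

lemma prodn_density:
  fixes f :: "'a \<Rightarrow> real"
  assumes \<mu>: "prob_space \<mu>" and f: "f \<in> borel_measurable \<mu>" "\<And>x. f x \<ge> 0"
    and \<nu>: "\<nu> = density \<mu> (\<lambda>x. ennreal (f x))" "prob_space \<nu>"
  shows "prodn n \<nu> = density (prodn n \<mu>) (\<lambda>x. \<Prod>i<n. ennreal (f (x i)))"
proof -
  interpret mu: prob_space \<mu> by fact
  interpret nu: prob_space \<nu> by fact
  interpret M: product_sigma_finite "\<lambda>_::nat. \<mu>" by standard
  interpret N: product_sigma_finite "\<lambda>_::nat. \<nu>" by standard
  have [measurable]: "(\<lambda>x. \<Prod>i<n. ennreal (f (x i))) \<in> borel_measurable (PiM {..<n} (\<lambda>_. \<mu>))"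
    using f by (intro borel_measurable_prod_ennreal) (auto intro: measurable_compose[OF measurable_component_singleton])
  have "density (PiM {..<n} (\<lambda>_. \<mu>)) (\<lambda>x. \<Prod>i<n. ennreal (f (x i))) = PiM {..<n} (\<lambda>_. \<nu>)"
  proof (rule N.PiM_eqI)
    show "sets (density (PiM {..<n} (\<lambda>_. \<mu>)) (\<lambda>x. \<Prod>i<n. ennreal (f (x i)))) = sets (PiM {..<n} (\<lambda>_. \<nu>))"
      unfolding sets_density by (intro sets_PiM_cong) (auto simp: \<nu>)
  next
    fix A assume "\<And>i. i \<in> {..<n} \<Longrightarrow> A i \<in> sets \<nu>"
    then have A: "A i \<in> sets \<mu>" if "i < n" for i using that by (simp add: \<nu>)
    have PA: "PiE {..<n} A \<in> sets (PiM {..<n} (\<lambda>_. \<mu>))" using A by (intro sets_PiM_I_finite) auto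
    have "emeasure (density (PiM {..<n} (\<lambda>_. \<mu>)) (\<lambda>x. \<Prod>i<n. ennreal (f (x i)))) (PiE {..<n} A)
      = (\<integral>\<^sup>+x. (\<Prod>i<n. ennreal (f (x i))) * indicator (PiE {..<n} A) x \<partial>PiM {..<n} (\<lambda>_. \<mu>))"
      using PA by (simp add: emeasure_density)
    also have "\<dots> = (\<integral>\<^sup>+x. (\<Prod>i<n. ennreal (f (x i)) * indicator (A i) (x i)) \<partial>PiM {..<n} (\<lambda>_. \<mu>))"
    proof (intro nn_integral_cong)
      fix x assume "x \<in> space (PiM {..<n} (\<lambda>_. \<mu>))"
      then have "x \<in> extensional {..<n}" by (simp add: space_PiM PiE_def)
      then have "indicator (PiE {..<n} A) x = (\<Prod>i<n. indicator (A i) (x i) :: ennreal)"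
        by (auto simp: indicator_def PiE_def Pi_iff prod_zero_iff)
      then show "(\<Prod>i<n. ennreal (f (x i))) * indicator (PiE {..<n} A) x = (\<Prod>i<n. ennreal (f (x i)) * indicator (A i) (x i))"
        by (simp add: prod.distrib)
    qed
    also have "\<dots> = (\<Prod>i<n. \<integral>\<^sup>+x. ennreal (f x) * indicator (A i) x \<partial>\<mu>)"
      using f A by (intro M.product_nn_integral_prod) auto
    also have "\<dots> = (\<Prod>i<n. emeasure \<nu> (A i))"
      using f A by (intro prod.cong) (auto simp: \<nu> emeasure_density)
    finally show "emeasure (density (PiM {..<n} (\<lambda>_. \<mu>)) (\<lambda>x. \<Prod>i<n. ennreal (f (x i)))) (PiE {..<n} A)
      = (\<Prod>i<n. emeasure \<nu> (A i))" .
  qed simp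
  then show ?thesis by (simp add: prodn_def)
qed

text \<open>On \<open>B\<close> the likelihood ratio of the products is at most
  \<open>exp K\<close>. Read backwards, a set of substantial measure under
  \<open>prodn n \<nu>\<close> has measure of order at least \<open>exp (- K)\<close> under
  \<open>prodn n \<mu>\<close>.\<close>

lemma measure_prodn_density_le:
  fixes f :: "'a \<Rightarrow> real"
  assumes \<mu>: "prob_space \<mu>" and f: "f \<in> borel_measurable \<mu>" "\<And>x. f x \<ge> 0"
    and \<nu>: "\<nu> = density \<mu> (\<lambda>x. ennreal (f x))" "prob_space \<nu>"
    and B: "B \<in> sets (prodn n \<mu>)" "\<And>x. x \<in> B \<Longrightarrow> (\<Sum>i<n. ln (f (x i))) \<le> K"
  shows "measure (prodn n \<nu>) B \<le> exp K * measure (prodn n \<mu>) B"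
proof -
  interpret M: prob_space "prodn n \<mu>" by (rule prob_space_prodn) fact
  interpret N: prob_space "prodn n \<nu>" by (rule prob_space_prodn) fact
  have m: "(\<lambda>x. \<Prod>i<n. ennreal (f (x i))) \<in> borel_measurable (prodn n \<mu>)"
    using f by (intro borel_measurable_prod_ennreal) (auto intro: measurable_compose[OF component_measurable_prodn])
  have "emeasure (prodn n \<nu>) B = (\<integral>\<^sup>+x. (\<Prod>i<n. ennreal (f (x i))) * indicator B x \<partial>prodn n \<mu>)"
    unfolding prodn_density[OF \<mu> f \<nu>] using m B by (simp add: emeasure_density)
  also have "\<dots> \<le> (\<integral>\<^sup>+x. ennreal (exp K) * indicator B x \<partial>prodn n \<mu>)"
  proof (intro nn_integral_mono)
    fix x
    have "(\<Prod>i<n. f (x i)) \<le> exp K" if x: "x \<in> B"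
    proof (cases "\<forall>i<n. f (x i) > 0")
      case True
      then have "(\<Prod>i<n. f (x i)) = (\<Prod>i<n. exp (ln (f (x i))))" by (intro prod.cong) auto
      also have "\<dots> = exp (\<Sum>i<n. ln (f (x i)))" by (simp add: exp_sum)
      also have "\<dots> \<le> exp K" using B(2)[OF x] by simp
      finally show ?thesis .
    next
      \<comment> \<open>Where a factor vanishes, the sum of logarithms says nothing about the
        product, but the product is \<open>0\<close>.\<close>
      case False
      then obtain i where "i < n" "f (x i) = 0" using f(2) by (metis less_eq_real_def)
      then have "(\<Prod>i<n. f (x i)) = 0" by (intro prod_zero) auto
      then show ?thesis by (rule ord_eq_le_trans) simp
    qed
    then show "(\<Prod>i<n. ennreal (f (x i))) * indicator B x \<le> ennreal (exp K) * indicator B x"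
      using f(2) by (auto simp: indicator_def prod_ennreal ennreal_leI)
  qed
  also have "\<dots> = ennreal (exp K * measure (prodn n \<mu>) B)"
    using B by (simp add: nn_integral_cmult_indicator M.emeasure_eq_measure ennreal_mult)
  finally show ?thesis by (simp add: N.emeasure_eq_measure)
qed

section \<open>Couplings from samples\<close>

text \<open>A step-function coupling: paired densities \<open>\<alpha> k\<close>, \<open>\<beta> k\<close> carry mass \<open>s\<close> each, and the
  remaining mass of both marginals is coupled independently.\<close>

locale gluing = nu: prob_space \<nu> + mu: prob_space \<mu> for \<nu> \<mu> :: "'a::euclidean_space measure" +
  fixes n :: nat and s :: real and \<alpha> \<beta> :: "nat \<Rightarrow> 'a \<Rightarrow> real"
  assumes sets_\<nu>: "sets \<nu> = sets borel" and sets_\<mu>: "sets \<mu> = sets borel"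
    and \<alpha>_measurable: "\<And>k. \<alpha> k \<in> borel_measurable borel" and \<beta>_measurable: "\<And>k. \<beta> k \<in> borel_measurable borel"
    and \<alpha>_nonneg: "\<And>k x. 0 \<le> \<alpha> k x" and \<beta>_nonneg: "\<And>k x. 0 \<le> \<beta> k x"
    and \<alpha>_int: "\<And>k. k < n \<Longrightarrow> integrable \<nu> (\<alpha> k)" "\<And>k. k < n \<Longrightarrow> (\<integral>x. \<alpha> k x \<partial>\<nu>) = 1"
    and \<beta>_int: "\<And>k. k < n \<Longrightarrow> integrable \<mu> (\<beta> k)" "\<And>k. k < n \<Longrightarrow> (\<integral>x. \<beta> k x \<partial>\<mu>) = 1"
    and \<alpha>_le: "\<And>x. s * (\<Sum>k<n. \<alpha> k x) \<le> 1" and \<beta>_le: "\<And>x. s * (\<Sum>k<n. \<beta> k x) \<le> 1"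
    and s_nonneg: "0 \<le> s" and s_less: "s * real n < 1"
begin

text \<open>The two factors of the numerator are the densities of the unmatched parts of \<nu> and
  \<mu>. Both parts have mass \<open>1 - s * real n\<close>, and dividing by it once gives their
  product the same mass.\<close>

definition rest :: "'a \<Rightarrow> 'a \<Rightarrow> real" where
  "rest x y = (1 - s * (\<Sum>k<n. \<alpha> k x)) * (1 - s * (\<Sum>k<n. \<beta> k y)) / (1 - s * real n)"

definition dens :: "'a \<Rightarrow> 'a \<Rightarrow> real" where
  "dens x y = s * (\<Sum>k<n. \<alpha> k x * \<beta> k y) + rest x y"

definition glue :: "('a \<times> 'a) measure" where
  "glue = density (\<nu> \<Otimes>\<^sub>M \<mu>) (\<lambda>p. ennreal (dens (fst p) (snd p)))"

lemma rest_nonneg: "0 \<le> rest x y"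
  using \<alpha>_le[of x] \<beta>_le[of y] s_less unfolding rest_def by (intro divide_nonneg_pos mult_nonneg_nonneg) auto

lemma rest_le_dens: "rest x y \<le> dens x y"
  using s_nonneg \<alpha>_nonneg \<beta>_nonneg unfolding dens_def by (simp add: sum_nonneg)

lemma dens_nonneg: "0 \<le> dens x y"
  using rest_nonneg[of x y] rest_le_dens[of x y] by linarith

lemma sets_pair: "sets (\<nu> \<Otimes>\<^sub>M \<mu>) = sets (borel \<Otimes>\<^sub>M borel)"
  by (intro sets_pair_measure_cong sets_\<nu> sets_\<mu>)

lemmas [measurable_cong] = sets_\<nu> sets_\<mu>

lemma [measurable]: "\<alpha> k \<in> borel_measurable borel" "\<beta> k \<in> borel_measurable borel"
  by (rule \<alpha>_measurable \<beta>_measurable)+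

lemma rest_measurable [measurable]: "(\<lambda>p. rest (fst p) (snd p)) \<in> borel_measurable (borel \<Otimes>\<^sub>M borel)"
  unfolding rest_def by measurable

lemma dens_measurable [measurable]: "(\<lambda>p. dens (fst p) (snd p)) \<in> borel_measurable (borel \<Otimes>\<^sub>M borel)"
  unfolding dens_def by measurable

lemma nn_integral_rest_snd: "(\<integral>\<^sup>+y. ennreal (rest x y) \<partial>\<mu>) = ennreal (1 - s * (\<Sum>k<n. \<alpha> k x))"
proof -
  have i: "integrable \<mu> (\<lambda>y. \<Sum>k<n. \<beta> k y)" using \<beta>_int by auto
  have "(\<integral>y. rest x y \<partial>\<mu>) = (1 - s * (\<Sum>k<n. \<alpha> k x)) * (\<integral>y. 1 - s * (\<Sum>k<n. \<beta> k y) \<partial>\<mu>) / (1 - s * real n)"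
    unfolding rest_def by simp
  also have "(\<integral>y. 1 - s * (\<Sum>k<n. \<beta> k y) \<partial>\<mu>) = 1 - s * real n"
    using i \<beta>_int by (simp add: mu.prob_space)
  finally have "(\<integral>y. rest x y \<partial>\<mu>) = 1 - s * (\<Sum>k<n. \<alpha> k x)" using s_less by simp
  moreover have "integrable \<mu> (rest x)" unfolding rest_def using i by simp
  ultimately show ?thesis by (simp add: nn_integral_eq_integral rest_nonneg)
qed

text \<open>The matched pairs contribute \<open>s * (\<Sum>k<n. \<alpha> k x)\<close> to the first
  marginal, and the independent part supplies exactly what is missing to \<open>1\<close>.\<close>

lemma nn_integral_dens_snd: "(\<integral>\<^sup>+y. ennreal (dens x y) \<partial>\<mu>) = 1"
proof -
  have i: "integrable \<mu> (\<lambda>y. s * (\<Sum>k<n. \<alpha> k x * \<beta> k y))" using \<beta>_int by auto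
  have nn: "0 \<le> s * (\<Sum>k<n. \<alpha> k x * \<beta> k y)" for y
    using s_nonneg \<alpha>_nonneg \<beta>_nonneg by (simp add: sum_nonneg)
  have "(\<integral>\<^sup>+y. ennreal (s * (\<Sum>k<n. \<alpha> k x * \<beta> k y)) \<partial>\<mu>) = ennreal (\<integral>y. s * (\<Sum>k<n. \<alpha> k x * \<beta> k y) \<partial>\<mu>)"
    using nn by (intro nn_integral_eq_integral i) simp
  also have "(\<integral>y. s * (\<Sum>k<n. \<alpha> k x * \<beta> k y) \<partial>\<mu>) = s * (\<Sum>k<n. \<alpha> k x)"
    using \<beta>_int by (simp add: Bochner_Integration.integral_sum)
  finally have "(\<integral>\<^sup>+y. ennreal (s * (\<Sum>k<n. \<alpha> k x * \<beta> k y)) \<partial>\<mu>) = ennreal (s * (\<Sum>k<n. \<alpha> k x))" .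
  moreover have "(\<lambda>y. ennreal (rest x y)) \<in> borel_measurable \<mu>" unfolding rest_def by measurable
  ultimately have "(\<integral>\<^sup>+y. ennreal (s * (\<Sum>k<n. \<alpha> k x * \<beta> k y)) + ennreal (rest x y) \<partial>\<mu>)
      = ennreal (s * (\<Sum>k<n. \<alpha> k x)) + ennreal (1 - s * (\<Sum>k<n. \<alpha> k x))"
    by (subst nn_integral_add) (auto simp: nn_integral_rest_snd)
  also have "\<dots> = 1"
    using \<alpha>_le[of x] s_nonneg \<alpha>_nonneg by (subst ennreal_plus[symmetric]) (auto intro!: mult_nonneg_nonneg sum_nonneg)
  finally show ?thesis
    unfolding dens_def using nn rest_nonneg by (simp add: ennreal_plus)
qed

sublocale pair_sigma_finite \<nu> \<mu> ..

lemma nn_integral_pair_fst: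
  assumes [measurable]: "h \<in> borel_measurable (borel \<Otimes>\<^sub>M borel)"
  shows "(\<integral>\<^sup>+p. h p \<partial>(\<nu> \<Otimes>\<^sub>M \<mu>)) = (\<integral>\<^sup>+x. (\<integral>\<^sup>+y. h (x, y) \<partial>\<mu>) \<partial>\<nu>)"
  by (rule mu.nn_integral_fst[symmetric]) (simp add: measurable_cong_sets[OF sets_pair refl])

lemma nn_integral_dens_fst_function:
  assumes [measurable]: "g \<in> borel_measurable borel"
  shows "(\<integral>\<^sup>+p. ennreal (dens (fst p) (snd p)) * g (fst p) \<partial>(\<nu> \<Otimes>\<^sub>M \<mu>)) = (\<integral>\<^sup>+x. g x \<partial>\<nu>)"
proof -
  have [measurable]: "(\<lambda>y. ennreal (dens x y)) \<in> borel_measurable \<mu>" for x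
    unfolding dens_def rest_def by measurable
  show ?thesis
    by (subst nn_integral_pair_fst) (auto simp: nn_integral_multc nn_integral_dens_snd)
qed

lemma nn_integral_rest: "(\<integral>\<^sup>+p. ennreal (rest (fst p) (snd p)) \<partial>(\<nu> \<Otimes>\<^sub>M \<mu>)) = ennreal (1 - s * real n)"
proof -
  have i: "integrable \<nu> (\<lambda>x. \<Sum>k<n. \<alpha> k x)" using \<alpha>_int by auto
  have "(\<integral>\<^sup>+p. ennreal (rest (fst p) (snd p)) \<partial>(\<nu> \<Otimes>\<^sub>M \<mu>)) = (\<integral>\<^sup>+x. ennreal (1 - s * (\<Sum>k<n. \<alpha> k x)) \<partial>\<nu>)"
    by (subst nn_integral_pair_fst) (auto simp: nn_integral_rest_snd)
  also have "\<dots> = ennreal (\<integral>x. 1 - s * (\<Sum>k<n. \<alpha> k x) \<partial>\<nu>)"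
    using i \<alpha>_le by (intro nn_integral_eq_integral) auto
  also have "(\<integral>x. 1 - s * (\<Sum>k<n. \<alpha> k x) \<partial>\<nu>) = 1 - s * real n"
    using i \<alpha>_int by (simp add: nu.prob_space)
  finally show ?thesis .
qed

lemma nn_integral_product_density:
  assumes "k < n"
  shows "(\<integral>\<^sup>+p. ennreal (\<alpha> k (fst p) * \<beta> k (snd p)) \<partial>(\<nu> \<Otimes>\<^sub>M \<mu>)) = 1"
proof -
  have "(\<integral>\<^sup>+p. ennreal (\<alpha> k (fst p) * \<beta> k (snd p)) \<partial>(\<nu> \<Otimes>\<^sub>M \<mu>))
    = (\<integral>\<^sup>+x. (\<integral>\<^sup>+y. ennreal (\<alpha> k x) * ennreal (\<beta> k y) \<partial>\<mu>) \<partial>\<nu>)"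
    by (subst nn_integral_pair_fst) (auto simp: ennreal_mult \<alpha>_nonneg \<beta>_nonneg)
  also have "(\<integral>\<^sup>+y. ennreal (\<beta> k y) \<partial>\<mu>) = 1"
    using \<beta>_int assms \<beta>_nonneg by (simp add: nn_integral_eq_integral)
  then have "(\<integral>\<^sup>+x. (\<integral>\<^sup>+y. ennreal (\<alpha> k x) * ennreal (\<beta> k y) \<partial>\<mu>) \<partial>\<nu>) = (\<integral>\<^sup>+x. ennreal (\<alpha> k x) \<partial>\<nu>)"
    by (simp add: nn_integral_cmult)
  also have "\<dots> = 1" using \<alpha>_int assms \<alpha>_nonneg by (simp add: nn_integral_eq_integral)
  finally show ?thesis .
qed

end

text \<open>The construction is symmetric in the two measures, so the second marginal follows from
  the computation for the first.\<close>

lemma (in gluing) gluing_swap: "gluing \<mu> \<nu> n s \<beta> \<alpha>"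
  by unfold_locales (auto simp: sets_\<nu> sets_\<mu> \<alpha>_int \<beta>_int \<alpha>_nonneg \<beta>_nonneg \<alpha>_le \<beta>_le s_nonneg s_less)

context gluing begin

interpretation swap: gluing \<mu> \<nu> n s \<beta> \<alpha> by (rule gluing_swap)

lemma dens_swap: "swap.dens y x = dens x y"
  unfolding dens_def swap.dens_def rest_def swap.rest_def by (simp add: mult.commute)

lemma nn_integral_dens_snd_function:
  assumes [measurable]: "g \<in> borel_measurable borel"
  shows "(\<integral>\<^sup>+p. ennreal (dens (fst p) (snd p)) * g (snd p) \<partial>(\<nu> \<Otimes>\<^sub>M \<mu>)) = (\<integral>\<^sup>+x. g x \<partial>\<mu>)"
proof -
  have [measurable]: "(\<lambda>x. ennreal (dens x y)) \<in> borel_measurable \<nu>" for y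
    unfolding dens_def rest_def by measurable
  have m: "(\<lambda>p. ennreal (dens (fst p) (snd p)) * g (snd p)) \<in> borel_measurable (\<nu> \<Otimes>\<^sub>M \<mu>)"
    unfolding measurable_cong_sets[OF sets_pair refl] by measurable
  have "(\<integral>\<^sup>+p. ennreal (dens (fst p) (snd p)) * g (snd p) \<partial>(\<nu> \<Otimes>\<^sub>M \<mu>))
      = (\<integral>\<^sup>+y. (\<integral>\<^sup>+x. ennreal (dens x y) * g y \<partial>\<nu>) \<partial>\<mu>)"
    using nn_integral_snd[OF m] by simp
  also have "\<dots> = (\<integral>\<^sup>+y. g y \<partial>\<mu>)"
    using swap.nn_integral_dens_snd by (simp add: nn_integral_multc dens_swap)
  finally show ?thesis .
qed

lemma glue_couplings: "glue \<in> couplings \<nu> \<mu>"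
proof -
  have m: "(\<lambda>p. ennreal (dens (fst p) (snd p))) \<in> borel_measurable (\<nu> \<Otimes>\<^sub>M \<mu>)"
    unfolding measurable_cong_sets[OF sets_pair refl] by measurable
  have sets: "sets glue = sets (borel \<Otimes>\<^sub>M borel)" by (simp add: glue_def sets_pair)
  have sp: "space glue = UNIV" using sets_eq_imp_space_eq[OF sets] by (simp add: space_pair_measure)
  have f: "fst \<in> measurable glue borel" "snd \<in> measurable glue borel"
    by (simp_all add: measurable_cong_sets[OF sets refl])
  have e: "emeasure glue ((\<lambda>p. F p) -` A \<inter> space glue)
      = (\<integral>\<^sup>+p. ennreal (dens (fst p) (snd p)) * indicator A (F p) \<partial>(\<nu> \<Otimes>\<^sub>M \<mu>))"
    if "F \<in> measurable glue borel" "A \<in> sets borel" for A and F :: "'a \<times> 'a \<Rightarrow> 'a"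
  proof -
    have "F -` A \<inter> space glue \<in> sets (\<nu> \<Otimes>\<^sub>M \<mu>)"
      using measurable_sets[OF that] by (simp add: sets sets_pair)
    then show ?thesis
      unfolding glue_def using m sp
      by (simp add: emeasure_density glue_def) (intro nn_integral_cong, simp add: indicator_def)
  qed
  have "distr glue borel fst = \<nu>"
  proof (rule measure_eqI)
    fix A assume "A \<in> sets (distr glue borel fst)"
    then have A: "A \<in> sets borel" by simp
    have "emeasure (distr glue borel fst) A = (\<integral>\<^sup>+x. indicator A x \<partial>\<nu>)"
      using A f by (simp add: emeasure_distr e nn_integral_dens_fst_function)
    then show "emeasure (distr glue borel fst) A = emeasure \<nu> A" using A by (simp add: sets_\<nu>)
  qed (simp add: sets_\<nu>)
  moreover have "distr glue borel snd = \<mu>"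
  proof (rule measure_eqI)
    fix A assume "A \<in> sets (distr glue borel snd)"
    then have A: "A \<in> sets borel" by simp
    have "emeasure (distr glue borel snd) A = (\<integral>\<^sup>+x. indicator A x \<partial>\<mu>)"
      using A f by (simp add: emeasure_distr e nn_integral_dens_snd_function)
    then show "emeasure (distr glue borel snd) A = emeasure \<mu> A" using A by (simp add: sets_\<mu>)
  qed (simp add: sets_\<mu>)
  ultimately show ?thesis by (simp add: couplings_def sets)
qed

text \<open>Matched mass inside \<open>S\<close> costs at most \<open>q k\<close> per pair. All
  other mass is charged through a crude bound on the squared distance: \<open>4 * T\<close> plus
  twice the excess of each squared norm over \<open>T\<close>. The constant meets only a small mass,
  and each excess depends on one variable, so it integrates against a marginal.\<close>

lemma T2_le_glue:
  assumes S: "S \<in> sets borel" and T: "T \<ge> 0" and q: "\<And>k. 0 \<le> q k"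
    and close: "\<And>k x y. k < n \<Longrightarrow> x \<in> S \<Longrightarrow> y \<in> S \<Longrightarrow> \<alpha> k x \<noteq> 0 \<Longrightarrow> \<beta> k y \<noteq> 0 \<Longrightarrow> (dist x y)\<^sup>2 \<le> q k"
  shows "T2 \<nu> \<mu> \<le> ennreal (s * (\<Sum>k<n. q k) + 4 * T * (measure \<nu> (-S) + measure \<mu> (-S) + (1 - s * real n)))
    + 2 * (\<integral>\<^sup>+x. ennreal (max 0 ((norm x)\<^sup>2 - T)) \<partial>\<nu>) + 2 * (\<integral>\<^sup>+x. ennreal (max 0 ((norm x)\<^sup>2 - T)) \<partial>\<mu>)"
proof -
  define e :: "'a \<Rightarrow> real" where "e x = max 0 ((norm x)\<^sup>2 - T)" for x
  have e0: "e x \<ge> 0" for x by (simp add: e_def)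
  have [measurable]: "e \<in> borel_measurable borel" unfolding e_def by measurable
  have [measurable]: "S \<in> sets borel" by (rule S)
  have d2: "(dist x y)\<^sup>2 \<le> 4 * T + 2 * e x + 2 * e y" for x y :: 'a
  proof -
    have "(dist x y)\<^sup>2 \<le> (norm x + norm y)\<^sup>2"
      unfolding dist_norm by (intro power_mono norm_triangle_ineq4) simp
    also have "\<dots> \<le> 2 * (norm x)\<^sup>2 + 2 * (norm y)\<^sup>2"
      using sum_squares_bound[of "norm x" "norm y"] by (simp add: power2_sum)
    also have "\<dots> \<le> 2 * (T + e x) + 2 * (T + e y)" by (intro add_mono mult_left_mono) (auto simp: e_def)
    finally show ?thesis by simp
  qed
  define g where "g p = s * (\<Sum>k<n. q k * (\<alpha> k (fst p) * \<beta> k (snd p)))" for p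
  have g0: "0 \<le> g p" for p unfolding g_def using s_nonneg q \<alpha>_nonneg \<beta>_nonneg by (simp add: sum_nonneg)
  have [measurable]: "g \<in> borel_measurable (borel \<Otimes>\<^sub>M borel)" unfolding g_def by measurable
  \<comment> \<open>Outside the product of \<open>S\<close> with itself the whole density is charged
    with \<open>4 * T\<close>, through the indicators; inside, only \<open>rest\<close> is.\<close>
  have main: "dens x y * (dist x y)\<^sup>2 \<le> g (x, y)
      + (4 * T * (dens x y * indicat_real (-S) x) + 4 * T * (dens x y * indicat_real (-S) y) + 4 * T * rest x y
      + 2 * (dens x y * e x) + 2 * (dens x y * e y))" for x y
  proof (cases "x \<in> S \<and> y \<in> S")
    case True
    have "s * (\<Sum>k<n. \<alpha> k x * \<beta> k y) * (dist x y)\<^sup>2 = s * (\<Sum>k<n. \<alpha> k x * \<beta> k y * (dist x y)\<^sup>2)"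
      by (simp add: sum_distrib_right mult.assoc)
    also have "\<dots> \<le> g (x, y)"
      unfolding g_def fst_conv snd_conv
    proof (intro mult_left_mono sum_mono s_nonneg)
      fix k assume k: "k \<in> {..<n}"
      show "\<alpha> k x * \<beta> k y * (dist x y)\<^sup>2 \<le> q k * (\<alpha> k x * \<beta> k y)"
      proof (cases "\<alpha> k x \<noteq> 0 \<and> \<beta> k y \<noteq> 0")
        case t: True
        then have "(dist x y)\<^sup>2 \<le> q k" using close k True by auto
        then have "\<alpha> k x * \<beta> k y * (dist x y)\<^sup>2 \<le> \<alpha> k x * \<beta> k y * q k"
          using \<alpha>_nonneg \<beta>_nonneg by (intro mult_left_mono) auto
        then show ?thesis by (simp add: mult.commute)
      qed auto
    qed
    finally have 1: "s * (\<Sum>k<n. \<alpha> k x * \<beta> k y) * (dist x y)\<^sup>2 \<le> g (x, y)" .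
    have "rest x y * (dist x y)\<^sup>2 \<le> rest x y * (4 * T + 2 * e x + 2 * e y)"
      by (intro mult_left_mono d2 rest_nonneg)
    also have "\<dots> = 4 * T * rest x y + 2 * (rest x y * e x) + 2 * (rest x y * e y)"
      by (simp add: algebra_simps)
    also have "\<dots> \<le> 4 * T * rest x y + 2 * (dens x y * e x) + 2 * (dens x y * e y)"
      using T by (intro add_mono mult_left_mono mult_right_mono rest_le_dens e0) auto
    finally show ?thesis using 1 True unfolding dens_def[of x y] by (simp add: algebra_simps)
  next
    case False
    have "dens x y * (dist x y)\<^sup>2 \<le> dens x y * (4 * T + 2 * e x + 2 * e y)"
      by (intro mult_left_mono d2 dens_nonneg)
    also have "\<dots> = 4 * T * dens x y + 2 * (dens x y * e x) + 2 * (dens x y * e y)"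
      by (simp add: algebra_simps)
    also have "4 * T * dens x y \<le> 4 * T * (dens x y * indicat_real (-S) x) + 4 * T * (dens x y * indicat_real (-S) y)"
      using False T dens_nonneg[of x y] by (auto simp: indicator_def)
    finally show ?thesis using g0[of "(x, y)"] rest_nonneg[of x y] T
      by (smt (verit) mult_nonneg_nonneg)
  qed
  let ?P = "\<nu> \<Otimes>\<^sub>M \<mu>"
  have m: "(\<lambda>p. ennreal (dens (fst p) (snd p))) \<in> borel_measurable ?P" "(\<lambda>p. ennreal ((dist (fst p) (snd p))\<^sup>2)) \<in> borel_measurable ?P"
    unfolding measurable_cong_sets[OF sets_pair refl] by measurable
  have "T2 \<nu> \<mu> \<le> (\<integral>\<^sup>+p. ennreal ((dist (fst p) (snd p))\<^sup>2) \<partial>glue)"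
    unfolding T2_def by (rule INF_lower[OF glue_couplings])
  also have "\<dots> = (\<integral>\<^sup>+p. ennreal (dens (fst p) (snd p)) * ennreal ((dist (fst p) (snd p))\<^sup>2) \<partial>?P)"
    unfolding glue_def by (rule nn_integral_density[OF m])
  also have "\<dots> \<le> (\<integral>\<^sup>+p. ennreal (g p)
      + (ennreal (4 * T) * (ennreal (dens (fst p) (snd p)) * indicator (-S) (fst p))
      + ennreal (4 * T) * (ennreal (dens (fst p) (snd p)) * indicator (-S) (snd p))
      + ennreal (4 * T) * ennreal (rest (fst p) (snd p))
      + 2 * (ennreal (dens (fst p) (snd p)) * ennreal (e (fst p)))
      + 2 * (ennreal (dens (fst p) (snd p)) * ennreal (e (snd p)))) \<partial>?P)"
  proof (intro nn_integral_mono)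
    fix p :: "'a \<times> 'a"
    obtain x y where p: "p = (x, y)" by (cases p)
    have ind: "(indicator (-S) z :: ennreal) = ennreal (indicat_real (-S) z)" for z by (simp add: indicator_def)
    have two: "(2::ennreal) = ennreal 2" by simp
    show "ennreal (dens (fst p) (snd p)) * ennreal ((dist (fst p) (snd p))\<^sup>2) \<le> ennreal (g p)
      + (ennreal (4 * T) * (ennreal (dens (fst p) (snd p)) * indicator (-S) (fst p))
      + ennreal (4 * T) * (ennreal (dens (fst p) (snd p)) * indicator (-S) (snd p))
      + ennreal (4 * T) * ennreal (rest (fst p) (snd p))
      + 2 * (ennreal (dens (fst p) (snd p)) * ennreal (e (fst p)))
      + 2 * (ennreal (dens (fst p) (snd p)) * ennreal (e (snd p))))"
      using main[of x y] T dens_nonneg rest_nonneg e0 g0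
      unfolding p fst_conv snd_conv ind two
      by (simp add: ennreal_mult[symmetric] ennreal_plus[symmetric] ennreal_leI del: ennreal_numeral ennreal_plus)
  qed
  also have "\<dots> = (\<integral>\<^sup>+p. ennreal (g p) \<partial>?P)
      + (ennreal (4 * T) * (\<integral>\<^sup>+x. indicator (-S) x \<partial>\<nu>)
      + ennreal (4 * T) * (\<integral>\<^sup>+x. indicator (-S) x \<partial>\<mu>)
      + ennreal (4 * T) * ennreal (1 - s * real n)
      + 2 * (\<integral>\<^sup>+x. ennreal (e x) \<partial>\<nu>)
      + 2 * (\<integral>\<^sup>+x. ennreal (e x) \<partial>\<mu>))"
  proof -
    have "A \<in> borel_measurable ?P" if "A \<in> borel_measurable (borel \<Otimes>\<^sub>M borel)" for A :: "'a \<times> 'a \<Rightarrow> ennreal"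
      using that measurable_cong_sets[OF sets_pair refl] by blast
    note mm = this
    have [measurable]: "(\<lambda>p. ennreal (g p)) \<in> borel_measurable ?P"
      "(\<lambda>p. ennreal (dens (fst p) (snd p)) * indicator (-S) (fst p)) \<in> borel_measurable ?P"
      "(\<lambda>p. ennreal (dens (fst p) (snd p)) * indicator (-S) (snd p)) \<in> borel_measurable ?P"
      "(\<lambda>p. ennreal (rest (fst p) (snd p))) \<in> borel_measurable ?P"
      "(\<lambda>p. ennreal (dens (fst p) (snd p)) * ennreal (e (fst p))) \<in> borel_measurable ?P"
      "(\<lambda>p. ennreal (dens (fst p) (snd p)) * ennreal (e (snd p))) \<in> borel_measurable ?P"
      by (rule mm, measurable)+
    have "(\<lambda>x. ennreal (e x)) \<in> borel_measurable borel" by measurable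
    note ee = nn_integral_dens_fst_function[OF this] nn_integral_dens_snd_function[OF this]
    show ?thesis
      by (simp add: nn_integral_add nn_integral_cmult nn_integral_rest ee
          nn_integral_dens_fst_function nn_integral_dens_snd_function)
  qed
  also have "(\<integral>\<^sup>+p. ennreal (g p) \<partial>?P) = ennreal (s * (\<Sum>k<n. q k))"
  proof -
    have "(\<integral>\<^sup>+p. ennreal (g p) \<partial>?P) = (\<integral>\<^sup>+p. (\<Sum>k<n. ennreal (s * q k) * ennreal (\<alpha> k (fst p) * \<beta> k (snd p))) \<partial>?P)"
      unfolding g_def using s_nonneg q \<alpha>_nonneg \<beta>_nonneg
      by (intro nn_integral_cong) (simp add: sum_distrib_left ennreal_mult[symmetric] mult.assoc sum_nonneg)
    also have "\<dots> = (\<Sum>k<n. ennreal (s * q k) * (\<integral>\<^sup>+p. ennreal (\<alpha> k (fst p) * \<beta> k (snd p)) \<partial>?P))"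
    proof -
      have "(\<lambda>p. ennreal (\<alpha> k (fst p) * \<beta> k (snd p))) \<in> borel_measurable ?P" for k
        unfolding measurable_cong_sets[OF sets_pair refl] by measurable
      then show ?thesis by (simp add: nn_integral_sum nn_integral_cmult)
    qed
    also have "\<dots> = ennreal (s * (\<Sum>k<n. q k))"
      using s_nonneg q by (simp add: nn_integral_product_density sum_distrib_left sum_nonneg)
    finally show ?thesis .
  qed
  also have "(\<integral>\<^sup>+x. indicator (-S) x \<partial>\<nu>) = ennreal (measure \<nu> (-S))"
    using S by (simp add: sets_\<nu> nu.emeasure_eq_measure borel_comp)
  also have "(\<integral>\<^sup>+x. indicator (-S) x \<partial>\<mu>) = ennreal (measure \<mu> (-S))"
    using S by (simp add: sets_\<mu> mu.emeasure_eq_measure borel_comp)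
  also have "ennreal (s * (\<Sum>k<n. q k)) + (ennreal (4 * T) * ennreal (measure \<nu> (-S)) + ennreal (4 * T) * ennreal (measure \<mu> (-S))
      + ennreal (4 * T) * ennreal (1 - s * real n) + 2 * (\<integral>\<^sup>+x. ennreal (e x) \<partial>\<nu>) + 2 * (\<integral>\<^sup>+x. ennreal (e x) \<partial>\<mu>))
    = ennreal (s * (\<Sum>k<n. q k) + 4 * T * (measure \<nu> (-S) + measure \<mu> (-S) + (1 - s * real n)))
    + 2 * (\<integral>\<^sup>+x. ennreal (e x) \<partial>\<nu>) + 2 * (\<integral>\<^sup>+x. ennreal (e x) \<partial>\<mu>)"
  proof -
    have "0 \<le> s * (\<Sum>k<n. q k)" using s_nonneg q by (simp add: sum_nonneg)
    then have "ennreal (s * (\<Sum>k<n. q k) + 4 * T * (measure \<nu> (-S) + measure \<mu> (-S) + (1 - s * real n)))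
      = ennreal (s * (\<Sum>k<n. q k)) + (ennreal (4 * T) * ennreal (measure \<nu> (-S)) + ennreal (4 * T) * ennreal (measure \<mu> (-S))
      + ennreal (4 * T) * ennreal (1 - s * real n))"
      using T s_less by (simp add: ennreal_mult[symmetric] ennreal_plus[symmetric] distrib_left add.assoc del: ennreal_plus)
    then show ?thesis by (simp add: add.assoc)
  qed
  finally show ?thesis unfolding e_def .
qed

end

text \<open>The pair \<open>(x k, y k)\<close> is spread over the cells of its two points, uniformly
  with respect to \<nu> and \<mu>. The frequency bounds keep the sum of these densities, scaled by
  \<open>s\<close>, below \<open>1\<close>. Cell \<open>m\<close> collects everything without a
  diameter bound and is left to the crude estimate.\<close>

lemma T2_le_samples:
  fixes \<nu> \<mu> :: "'a::euclidean_space measure" and c :: "'a \<Rightarrow> nat"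
  assumes \<nu>: "prob_space \<nu>" "sets \<nu> = sets borel" and \<mu>: "prob_space \<mu>" "sets \<mu> = sets borel"
    and c: "c \<in> measurable borel (count_space UNIV)" "\<And>p. c p \<le> m"
    and cell: "\<And>p q. c p = c q \<Longrightarrow> c p < m \<Longrightarrow> dist p q \<le> 2 * \<delta>" and \<delta>: "\<delta> > 0"
    and n: "n > 0" and \<eta>: "\<eta> > 0" and T: "T \<ge> 0"
    and x: "\<And>j. j \<le> m \<Longrightarrow> (\<Sum>k<n. indicat_real (c -` {j}) (x k)) \<le> real n * ((1 + \<eta>) * measure \<nu> (c -` {j}))"
    and y: "\<And>j. j \<le> m \<Longrightarrow> (\<Sum>k<n. indicat_real (c -` {j}) (y k)) \<le> real n * ((1 + \<eta>) * measure \<mu> (c -` {j}))"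
  shows "T2 \<nu> \<mu> \<le> ennreal ((1 + \<delta>) * ((l2dist n x y)\<^sup>2 / real n) + 16 * \<delta> * (1 + \<delta>)
      + 4 * T * (measure \<nu> (c -` {m}) + measure \<mu> (c -` {m}) + \<eta>))
    + 2 * (\<integral>\<^sup>+x. ennreal (max 0 ((norm x)\<^sup>2 - T)) \<partial>\<nu>) + 2 * (\<integral>\<^sup>+x. ennreal (max 0 ((norm x)\<^sup>2 - T)) \<partial>\<mu>)"
proof -
  \<comment> \<open>Slightly less than \<open>1 / n\<close>: the factor \<open>1 + \<eta>\<close>
    absorbs the excess of the frequencies and leaves the unmatched mass \<open>1 - s * n\<close>,
    which is positive and at most \<eta>.\<close>
  define s where "s = 1 / (real n * (1 + \<eta>))"
  define dn where "dn = (\<lambda>(\<rho>::'a measure) (z::nat \<Rightarrow> 'a) k p. indicat_real (c -` {c (z k)}) p / measure \<rho> (c -` {c (z k)}))"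
  have cs: "c -` {j} \<in> sets borel" for j using measurable_sets[OF c(1), of "{j}"] by simp
  have s0: "s \<ge> 0" using \<eta> by (simp add: s_def)
  have sn: "s * real n = 1 / (1 + \<eta>)" using n by (simp add: s_def)
  have dn_meas: "dn \<rho> z k \<in> borel_measurable borel" for \<rho> z k
    unfolding dn_def using cs by measurable
  have dn_nonneg: "0 \<le> dn \<rho> z k p" for \<rho> z k p by (simp add: dn_def)
  have props: "integrable \<rho> (dn \<rho> z k)" "(\<integral>p. dn \<rho> z k p \<partial>\<rho>) = 1" "s * (\<Sum>k<n. dn \<rho> z k p) \<le> 1"
    if \<rho>: "prob_space \<rho>" "sets \<rho> = sets borel"
      and z: "\<And>j. j \<le> m \<Longrightarrow> (\<Sum>k<n. indicat_real (c -` {j}) (z k)) \<le> real n * ((1 + \<eta>) * measure \<rho> (c -` {j}))"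
      and k: "k < n" for \<rho> z k p
  proof -
    interpret rho: prob_space \<rho> by fact
    \<comment> \<open>A cell that contains a sample cannot be null, since its frequency bound would
      be \<open>0\<close>.\<close>
    have "1 \<le> (\<Sum>i<n. indicat_real (c -` {c (z k)}) (z i))"
      using member_le_sum[of k "{..<n}" "\<lambda>i. indicat_real (c -` {c (z k)}) (z i)"] k by simp
    also have "\<dots> \<le> real n * ((1 + \<eta>) * measure \<rho> (c -` {c (z k)}))" by (intro z c)
    finally have pos: "measure \<rho> (c -` {c (z k)}) \<noteq> 0" by auto
    have ind: "integrable \<rho> (indicat_real (c -` {c (z k)}))"
      using cs \<rho>(2) by (intro rho.integrable_const_bound[where B=1]) (auto simp: indicator_def)
    then show "integrable \<rho> (dn \<rho> z k)" unfolding dn_def by simp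
    show "(\<integral>p. dn \<rho> z k p \<partial>\<rho>) = 1" unfolding dn_def using pos cs \<rho>(2) by simp
    \<comment> \<open>At \<open>p\<close> only the samples in the cell of \<open>p\<close>
      contribute, all with the same height.\<close>
    have eq: "(\<Sum>k<n. dn \<rho> z k p) = (\<Sum>k<n. indicat_real (c -` {c p}) (z k)) / measure \<rho> (c -` {c p})"
      unfolding sum_divide_distrib by (intro sum.cong) (auto simp: dn_def indicator_def)
    show "s * (\<Sum>k<n. dn \<rho> z k p) \<le> 1"
    proof (cases "measure \<rho> (c -` {c p}) = 0")
      case False
      then have mp: "measure \<rho> (c -` {c p}) > 0" by (simp add: zero_less_measure_iff)
      have "(\<Sum>k<n. dn \<rho> z k p) \<le> real n * ((1 + \<eta>) * measure \<rho> (c -` {c p})) / measure \<rho> (c -` {c p})"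
        unfolding eq by (intro divide_right_mono z c) simp
      also have "\<dots> = real n * (1 + \<eta>)" using mp by simp
      finally have "s * (\<Sum>k<n. dn \<rho> z k p) \<le> s * (real n * (1 + \<eta>))" using s0 by (rule mult_left_mono)
      also have "\<dots> = 1" using n \<eta> by (simp add: s_def)
      finally show ?thesis .
    qed (simp add: eq)
  qed
  interpret gluing \<nu> \<mu> n s "dn \<nu> x" "dn \<mu> y"
  proof (intro gluing.intro gluing_axioms.intro \<nu> \<mu> dn_meas dn_nonneg s0)
    show "integrable \<nu> (dn \<nu> x k)" "(\<integral>p. dn \<nu> x k p \<partial>\<nu>) = 1" if "k < n" for k
      using props(1,2)[OF \<nu> x that] by auto
    show "integrable \<mu> (dn \<mu> y k)" "(\<integral>p. dn \<mu> y k p \<partial>\<mu>) = 1" if "k < n" for k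
      using props(1,2)[OF \<mu> y that] by auto
    show "s * (\<Sum>k<n. dn \<nu> x k p) \<le> 1" "s * (\<Sum>k<n. dn \<mu> y k p) \<le> 1" for p
      using props(3)[OF \<nu> x n] props(3)[OF \<mu> y n] by auto
    show "s * real n < 1" unfolding sn using \<eta> by simp
  qed
  have S: "- (c -` {m}) \<in> sets borel" using cs by (rule borel_comp)
  \<comment> \<open>Moving each of the two points within its cell changes the distance by at most
    \<open>2 * \<delta>\<close>.\<close>
  have close: "(dist p q)\<^sup>2 \<le> (dist (x k) (y k) + 4 * \<delta>)\<^sup>2"
    if "k < n" "p \<in> - (c -` {m})" "q \<in> - (c -` {m})" "dn \<nu> x k p \<noteq> 0" "dn \<mu> y k q \<noteq> 0" for k p q
  proof -
    have pq: "c p = c (x k)" "c q = c (y k)" using that(4,5) by (auto simp: dn_def indicator_def split: if_splits)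
    have "c p < m" "c q < m" using that(2,3) c(2)[of p] c(2)[of q] by auto
    then have "dist p (x k) \<le> 2 * \<delta>" "dist q (y k) \<le> 2 * \<delta>" using cell pq by auto
    then have "dist p q \<le> dist (x k) (y k) + 4 * \<delta>"
      using dist_triangle[of p q "x k"] dist_triangle[of "x k" q "y k"] by (simp add: dist_commute)
    then show ?thesis by (intro power_mono) auto
  qed
  have "T2 \<nu> \<mu> \<le> ennreal (s * (\<Sum>k<n. (dist (x k) (y k) + 4 * \<delta>)\<^sup>2)
      + 4 * T * (measure \<nu> (- (- (c -` {m}))) + measure \<mu> (- (- (c -` {m}))) + (1 - s * real n)))
    + 2 * (\<integral>\<^sup>+x. ennreal (max 0 ((norm x)\<^sup>2 - T)) \<partial>\<nu>) + 2 * (\<integral>\<^sup>+x. ennreal (max 0 ((norm x)\<^sup>2 - T)) \<partial>\<mu>)"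
    by (rule T2_le_glue[OF S T _ close]) auto
  also have "s * (\<Sum>k<n. (dist (x k) (y k) + 4 * \<delta>)\<^sup>2)
      + 4 * T * (measure \<nu> (- (- (c -` {m}))) + measure \<mu> (- (- (c -` {m}))) + (1 - s * real n))
    \<le> (1 + \<delta>) * ((l2dist n x y)\<^sup>2 / real n) + 16 * \<delta> * (1 + \<delta>)
      + 4 * T * (measure \<nu> (c -` {m}) + measure \<mu> (c -` {m}) + \<eta>)"
  proof (intro add_mono mult_left_mono)
    \<comment> \<open>Young's inequality for the cross term \<open>8 * \<delta> * d\<close>, with
      defect exactly \<open>\<delta> * (d - 4)\<^sup>2\<close>.\<close>
    have young: "(d + 4 * \<delta>)\<^sup>2 \<le> (1 + \<delta>) * d\<^sup>2 + 16 * \<delta> * (1 + \<delta>)" for d :: real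
    proof -
      have "(1 + \<delta>) * d\<^sup>2 + 16 * \<delta> * (1 + \<delta>) - (d + 4 * \<delta>)\<^sup>2 = \<delta> * (d - 4)\<^sup>2"
        by (simp add: power2_eq_square algebra_simps)
      also have "\<dots> \<ge> 0" using \<delta> by simp
      finally show ?thesis by simp
    qed
    have "s \<le> 1 / real n"
      unfolding s_def using n \<eta> by (intro divide_left_mono) simp_all
    then have "s * (\<Sum>k<n. (dist (x k) (y k) + 4 * \<delta>)\<^sup>2) \<le> (1 / real n) * (\<Sum>k<n. (dist (x k) (y k) + 4 * \<delta>)\<^sup>2)"
      by (intro mult_right_mono sum_nonneg) auto
    also have "\<dots> \<le> (1 / real n) * (\<Sum>k<n. (1 + \<delta>) * (dist (x k) (y k))\<^sup>2 + 16 * \<delta> * (1 + \<delta>))"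
      by (intro mult_left_mono sum_mono young) simp
    also have "\<dots> = (1 + \<delta>) * ((\<Sum>k<n. (dist (x k) (y k))\<^sup>2) / real n) + 16 * \<delta> * (1 + \<delta>)"
      using n by (simp add: sum.distrib sum_distrib_left[symmetric] field_simps)
    also have "(\<Sum>k<n. (dist (x k) (y k))\<^sup>2) = (l2dist n x y)\<^sup>2"
      by (simp add: l2dist_def dist_norm sum_nonneg)
    finally show "s * (\<Sum>k<n. (dist (x k) (y k) + 4 * \<delta>)\<^sup>2)
      \<le> (1 + \<delta>) * ((l2dist n x y)\<^sup>2 / real n) + 16 * \<delta> * (1 + \<delta>)" .
    show "1 - s * real n \<le> \<eta>" unfolding sn using \<eta> by (simp add: field_simps)
  qed (use T in auto)
  finally show ?thesis by (simp add: add_mono ennreal_leI)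
qed

section \<open>Relative entropy and moments\<close>

text \<open>The factors \<open>D\<close> and \<open>1 / D\<close> cancel where \<open>D\<close> is
  positive; the integral of \<open>u\<close> over the zeros of \<open>D\<close> is lost on the
  left.\<close>

lemma nn_integral_divide_density_le:
  fixes D u :: "'a \<Rightarrow> real"
  assumes D: "D \<in> borel_measurable \<mu>" and u: "u \<in> borel_measurable \<mu>" "\<And>x. 0 \<le> u x"
    and D0: "\<And>x. 0 \<le> D x"
  shows "(\<integral>\<^sup>+x. ennreal (u x / D x) \<partial>density \<mu> (\<lambda>x. ennreal (D x))) \<le> (\<integral>\<^sup>+x. ennreal (u x) \<partial>\<mu>)"
proof -
  have "(\<integral>\<^sup>+x. ennreal (u x / D x) \<partial>density \<mu> (\<lambda>x. ennreal (D x))) = (\<integral>\<^sup>+x. ennreal (D x) * ennreal (u x / D x) \<partial>\<mu>)"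
    using D u by (intro nn_integral_density) auto
  also have "\<dots> \<le> (\<integral>\<^sup>+x. ennreal (u x) \<partial>\<mu>)"
    using D0 u(2) by (intro nn_integral_mono) (auto simp: ennreal_mult[symmetric] intro!: ennreal_leI)
  finally show ?thesis .
qed

text \<open>Unpacks finite entropy into a genuine integral. The bound
  \<open>1 - 1 / D \<le> ln D\<close> does two things: since \<open>1 / D\<close> has \<nu>-integral
  at most \<open>1\<close>, the negative part is finite and no difference of infinities occurs;
  integrated, the same bound gives nonnegativity.\<close>

lemma rel_entropy_cases:
  fixes \<mu> :: "'a measure"
  assumes \<mu>: "prob_space \<mu>" and \<nu>: "prob_space \<nu>" and fin: "rel_entropy \<nu> \<mu> \<noteq> \<infinity>"
  obtains D :: "'a \<Rightarrow> real" where "D \<in> borel_measurable \<mu>" "\<And>x. 0 \<le> D x" "\<nu> = density \<mu> (\<lambda>x. ennreal (D x))"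
    "AE x in \<nu>. 0 < D x" "integrable \<nu> (\<lambda>x. ln (D x))" "rel_entropy \<nu> \<mu> = ereal (\<integral>x. ln (D x) \<partial>\<nu>)"
    "0 \<le> (\<integral>x. ln (D x) \<partial>\<nu>)"
proof -
  interpret mu: prob_space \<mu> by fact
  interpret nu: prob_space \<nu> by fact
  have ac: "absolutely_continuous \<mu> \<nu>" "sets \<nu> = sets \<mu>"
    using fin by (auto simp: rel_entropy_def split: if_splits)
  obtain D :: "'a \<Rightarrow> real" where D: "D \<in> borel_measurable \<mu>" "AE x in \<mu>. RN_deriv \<mu> \<nu> x = ennreal (D x)"
    "AE x in \<nu>. 0 < D x" "\<And>x. 0 \<le> D x"
    using mu.real_RN_deriv[OF nu.finite_measure_axioms ac] by blast
  have "\<nu> = density \<mu> (RN_deriv \<mu> \<nu>)" using mu.density_RN_deriv[OF ac] by simp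
  also have "\<dots> = density \<mu> (\<lambda>x. ennreal (D x))" using D by (intro density_cong) auto
  finally have dens: "\<nu> = density \<mu> (\<lambda>x. ennreal (D x))" .
  have Dn [measurable]: "D \<in> borel_measurable \<nu>" using D(1) measurable_cong_sets[OF ac(2) refl] by blast
  let ?f = "\<lambda>x. ln (enn2real (RN_deriv \<mu> \<nu> x))"
  have "AE x in \<mu>. ?f x = ln (D x)" using D(2) by eventually_elim (simp add: D(4))
  then have eq: "AE x in \<nu>. ?f x = ln (D x)" using absolutely_continuous_AE[OF ac(2) ac(1)] by simp
  have ent: "rel_entropy \<nu> \<mu> = enn2ereal (\<integral>\<^sup>+x. ennreal (ln (D x)) \<partial>\<nu>) - enn2ereal (\<integral>\<^sup>+x. ennreal (- ln (D x)) \<partial>\<nu>)"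
  proof -
    have "(\<integral>\<^sup>+x. ennreal (?f x) \<partial>\<nu>) = (\<integral>\<^sup>+x. ennreal (ln (D x)) \<partial>\<nu>)"
      by (intro nn_integral_cong_AE) (use eq in \<open>eventually_elim, simp\<close>)
    moreover have "(\<integral>\<^sup>+x. ennreal (- ?f x) \<partial>\<nu>) = (\<integral>\<^sup>+x. ennreal (- ln (D x)) \<partial>\<nu>)"
      by (intro nn_integral_cong_AE) (use eq in \<open>eventually_elim, simp\<close>)
    ultimately show ?thesis using ac by (simp add: rel_entropy_def)
  qed
  have inv: "(\<integral>\<^sup>+x. ennreal (1 / D x) \<partial>\<nu>) \<le> 1"
    using nn_integral_divide_density_le[of D \<mu> "\<lambda>_. 1"] D dens by (simp add: mu.emeasure_space_1)
  have low: "AE x in \<nu>. 1 - 1 / D x \<le> ln (D x)"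
    using D(3)
  proof eventually_elim
    case (elim x)
    have "ln (1 / D x) \<le> 1 / D x - 1" using elim by (intro ln_le_minus_one) simp
    then show ?case using elim by (simp add: ln_div)
  qed
  have "(\<integral>\<^sup>+x. ennreal (- ln (D x)) \<partial>\<nu>) \<le> (\<integral>\<^sup>+x. ennreal (1 / D x) \<partial>\<nu>)"
    by (intro nn_integral_mono_AE) (use low in \<open>eventually_elim, auto intro!: ennreal_leI\<close>)
  then have neg: "(\<integral>\<^sup>+x. ennreal (- ln (D x)) \<partial>\<nu>) \<noteq> \<infinity>" using inv by (auto simp: top_unique)
  have pos: "(\<integral>\<^sup>+x. ennreal (ln (D x)) \<partial>\<nu>) \<noteq> \<infinity>"
  proof
    assume "(\<integral>\<^sup>+x. ennreal (ln (D x)) \<partial>\<nu>) = \<infinity>"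
    then have "rel_entropy \<nu> \<mu> = \<infinity>" unfolding ent by (simp add: top_ereal_def)
    with fin show False by simp
  qed
  have int: "integrable \<nu> (\<lambda>x. ln (D x))" using pos neg by (simp add: real_integrable_def)
  have "rel_entropy \<nu> \<mu> = ereal (\<integral>x. ln (D x) \<partial>\<nu>)"
    unfolding ent by (rule nn_integral_parts[OF int])
  moreover have "0 \<le> (\<integral>x. ln (D x) \<partial>\<nu>)"
  proof -
    have i: "integrable \<nu> (\<lambda>x. 1 / D x)"
      using inv D(4) by (intro integrableI_nonneg) (auto simp: top_unique less_top[symmetric] neq_top_trans)
    have "(\<integral>x. 1 / D x \<partial>\<nu>) \<le> 1"
      using inv D(4) i by (simp add: nn_integral_eq_integral)
    then have "0 \<le> (\<integral>x. 1 - 1 / D x \<partial>\<nu>)" using i by (simp add: nu.prob_space)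
    also have "\<dots> \<le> (\<integral>x. ln (D x) \<partial>\<nu>)" using i int low by (intro integral_mono_AE) auto
    finally show ?thesis .
  qed
  ultimately show ?thesis using that D dens int by blast
qed

section \<open>Second moments from Gaussian tails\<close>

text \<open>The inequality \<open>t \<le> exp t\<close> at
  \<open>t = l * (norm x)\<^sup>2 - ln (D x)\<close> bounds \<open>l * (norm x)\<^sup>2\<close> by
  two terms: the logarithm, integrable by assumption, and an exponential divided by
  \<open>D\<close>, whose \<nu>-integral is at most the exponential moment of \<mu>.\<close>

lemma square_moment_of_exp_moment:
  fixes D :: "'a::euclidean_space \<Rightarrow> real"
  assumes D: "D \<in> borel_measurable \<mu>" "\<And>x. 0 \<le> D x" and \<mu>: "sets \<mu> = sets borel"
    and \<nu>: "\<nu> = density \<mu> (\<lambda>x. ennreal (D x))" "AE x in \<nu>. 0 < D x"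
    and int: "integrable \<nu> (\<lambda>x. ln (D x))"
    and l: "l > 0" and exp: "(\<integral>\<^sup>+x. ennreal (exp (l * (norm x)\<^sup>2)) \<partial>\<mu>) < \<infinity>"
  shows "integrable \<nu> (\<lambda>x. (norm x)\<^sup>2)"
proof -
  have \<nu>s: "sets \<nu> = sets borel" by (simp add: \<nu> \<mu>)
  have [measurable]: "D \<in> borel_measurable \<nu>" using D(1) measurable_cong_sets[of \<nu> \<mu> borel borel] \<nu> by simp
  have nm [measurable]: "norm \<in> borel_measurable \<nu>" using measurable_cong_sets[OF \<nu>s refl] borel_measurable_norm by blast
  have nm' [measurable]: "norm \<in> borel_measurable \<mu>" using measurable_cong_sets[OF \<mu> refl] borel_measurable_norm by blast
  have "AE x in \<nu>. ennreal (l * (norm x)\<^sup>2) \<le> ennreal \<bar>ln (D x)\<bar> + ennreal (exp (l * (norm x)\<^sup>2) / D x)"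
    using \<nu>(2)
  proof eventually_elim
    case (elim x)
    have "l * (norm x)\<^sup>2 - ln (D x) \<le> exp (l * (norm x)\<^sup>2 - ln (D x))"
      using exp_ge_add_one_self[of "l * (norm x)\<^sup>2 - ln (D x)"] by linarith
    also have "\<dots> = exp (l * (norm x)\<^sup>2) / D x" using elim by (simp add: exp_diff)
    finally have "l * (norm x)\<^sup>2 \<le> \<bar>ln (D x)\<bar> + exp (l * (norm x)\<^sup>2) / D x" by linarith
    then show ?case using elim by (simp add: ennreal_plus[symmetric] ennreal_leI del: ennreal_plus)
  qed
  then have "(\<integral>\<^sup>+x. ennreal (l * (norm x)\<^sup>2) \<partial>\<nu>) \<le> (\<integral>\<^sup>+x. ennreal \<bar>ln (D x)\<bar> + ennreal (exp (l * (norm x)\<^sup>2) / D x) \<partial>\<nu>)"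
    by (rule nn_integral_mono_AE)
  also have "\<dots> = (\<integral>\<^sup>+x. ennreal \<bar>ln (D x)\<bar> \<partial>\<nu>) + (\<integral>\<^sup>+x. ennreal (exp (l * (norm x)\<^sup>2) / D x) \<partial>\<nu>)"
    by (intro nn_integral_add) measurable
  also have "\<dots> < \<infinity>"
  proof -
    have "(\<integral>\<^sup>+x. ennreal \<bar>ln (D x)\<bar> \<partial>\<nu>) < \<infinity>" using int by (simp add: integrable_iff_bounded)
    moreover have "(\<integral>\<^sup>+x. ennreal (exp (l * (norm x)\<^sup>2) / D x) \<partial>\<nu>) < \<infinity>"
      using nn_integral_divide_density_le[of D \<mu> "\<lambda>x. exp (l * (norm x)\<^sup>2)"] D exp \<nu>
      by (auto intro: le_less_trans)
    ultimately show ?thesis by (simp add: ennreal_add_eq_top less_top)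
  qed
  finally have "integrable \<nu> (\<lambda>x. l * (norm x)\<^sup>2)"
    using l by (intro integrableI_nonneg) auto
  then show ?thesis using l by simp
qed

text \<open>Sum over the shells between the radii \<open>k\<close> and \<open>k + 1\<close>. For
  large \<open>k\<close> the exponent \<open>a / 8 * (k + 1)\<^sup>2\<close> is outweighed by
  \<open>a * (k - R)\<^sup>2\<close>, whatever \<open>R\<close> is; any positive factor below
  \<open>a\<close> would do in place of \<open>a / 8\<close>.\<close>

lemma exp_moment_of_tail:
  fixes \<mu> :: "'a::euclidean_space measure"
  assumes \<mu>: "prob_space \<mu>" "sets \<mu> = sets borel" and a: "a > 0" and b: "b \<ge> 0"
    and tail: "\<And>t. t \<ge> R \<Longrightarrow> measure \<mu> {x. norm x > t} \<le> b * exp (- a * (t - R)\<^sup>2)"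
  shows "(\<integral>\<^sup>+x. ennreal (exp (a / 8 * (norm x)\<^sup>2)) \<partial>\<mu>) < \<infinity>"
proof -
  interpret mu: prob_space \<mu> by fact
  have nm [measurable]: "norm \<in> borel_measurable \<mu>" using measurable_cong_sets[OF \<mu>(2) refl] borel_measurable_norm by blast
  have sp: "space \<mu> = UNIV" using sets_eq_imp_space_eq[OF \<mu>(2)] by simp
  define w where "w k = exp (a / 8 * (real k + 1)\<^sup>2) * measure \<mu> {x. norm x > real k}" for k :: nat
  have sets: "{x. norm x > t} \<in> sets \<mu>" for t :: real
    using measurable_sets[OF nm, of "{t<..}"] by (simp add: sp vimage_def)
  have bound: "ennreal (exp (a / 8 * (norm x)\<^sup>2)) \<le> 1 + (\<Sum>k. ennreal (exp (a / 8 * (real k + 1)\<^sup>2)) * indicator {x. norm x > real k} x)" for x :: 'a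
  proof (cases "x = 0")
    case False
    define k where "k = nat (\<lceil>norm x\<rceil> - 1)"
    have k: "real k < norm x" "norm x \<le> real k + 1"
    proof -
      have "\<lceil>norm x\<rceil> \<ge> 1" using False by simp
      then have "real k = of_int \<lceil>norm x\<rceil> - 1" by (simp add: k_def)
      then show "real k < norm x" "norm x \<le> real k + 1" by linarith+
    qed
    have "ennreal (exp (a / 8 * (norm x)\<^sup>2)) \<le> ennreal (exp (a / 8 * (real k + 1)\<^sup>2))"
      using k(2) a by (intro ennreal_leI) (simp add: power_mono)
    also have "\<dots> = ennreal (exp (a / 8 * (real k + 1)\<^sup>2)) * indicator {x. norm x > real k} x" using k by simp
    also have "\<dots> \<le> (\<Sum>k. ennreal (exp (a / 8 * (real k + 1)\<^sup>2)) * indicator {x. norm x > real k} x)"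
    proof -
      have "F k \<le> (\<Sum>k. F k)" for F :: "nat \<Rightarrow> ennreal"
        using sum_le_suminf[of F "{k}"] by simp
      then show ?thesis .
    qed
    also have "\<dots> \<le> 1 + \<dots>" by (rule add_increasing) simp_all
    finally show ?thesis .
  qed simp
  have "summable w"
  proof (rule summable_comparison_test_ev)
    have "eventually (\<lambda>k::nat. a / 8 * (real k + 1)\<^sup>2 - a * (real k - R)\<^sup>2 \<le> - real k) sequentially"
      using a by real_asymp
    moreover have "eventually (\<lambda>k::nat. R \<le> real k) sequentially"
      by (simp add: eventually_sequentially) (meson le_trans of_nat_mono order_trans real_arch_simple)
    ultimately show "eventually (\<lambda>k. norm (w k) \<le> b * exp (-1) ^ k) sequentially"
    proof eventually_elim
      case (elim k)
      have "w k \<le> exp (a / 8 * (real k + 1)\<^sup>2) * (b * exp (- a * (real k - R)\<^sup>2))"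
        unfolding w_def using elim by (intro mult_left_mono tail) auto
      also have "\<dots> = b * exp (a / 8 * (real k + 1)\<^sup>2 - a * (real k - R)\<^sup>2)" 
        by (simp add: exp_add[symmetric] mult.left_commute[of _ b])
      also have "\<dots> \<le> b * exp (- real k)" using elim b by (intro mult_left_mono) auto
      also have "exp (- real k) = exp (-1) ^ k" by (simp add: exp_of_nat_mult[symmetric])
      finally show ?case by (simp add: w_def)
    qed
    show "summable (\<lambda>k. b * exp (-1) ^ k)" by (intro summable_mult summable_geometric) simp
  qed
  have "(\<integral>\<^sup>+x. ennreal (exp (a / 8 * (norm x)\<^sup>2)) \<partial>\<mu>)
      \<le> (\<integral>\<^sup>+x. 1 + (\<Sum>k. ennreal (exp (a / 8 * (real k + 1)\<^sup>2)) * indicator {x. norm x > real k} x) \<partial>\<mu>)"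
    by (intro nn_integral_mono bound)
  also have "\<dots> = 1 + (\<Sum>k. ennreal (exp (a / 8 * (real k + 1)\<^sup>2)) * emeasure \<mu> {x. norm x > real k})"
    using sets by (simp add: nn_integral_add nn_integral_suminf nn_integral_cmult_indicator mu.emeasure_space_1)
  also have "(\<Sum>k. ennreal (exp (a / 8 * (real k + 1)\<^sup>2)) * emeasure \<mu> {x. norm x > real k}) = (\<Sum>k. ennreal (w k))"
    by (simp add: w_def mu.emeasure_eq_measure ennreal_mult)
  also have "\<dots> = ennreal (\<Sum>k. w k)"
    by (rule suminf_ennreal2[OF _ \<open>summable w\<close>]) (simp add: w_def)
  finally show ?thesis by (rule le_less_trans) (simp add: less_top[symmetric])
qed

text \<open>Concentration is applied to a ball around the origin of radius \<open>k\<close> and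
  measure above \<open>1/2\<close>. Its enlargement by \<open>r\<close> lies in the ball of radius
  \<open>k + r\<close>, whence \<open>R = k + r\<^sub>o\<close>.\<close>

lemma concentration_imp_tail:
  fixes \<mu> :: "'a::euclidean_space measure"
  assumes \<mu>: "prob_space \<mu>" "sets \<mu> = sets borel" and r\<^sub>o: "r\<^sub>o \<ge> 0" and b: "b \<ge> 0"
    and conc: "\<And>A r. A \<in> sets (prodn 1 \<mu>) \<Longrightarrow> measure (prodn 1 \<mu>) A \<ge> 1/2 \<Longrightarrow> r \<ge> r\<^sub>o \<Longrightarrow>
      measure (completion (prodn 1 \<mu>)) (enlarge 1 A r) \<ge> 1 - b * exp (- a * (r - r\<^sub>o)\<^sup>2)"
  obtains R where "\<And>t. t \<ge> R \<Longrightarrow> measure \<mu> {x. norm x > t} \<le> b * exp (- a * (t - R)\<^sup>2)"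
proof -
  interpret mu: prob_space \<mu> by fact
  let ?P = "prodn 1 \<mu>"
  interpret P: prob_space ?P unfolding prodn_def by (rule prob_space_PiM[OF \<mu>(1)])
  have sp: "space \<mu> = UNIV" using sets_eq_imp_space_eq[OF \<mu>(2)] by simp
  have spP: "space ?P = PiE {..<1} (\<lambda>_. UNIV)" by (simp add: prodn_def space_PiM sp)
  have comp: "(\<lambda>x. x 0) \<in> measurable ?P \<mu>" unfolding prodn_def by (rule measurable_component_singleton) simp
  have distr: "distr ?P \<mu> (\<lambda>x. x 0) = \<mu>"
    unfolding prodn_def by (rule distr_PiM_component[where M="\<lambda>_. \<mu>"]) (use \<mu> in auto)
  have cb: "cball (0::'a) t \<in> sets \<mu>" for t by (simp add: \<mu>)
  have meas: "measure ?P {x \<in> space ?P. x 0 \<in> C} = measure \<mu> C" if "C \<in> sets \<mu>" for C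
  proof -
    have "measure \<mu> C = measure (distr ?P \<mu> (\<lambda>x. x 0)) C" by (simp only: distr)
    also have "\<dots> = measure ?P ((\<lambda>x. x 0) -` C \<inter> space ?P)" using that by (rule measure_distr[OF comp])
    also have "(\<lambda>x. x 0) -` C \<inter> space ?P = {x \<in> space ?P. x 0 \<in> C}" by auto
    finally show ?thesis by simp
  qed
  have "(\<lambda>k. measure \<mu> (cball 0 (real k))) \<longlonglongrightarrow> measure \<mu> (\<Union>k. cball 0 (real k))"
    using cb by (intro mu.finite_Lim_measure_incseq) (auto simp: incseq_def)
  also have "(\<Union>k. cball (0::'a) (real k)) = space \<mu>" using real_arch_simple by (auto simp: sp)
  finally have "(\<lambda>k. measure \<mu> (cball 0 (real k))) \<longlonglongrightarrow> 1" by (simp add: mu.prob_space)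
  then have "eventually (\<lambda>k. 1/2 < measure \<mu> (cball 0 (real k))) sequentially" by (rule order_tendstoD) simp
  then obtain k :: nat where k: "1/2 < measure \<mu> (cball 0 (real k))" by (auto simp: eventually_sequentially)
  define A where "A = {x \<in> space ?P. x 0 \<in> cball 0 (real k)}"
  have A: "A \<in> sets ?P"
    unfolding A_def using measurable_sets[OF comp cb] by (simp add: vimage_def Int_def conj_commute)
  have Ah: "measure ?P A \<ge> 1/2" using k meas[OF cb] by (simp add: A_def)
  show ?thesis
  proof (rule that[of "real k + r\<^sub>o"])
    fix t assume t: "real k + r\<^sub>o \<le> t"
    define r where "r = t - real k"
    let ?E = "{x \<in> space ?P. x 0 \<in> cball 0 t}"
    have E: "?E \<in> sets ?P" using measurable_sets[OF comp cb] by (simp add: vimage_def Int_def conj_commute)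
    have "enlarge 1 A r \<subseteq> ?E"
    proof
      fix x assume "x \<in> enlarge 1 A r"
      then obtain y where y: "x \<in> space ?P" "y \<in> A" "l2dist 1 x y \<le> r" unfolding enlarge_def spP by blast
      then have "norm (x 0 - y 0) \<le> r" "norm (y 0) \<le> real k" by (auto simp: l2dist_def A_def)
      then have "norm (x 0) \<le> t" using norm_triangle_ineq[of "x 0 - y 0" "y 0"] by (simp add: r_def)
      then show "x \<in> ?E" using y by simp
    qed
    then have "measure (completion ?P) (enlarge 1 A r) \<le> measure (completion ?P) ?E"
    \<comment> \<open>Off the measurable sets \<open>measure\<close> is \<open>0\<close>, so the
      comparison holds in either case.\<close>
    proof (cases "enlarge 1 A r \<in> sets (completion ?P)")
      case True
      have "finite_measure (completion ?P)"
        by (rule finite_measureI) (use P.emeasure_space_1 in simp)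
      then show ?thesis using \<open>enlarge 1 A r \<subseteq> ?E\<close> E by (intro finite_measure.finite_measure_mono) auto
    qed (simp add: measure_notin_sets)
    moreover have "measure (completion ?P) (enlarge 1 A r) \<ge> 1 - b * exp (- a * (r - r\<^sub>o)\<^sup>2)"
      using A Ah t by (intro conc) (auto simp: r_def)
    moreover have "measure (completion ?P) ?E = measure \<mu> (cball 0 t)"
      unfolding measure_completion[OF E] by (rule meas[OF cb])
    ultimately have "measure \<mu> (cball 0 t) \<ge> 1 - b * exp (- a * (t - (real k + r\<^sub>o))\<^sup>2)"
      by (simp add: r_def algebra_simps)
    moreover have "measure \<mu> (space \<mu> - cball 0 t) = 1 - measure \<mu> (cball 0 t)" by (rule mu.prob_compl[OF cb])
    moreover have "space \<mu> - cball 0 t = {x. norm x > t}" by (auto simp: sp)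
    ultimately show "measure \<mu> {x. norm x > t} \<le> b * exp (- a * (t - (real k + r\<^sub>o))\<^sup>2)" by simp
  qed
qed

lemma truncated_square_moment_tendsto_0:
  fixes \<mu> :: "'a::euclidean_space measure"
  assumes \<mu>: "sets \<mu> = sets borel" and int: "integrable \<mu> (\<lambda>x. (norm x)\<^sup>2)"
  shows "(\<lambda>k::nat. \<integral>x. max 0 ((norm x)\<^sup>2 - real k) \<partial>\<mu>) \<longlonglongrightarrow> 0"
proof -
  have [measurable]: "norm \<in> borel_measurable \<mu>" using measurable_cong_sets[OF \<mu> refl] borel_measurable_norm by blast
  have "(\<lambda>k::nat. \<integral>x. max 0 ((norm x)\<^sup>2 - real k) \<partial>\<mu>) \<longlonglongrightarrow> (\<integral>x. 0 \<partial>\<mu>)"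
  proof (rule integral_dominated_convergence[OF _ _ int])
    show "AE x in \<mu>. (\<lambda>k. max 0 ((norm x)\<^sup>2 - real k)) \<longlonglongrightarrow> 0"
    proof (rule AE_I2)
      fix x :: 'a
      obtain N :: nat where N: "(norm x)\<^sup>2 \<le> real N" using real_arch_simple by blast
      then have "max 0 ((norm x)\<^sup>2 - real k) = 0" if "k \<ge> N" for k using that by simp
      then show "(\<lambda>k. max 0 ((norm x)\<^sup>2 - real k)) \<longlonglongrightarrow> 0"
        by (intro tendsto_eventually eventually_sequentiallyI[of N]) auto
    qed
  qed auto
  then show ?thesis by simp
qed

section \<open>From concentration to transport\<close>

text \<open>Each point is labelled by the first member of a dense sequence closer than \<delta>,
  which cuts the whole space into countably many pieces of balls.\<close>

lemma small_cells:
  assumes \<delta>: "\<delta> > 0"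
  obtains c :: "'a::euclidean_space \<Rightarrow> nat" where "c \<in> measurable borel (count_space UNIV)"
    "\<And>p q. c p = c q \<Longrightarrow> dist p q \<le> 2 * \<delta>"
proof -
  obtain E :: "'a set" where E: "countable E" "\<And>X. open X \<Longrightarrow> X \<noteq> {} \<Longrightarrow> \<exists>d\<in>E. d \<in> X"
    using countable_dense_exists by blast
  have "E \<noteq> {}" using E(2)[of UNIV] by auto
  define c where "c p = (LEAST i. dist p (from_nat_into E i) < \<delta>)" for p
  have ex: "\<exists>i. dist p (from_nat_into E i) < \<delta>" for p
  proof -
    obtain d where "d \<in> E" "d \<in> ball p \<delta>" using E(2)[of "ball p \<delta>"] \<delta> by force
    then show ?thesis using from_nat_into_surj[OF E(1)] by (metis mem_ball)
  qed
  have near: "dist p (from_nat_into E (c p)) < \<delta>" for p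
    unfolding c_def by (rule LeastI_ex[OF ex])
  show ?thesis
  proof (rule that)
    show "c \<in> measurable borel (count_space UNIV)" unfolding c_def by measurable
    show "dist p q \<le> 2 * \<delta>" if "c p = c q" for p q
      using near[of p] near[of q] dist_triangle2[of p q "from_nat_into E (c p)"] that by simp
  qed
qed

text \<open>Capping the labels at \<open>m\<close> leaves finitely many cells and merges the others
  into cell \<open>m\<close>; the merged cells decrease to the empty set.\<close>

lemma last_cell_tendsto_0:
  fixes \<rho> :: "'a::euclidean_space measure"
  assumes \<rho>: "prob_space \<rho>" "sets \<rho> = sets borel" and c: "c \<in> measurable borel (count_space (UNIV::nat set))"
  shows "(\<lambda>m. measure \<rho> ((\<lambda>p. min (c p) m) -` {m})) \<longlonglongrightarrow> 0"
proof -
  interpret rho: prob_space \<rho> by fact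
  have eq: "(\<lambda>p. min (c p) m) -` {m} = c -` {m..}" for m by auto
  have "c -` {m..} \<in> sets \<rho>" for m using measurable_sets[OF c, of "{m..}"] by (simp add: \<rho>)
  then have "(\<lambda>m. measure \<rho> (c -` {m..})) \<longlonglongrightarrow> measure \<rho> (\<Inter>m. c -` {m..})"
    by (intro rho.finite_Lim_measure_decseq) (auto simp: decseq_def)
  also have "(\<Inter>m. c -` {m..}) = {}"
  proof -
    have "p \<notin> (\<Inter>m. c -` {m..})" for p by (auto intro!: exI[of _ "Suc (c p)"])
    then show ?thesis by blast
  qed
  finally show ?thesis by (simp add: eq)
qed

text \<open>There are finitely many cells, so a union bound turns the estimates for single cells
  into one for all of them.\<close>

lemma cell_frequencies_tendsto_1:
  fixes \<rho> :: "'a::euclidean_space measure" and c :: "'a \<Rightarrow> nat" and \<eta> :: real and m :: nat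
  assumes \<rho>: "prob_space \<rho>" "sets \<rho> = sets borel" and c: "c \<in> measurable borel (count_space (UNIV::nat set))" and \<eta>: "\<eta> > 0"
  defines "F \<equiv> \<lambda>n. {x \<in> space (prodn n \<rho>). \<forall>j\<le>m. (\<Sum>k<n. indicat_real (c -` {j}) (x k)) \<le> real n * ((1 + \<eta>) * measure \<rho> (c -` {j}))}"
  shows "F n \<in> sets (prodn n \<rho>)" "(\<lambda>n. measure (prodn n \<rho>) (F n)) \<longlonglongrightarrow> 1"
proof -
  define G where "G j n = {x \<in> space (prodn n \<rho>). real n * ((1 + \<eta>) * measure \<rho> (c -` {j})) < (\<Sum>k<n. indicat_real (c -` {j}) (x k))}" for j n
  have cs: "c -` {j} \<in> sets \<rho>" for j using measurable_sets[OF c, of "{j}"] by (simp add: \<rho>)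
  have G: "G j n \<in> sets (prodn n \<rho>)" for j n
  proof -
    have "(\<lambda>x. \<Sum>k<n. indicat_real (c -` {j}) (x k)) \<in> borel_measurable (prodn n \<rho>)"
      using cs by (intro measurable_sum_prodn) simp
    then show ?thesis unfolding G_def by measurable
  qed
  have F: "F n = space (prodn n \<rho>) - (\<Union>j\<le>m. G j n)" for n
    by (auto simp: F_def G_def not_less)
  show "F n \<in> sets (prodn n \<rho>)" unfolding F using G by (intro sets.Diff sets.top sets.finite_UN) auto
  have "(\<lambda>n. \<Sum>j\<le>m. measure (prodn n \<rho>) (G j n)) \<longlonglongrightarrow> (\<Sum>j\<le>m. 0)"
    unfolding G_def by (intro tendsto_sum prodn_frequency_bound[OF \<rho>(1) cs \<eta>])
  then have lim: "(\<lambda>n. 1 - (\<Sum>j\<le>m. measure (prodn n \<rho>) (G j n))) \<longlonglongrightarrow> 1"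
    using tendsto_diff[OF tendsto_const[of 1]] by fastforce
  have "1 - (\<Sum>j\<le>m. measure (prodn n \<rho>) (G j n)) \<le> measure (prodn n \<rho>) (F n)" for n
  proof -
    interpret P: prob_space "prodn n \<rho>" by (rule prob_space_prodn) fact
    have "measure (prodn n \<rho>) (F n) = 1 - measure (prodn n \<rho>) (\<Union>j\<le>m. G j n)"
      unfolding F using G by (intro P.prob_compl) (auto intro!: sets.finite_UN)
    moreover have "measure (prodn n \<rho>) (\<Union>j\<le>m. G j n) \<le> (\<Sum>j\<le>m. measure (prodn n \<rho>) (G j n))"
      using G by (intro P.finite_measure_subadditive_finite) auto
    ultimately show ?thesis by simp
  qed
  moreover have "measure (prodn n \<rho>) (F n) \<le> 1" for n
    by (rule prob_space.prob_le_1) (rule prob_space_prodn[OF \<rho>(1)])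
  ultimately show "(\<lambda>n. measure (prodn n \<rho>) (F n)) \<longlonglongrightarrow> 1"
    by (intro tendsto_sandwich[OF _ _ lim tendsto_const[of 1]]) auto
qed

lemma concentration_imp_T2:
  fixes \<mu> \<nu> :: "'a::euclidean_space measure"
  assumes \<mu>: "prob_space \<mu>" "sets \<mu> = sets borel" and a: "a > 0" and r\<^sub>o: "r\<^sub>o \<ge> 0" and b: "b \<ge> 0"
    and conc: "\<And>n A r. n \<ge> 1 \<Longrightarrow> A \<in> sets (prodn n \<mu>) \<Longrightarrow> measure (prodn n \<mu>) A \<ge> 1/2 \<Longrightarrow> r \<ge> r\<^sub>o \<Longrightarrow>
      measure (completion (prodn n \<mu>)) (enlarge n A r) \<ge> 1 - b * exp (- a * (r - r\<^sub>o)\<^sup>2)"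
    and \<nu>: "prob_space \<nu>" "sets \<nu> = sets borel"
  shows "enn2ereal (T2 \<nu> \<mu>) \<le> ereal (1 / a) * rel_entropy \<nu> \<mu>"
proof (cases "rel_entropy \<nu> \<mu> = \<infinity>")
  case True
  then show ?thesis using a by simp
next
  case False
  then obtain D :: "'a \<Rightarrow> real" where D: "D \<in> borel_measurable \<mu>" "\<And>x. 0 \<le> D x" "\<nu> = density \<mu> (\<lambda>x. ennreal (D x))"
    "AE x in \<nu>. 0 < D x" "integrable \<nu> (\<lambda>x. ln (D x))" "rel_entropy \<nu> \<mu> = ereal (\<integral>x. ln (D x) \<partial>\<nu>)"
    "0 \<le> (\<integral>x. ln (D x) \<partial>\<nu>)"
    using rel_entropy_cases[OF \<mu>(1) \<nu>(1)] by metis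
  define H where "H = (\<integral>x. ln (D x) \<partial>\<nu>)"
  have H0: "H \<ge> 0" using D(7) by (simp add: H_def)
  obtain R where "\<And>t. t \<ge> R \<Longrightarrow> measure \<mu> {x. norm x > t} \<le> b * exp (- a * (t - R)\<^sup>2)"
    using concentration_imp_tail[OF \<mu> r\<^sub>o b conc] by blast
  then have expm: "(\<integral>\<^sup>+x. ennreal (exp (a / 8 * (norm x)\<^sup>2)) \<partial>\<mu>) < \<infinity>"
    by (rule exp_moment_of_tail[OF \<mu> a b])
  have m\<nu>: "integrable \<nu> (\<lambda>x. (norm x)\<^sup>2)"
    by (rule square_moment_of_exp_moment[OF D(1,2) \<mu>(2) D(3,4,5) _ expm]) (use a in simp)
  \<comment> \<open>The constant density \<open>1\<close>, of logarithm \<open>0\<close>, turns the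
    moment estimate into one for \<mu> itself.\<close>
  have m\<mu>: "integrable \<mu> (\<lambda>x. (norm x)\<^sup>2)"
    by (rule square_moment_of_exp_moment[of "\<lambda>_. 1", OF _ _ \<mu>(2) _ _ _ _ expm]) (use a in \<open>simp_all add: density_1\<close>)
  have "T2 \<nu> \<mu> \<le> ennreal (H / a)"
  proof (rule ennreal_le_epsilon)
    fix e' :: real assume e': "e' > 0"
    \<comment> \<open>The final bound is \<open>K + 7 * e\<close>, that is
      \<open>H / a + (2 / a + 8) * e\<close>; this choice makes the total error
      \<open>e'\<close>.\<close>
    define e where "e = e' / (2 / a + 8)"
    have pos: "2 / a + 8 > 0" using a by (simp add: add_pos_pos)
    then have e: "e > 0" using e' by (simp add: e_def)
    have ee: "2 * e / a + 8 * e = e'"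
    proof -
      have "2 * e / a + 8 * e = e * (2 / a + 8)" by (simp add: algebra_simps)
      then show ?thesis using pos by (simp add: e_def)
    qed
    \<comment> \<open>The bound for the squared radius per sample, whose limit is
      \<open>(H + 2 * e) / a\<close>; the last \<open>e\<close> leaves room for
      \<open>r\<^sub>o\<close>.\<close>
    define K where "K = (H + 2 * e) / a + e"
    have K: "K > 0" unfolding K_def using H0 e a by (intro add_nonneg_pos divide_nonneg_pos) auto
    \<comment> \<open>Chosen so that replacing samples by their cells costs at most
      \<open>e\<close>; since \<open>\<delta> \<le> 1\<close>, the term
      \<open>16 * \<delta> * (1 + \<delta>)\<close> is at most \<open>32 * \<delta>\<close>.\<close>
    define \<delta> where "\<delta> = min 1 (e / (K + 32))"
    have \<delta>: "\<delta> > 0" "\<delta> \<le> 1" using K e by (auto simp: \<delta>_def)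
    have \<delta>K: "(1 + \<delta>) * K + 16 * \<delta> * (1 + \<delta>) \<le> K + e"
    proof -
      have "\<delta> \<le> e / (K + 32)" by (simp add: \<delta>_def)
      then have "\<delta> * (K + 32) \<le> e" using K by (simp add: pos_le_divide_eq)
      moreover have "16 * \<delta> * (1 + \<delta>) \<le> 16 * \<delta> * 2" using \<delta> by (intro mult_left_mono) auto
      ultimately show ?thesis by (simp add: algebra_simps)
    qed
    have "eventually (\<lambda>k::nat. (\<integral>x. max 0 ((norm x)\<^sup>2 - real k) \<partial>\<nu>) < e \<and> (\<integral>x. max 0 ((norm x)\<^sup>2 - real k) \<partial>\<mu>) < e) sequentially"
      using order_tendstoD(2)[OF truncated_square_moment_tendsto_0[OF \<nu>(2) m\<nu>] e]
        order_tendstoD(2)[OF truncated_square_moment_tendsto_0[OF \<mu>(2) m\<mu>] e] by (rule eventually_conj)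
    then obtain t :: nat where t: "(\<integral>x. max 0 ((norm x)\<^sup>2 - real t) \<partial>\<nu>) < e" "(\<integral>x. max 0 ((norm x)\<^sup>2 - real t) \<partial>\<mu>) < e"
      by (auto simp: eventually_sequentially)
    define T where "T = real t"
    have T: "T \<ge> 0" by (simp add: T_def)
    obtain c0 :: "'a \<Rightarrow> nat" where c0: "c0 \<in> measurable borel (count_space UNIV)" "\<And>p q. c0 p = c0 q \<Longrightarrow> dist p q \<le> 2 * \<delta>"
      using small_cells[OF \<delta>(1)] by blast
    \<comment> \<open>The last cell is charged at rate \<open>4 * T\<close> under each of the two
      measures, hence \<open>8 * T\<close>; the summand \<open>1\<close> covers
      \<open>T = 0\<close>.\<close>
    define \<theta> where "\<theta> = e / (8 * T + 1)"
    have \<theta>: "\<theta> > 0" using e T by (simp add: \<theta>_def)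
    have "eventually (\<lambda>m. measure \<nu> ((\<lambda>p. min (c0 p) m) -` {m}) < \<theta> \<and> measure \<mu> ((\<lambda>p. min (c0 p) m) -` {m}) < \<theta>) sequentially"
      using order_tendstoD(2)[OF last_cell_tendsto_0[OF \<nu> c0(1)] \<theta>]
        order_tendstoD(2)[OF last_cell_tendsto_0[OF \<mu> c0(1)] \<theta>] by (rule eventually_conj)
    then obtain m where m: "measure \<nu> ((\<lambda>p. min (c0 p) m) -` {m}) < \<theta>" "measure \<mu> ((\<lambda>p. min (c0 p) m) -` {m}) < \<theta>"
      by (auto simp: eventually_sequentially)
    define c where "c p = min (c0 p) m" for p
    have c: "c \<in> measurable borel (count_space UNIV)" "\<And>p. c p \<le> m"
      unfolding c_def using c0(1) by measurable
    have cell: "dist p q \<le> 2 * \<delta>" if "c p = c q" "c p < m" for p q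
      using that by (intro c0(2)) (auto simp: c_def min_def split: if_splits)
    have mass: "measure \<nu> (c -` {m}) < \<theta>" "measure \<mu> (c -` {m}) < \<theta>" using m unfolding c_def[abs_def] by auto
    define \<eta> where "\<eta> = e / (4 * T + 1)"
    have \<eta>: "\<eta> > 0" using e T by (simp add: \<eta>_def)
    have small: "4 * T * (measure \<nu> (c -` {m}) + measure \<mu> (c -` {m}) + \<eta>) \<le> 2 * e"
    proof -
      have "4 * T * (measure \<nu> (c -` {m}) + measure \<mu> (c -` {m}) + \<eta>) \<le> 4 * T * (\<theta> + \<theta> + \<eta>)"
        using mass T by (intro mult_left_mono add_mono) auto
      also have "\<dots> = 8 * T * \<theta> + 4 * T * \<eta>" by (simp add: algebra_simps)
      also have "8 * T * \<theta> \<le> e" using T e by (simp add: \<theta>_def field_simps)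
      also have "4 * T * \<eta> \<le> e" using T e by (simp add: \<eta>_def field_simps)
      finally show ?thesis by simp
    qed
    define A where "A n = {y \<in> space (prodn n \<mu>). \<forall>j\<le>m. (\<Sum>k<n. indicat_real (c -` {j}) (y k)) \<le> real n * ((1 + \<eta>) * measure \<mu> (c -` {j}))}" for n
    define B where "B n = {x \<in> space (prodn n \<nu>). \<forall>j\<le>m. (\<Sum>k<n. indicat_real (c -` {j}) (x k)) \<le> real n * ((1 + \<eta>) * measure \<nu> (c -` {j}))}" for n
    \<comment> \<open>The samples of atypically large likelihood ratio. Off \<open>L n\<close> the
      change of measure costs at most the factor \<open>exp (n * (H + e))\<close>.\<close>
    define L where "L n = {x \<in> space (prodn n \<nu>). real n * (H + e) \<le> (\<Sum>k<n. ln (D (x k)))}" for n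
    \<comment> \<open>Solves \<open>a * (r n - r\<^sub>o)\<^sup>2 = n * (H + 2 * e)\<close>. The
      concentration bound \<open>b * exp (- n * (H + 2 * e))\<close> for the complement is then
      smaller, by a factor of order \<open>exp (- n * e)\<close>, than the \<mu>-measure guaranteed
      for typical samples.\<close>
    define r where "r n = r\<^sub>o + sqrt (real n * ((H + 2 * e) / a))" for n
    have A: "A n \<in> sets (prodn n \<mu>)" for n unfolding A_def by (rule cell_frequencies_tendsto_1[OF \<mu> c(1) \<eta>])
    have B: "B n \<in> sets (prodn n \<nu>)" for n unfolding B_def by (rule cell_frequencies_tendsto_1[OF \<nu> c(1) \<eta>])
    have L: "L n \<in> sets (prodn n \<nu>)" for n
      unfolding L_def using measurable_sum_prodn[OF borel_measurable_integrable[OF D(5)], of n] by measurable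
    have h: "(H + 2 * e) / a > 0" using H0 e a by simp
    have evA: "eventually (\<lambda>n. 1/2 < measure (prodn n \<mu>) (A n)) sequentially"
      unfolding A_def by (rule order_tendstoD(1)[OF cell_frequencies_tendsto_1(2)[OF \<mu> c(1) \<eta>]]) simp
    have evB: "eventually (\<lambda>n. 3/4 < measure (prodn n \<nu>) (B n)) sequentially"
      unfolding B_def by (rule order_tendstoD(1)[OF cell_frequencies_tendsto_1(2)[OF \<nu> c(1) \<eta>]]) simp
    have evL: "eventually (\<lambda>n. measure (prodn n \<nu>) (L n) < 1/4) sequentially"
      unfolding L_def H_def by (rule order_tendstoD(2)[OF prodn_law_of_large_numbers[OF \<nu>(1) D(5) e]]) simp
    have evb: "eventually (\<lambda>n. b * exp (- e * real n) < 1/2) sequentially"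
    proof -
      have "(\<lambda>n. b * exp (- e * real n)) \<longlonglongrightarrow> 0" using e by real_asymp
      then show ?thesis by (rule order_tendstoD) simp
    qed
    have evr: "eventually (\<lambda>n. (r n)\<^sup>2 / real n < K) sequentially"
    proof -
      have "(\<lambda>n. (r n)\<^sup>2 / real n) \<longlonglongrightarrow> (H + 2 * e) / a"
      proof -
        define g where "g = sqrt ((H + 2 * e) / a)"
        have "g > 0" using H0 e a by (simp add: g_def)
        then have "(\<lambda>n. (r\<^sub>o + sqrt (real n) * g)\<^sup>2 / real n) \<longlonglongrightarrow> g\<^sup>2" by real_asymp
        moreover have "g\<^sup>2 = (H + 2 * e) / a" using h by (simp add: g_def)
        ultimately show ?thesis unfolding r_def real_sqrt_mult g_def by simp
      qed
      then show ?thesis by (rule order_tendstoD) (use e in \<open>simp add: K_def\<close>)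
    qed
    have "eventually (\<lambda>n. n > 0 \<and> 1/2 < measure (prodn n \<mu>) (A n) \<and> 3/4 < measure (prodn n \<nu>) (B n) \<and>
        measure (prodn n \<nu>) (L n) < 1/4 \<and> b * exp (- e * real n) < 1/2 \<and> (r n)\<^sup>2 / real n < K) sequentially"
      by (intro eventually_conj evA evB evL evb evr eventually_gt_at_top)
    then obtain n where n: "n > 0" "1/2 < measure (prodn n \<mu>) (A n)" "3/4 < measure (prodn n \<nu>) (B n)"
      "measure (prodn n \<nu>) (L n) < 1/4" "b * exp (- e * real n) < 1/2" "(r n)\<^sup>2 / real n < K"
      by (auto simp: eventually_sequentially)
    interpret Pn: prob_space "prodn n \<nu>" by (rule prob_space_prodn) (rule \<nu>)
    interpret Pm: prob_space "prodn n \<mu>" by (rule prob_space_prodn) (rule \<mu>)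
    have sets_eq: "sets (prodn n \<nu>) = sets (prodn n \<mu>)"
      unfolding prodn_def by (intro sets_PiM_cong) (simp_all add: \<nu> \<mu>)
    have BL: "B n - L n \<in> sets (prodn n \<mu>)" using B[of n] L[of n] sets_eq by auto
    have "B n \<subseteq> (B n - L n) \<union> L n" by auto
    then have "measure (prodn n \<nu>) (B n) \<le> measure (prodn n \<nu>) ((B n - L n) \<union> L n)"
      using B[of n] L[of n] by (intro Pn.finite_measure_mono) auto
    also have "\<dots> \<le> measure (prodn n \<nu>) (B n - L n) + measure (prodn n \<nu>) (L n)"
      using B[of n] L[of n] by (intro measure_Un_le) auto
    finally have "1/2 < measure (prodn n \<nu>) (B n - L n)" using n by linarith
    also have "\<dots> \<le> exp (real n * (H + e)) * measure (prodn n \<mu>) (B n - L n)"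
      by (rule measure_prodn_density_le[OF \<mu>(1) D(1,2,3) \<nu>(1) BL]) (auto simp: B_def L_def not_le)
    finally have half: "1/2 < exp (real n * (H + e)) * measure (prodn n \<mu>) (B n - L n)" .
    have nh: "0 \<le> real n * ((H + 2 * e) / a)" using h by (intro mult_nonneg_nonneg) auto
    then have rr: "r n \<ge> r\<^sub>o" unfolding r_def using real_sqrt_ge_zero[OF nh] by linarith
    from nh have "(r n - r\<^sub>o)\<^sup>2 = real n * ((H + 2 * e) / a)"
      by (simp only: r_def add_diff_cancel_left' real_sqrt_pow2)
    then have "a * (r n - r\<^sub>o)\<^sup>2 = real n * (H + 2 * e)" using a by simp
    then have cn: "measure (completion (prodn n \<mu>)) (enlarge n (A n) (r n)) \<ge> 1 - b * exp (- (real n * (H + 2 * e)))"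
      using conc[of n "A n" "r n"] n(1,2) A rr by simp
    \<comment> \<open>If the two were disjoint, the typical samples would have at most the measure
      left over by the enlargement, and the change of measure would give
      \<open>1/2 < b * exp (- e * n)\<close>.\<close>
    have "(B n - L n) \<inter> enlarge n (A n) (r n) \<noteq> {}"
    proof
      assume dis: "(B n - L n) \<inter> enlarge n (A n) (r n) = {}"
      have "measure (prodn n \<mu>) (B n - L n) + measure (completion (prodn n \<mu>)) (enlarge n (A n) (r n)) \<le> 1"
      proof (cases "enlarge n (A n) (r n) \<in> sets (completion (prodn n \<mu>))")
        case True
        interpret C: prob_space "completion (prodn n \<mu>)"
          by (rule prob_spaceI) (simp add: Pm.emeasure_space_1)
        have "measure (completion (prodn n \<mu>)) (B n - L n) + measure (completion (prodn n \<mu>)) (enlarge n (A n) (r n))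
            = measure (completion (prodn n \<mu>)) ((B n - L n) \<union> enlarge n (A n) (r n))"
          using True BL dis by (intro C.finite_measure_Union[symmetric]) auto
        also have "\<dots> \<le> 1" by (rule C.prob_le_1)
        finally show ?thesis using BL by simp
      qed (simp add: measure_notin_sets)
      then have "measure (prodn n \<mu>) (B n - L n) \<le> b * exp (- (real n * (H + 2 * e)))" using cn by linarith
      then have "exp (real n * (H + e)) * measure (prodn n \<mu>) (B n - L n)
          \<le> exp (real n * (H + e)) * (b * exp (- (real n * (H + 2 * e))))"
        by (intro mult_left_mono) auto
      also have "\<dots> = b * (exp (real n * (H + e)) * exp (- (real n * (H + 2 * e))))" by simp
      also have "exp (real n * (H + e)) * exp (- (real n * (H + 2 * e))) = exp (- e * real n)"
        by (simp add: exp_add[symmetric] algebra_simps)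
      finally show False using half n(5) by linarith
    qed
    then obtain x y where xy: "x \<in> B n" "y \<in> A n" "l2dist n x y \<le> r n" by (auto simp: enlarge_def)
    have dist: "(l2dist n x y)\<^sup>2 / real n \<le> K"
    proof -
      have "0 \<le> l2dist n x y" by (simp add: l2dist_def sum_nonneg)
      then have "(l2dist n x y)\<^sup>2 / real n \<le> (r n)\<^sup>2 / real n"
        using xy(3) by (intro divide_right_mono power_mono) auto
      then show ?thesis using n(6) by linarith
    qed
    have trunc: "(\<integral>\<^sup>+x. ennreal (max 0 ((norm x)\<^sup>2 - T)) \<partial>\<rho>) \<le> ennreal e"
      if "prob_space \<rho>" "integrable \<rho> (\<lambda>x. (norm x)\<^sup>2)" "(\<integral>x. max 0 ((norm x)\<^sup>2 - real t) \<partial>\<rho>) < e" for \<rho> :: "'a measure"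
    proof -
      interpret rho: prob_space \<rho> by fact
      have "(\<integral>\<^sup>+x. ennreal (max 0 ((norm x)\<^sup>2 - T)) \<partial>\<rho>) = ennreal (\<integral>x. max 0 ((norm x)\<^sup>2 - T) \<partial>\<rho>)"
        using that(2) by (intro nn_integral_eq_integral integrable_max) auto
      then show ?thesis using that(3) by (simp add: T_def ennreal_leI)
    qed
    have cost: "(1 + \<delta>) * ((l2dist n x y)\<^sup>2 / real n) + 16 * \<delta> * (1 + \<delta>)
        + 4 * T * (measure \<nu> (c -` {m}) + measure \<mu> (c -` {m}) + \<eta>) \<le> K + e + 2 * e"
    proof -
      have "(1 + \<delta>) * ((l2dist n x y)\<^sup>2 / real n) \<le> (1 + \<delta>) * K" using dist \<delta> by (intro mult_left_mono) auto
      then show ?thesis using \<delta>K small by linarith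
    qed
    have "T2 \<nu> \<mu> \<le> ennreal ((1 + \<delta>) * ((l2dist n x y)\<^sup>2 / real n) + 16 * \<delta> * (1 + \<delta>)
        + 4 * T * (measure \<nu> (c -` {m}) + measure \<mu> (c -` {m}) + \<eta>))
      + 2 * (\<integral>\<^sup>+x. ennreal (max 0 ((norm x)\<^sup>2 - T)) \<partial>\<nu>) + 2 * (\<integral>\<^sup>+x. ennreal (max 0 ((norm x)\<^sup>2 - T)) \<partial>\<mu>)"
      by (rule T2_le_samples[OF \<nu> \<mu> c cell \<delta>(1) n(1) \<eta> T]) (use xy in \<open>auto simp: A_def B_def\<close>)
    also have "\<dots> \<le> ennreal (K + e + 2 * e) + 2 * ennreal e + 2 * ennreal e"
      by (intro add_mono[OF add_mono] mult_left_mono ennreal_leI[OF cost] trunc \<nu> \<mu> m\<nu> m\<mu> t) auto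
    also have "\<dots> = ennreal (K + e + 2 * e) + ennreal (2 * e) + ennreal (2 * e)"
      using e by (simp add: ennreal_mult)
    also have "\<dots> = ennreal (K + 7 * e)"
      using e K by (simp add: ennreal_plus[symmetric] del: ennreal_plus)
    also have "K + 7 * e = H / a + e'" using ee by (simp add: K_def add_divide_distrib)
    also have "ennreal (H / a + e') = ennreal (H / a) + ennreal e'" using H0 a e' by (intro ennreal_plus) auto
    finally show "T2 \<nu> \<mu> \<le> ennreal (H / a) + ennreal e'" .
  qed
  then have "enn2ereal (T2 \<nu> \<mu>) \<le> ereal (H / a)"
    using H0 a by (simp add: less_eq_ennreal.rep_eq enn2ereal_ennreal)
  then show ?thesis by (simp add: D(6) H_def)
qed

theorem theorem1:
  fixes \<mu> :: "'a::euclidean_space measure" and a :: real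
  assumes "prob_space \<mu>" and "sets \<mu> = sets borel" and "a > 0"
  shows "(\<exists>r\<^sub>o b. r\<^sub>o \<ge> 0 \<and> b \<ge> 0 \<and>
            (\<forall>n\<ge>1. \<forall>A\<in>sets (prodn n \<mu>). measure (prodn n \<mu>) A \<ge> 1/2 \<longrightarrow>
               (\<forall>r\<ge>r\<^sub>o. measure (completion (prodn n \<mu>)) (enlarge n A r)
                          \<ge> 1 - b * exp (- a * (r - r\<^sub>o)\<^sup>2))))
         \<longleftrightarrow>
         (\<forall>\<nu>. prob_space \<nu> \<and> sets \<nu> = sets borel \<longrightarrow>
            enn2ereal (T2 \<nu> \<mu>) \<le> ereal (1 / a) * rel_entropy \<nu> \<mu>)"
proof
  assume "\<exists>r\<^sub>o b. r\<^sub>o \<ge> 0 \<and> b \<ge> 0 \<and>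
            (\<forall>n\<ge>1. \<forall>A\<in>sets (prodn n \<mu>). measure (prodn n \<mu>) A \<ge> 1/2 \<longrightarrow>
               (\<forall>r\<ge>r\<^sub>o. measure (completion (prodn n \<mu>)) (enlarge n A r)
                          \<ge> 1 - b * exp (- a * (r - r\<^sub>o)\<^sup>2)))"
  then obtain r\<^sub>o b where rb: "r\<^sub>o \<ge> 0" "b \<ge> 0"
    and conc: "\<forall>n\<ge>1. \<forall>A\<in>sets (prodn n \<mu>). measure (prodn n \<mu>) A \<ge> 1/2 \<longrightarrow>
               (\<forall>r\<ge>r\<^sub>o. measure (completion (prodn n \<mu>)) (enlarge n A r)
                          \<ge> 1 - b * exp (- a * (r - r\<^sub>o)\<^sup>2))" by blast
  show "\<forall>\<nu>. prob_space \<nu> \<and> sets \<nu> = sets borel \<longrightarrow>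
            enn2ereal (T2 \<nu> \<mu>) \<le> ereal (1 / a) * rel_entropy \<nu> \<mu>"
  proof (intro allI impI, elim conjE)
    fix \<nu> :: "'a measure" assume \<nu>: "prob_space \<nu>" "sets \<nu> = sets borel"
    show "enn2ereal (T2 \<nu> \<mu>) \<le> ereal (1 / a) * rel_entropy \<nu> \<mu>"
      by (rule concentration_imp_T2[OF assms rb _ \<nu>]) (use conc in blast)
  qed
next
  assume T2: "\<forall>\<nu>. prob_space \<nu> \<and> sets \<nu> = sets borel \<longrightarrow>
            enn2ereal (T2 \<nu> \<mu>) \<le> ereal (1 / a) * rel_entropy \<nu> \<mu>"
  have "measure (completion (prodn n \<mu>)) (enlarge n A r) \<ge> 1 - 1 * exp (- a * (r - sqrt (ln 2 / a))\<^sup>2)"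
    if "A \<in> sets (prodn n \<mu>)" "measure (prodn n \<mu>) A \<ge> 1/2" "r \<ge> sqrt (ln 2 / a)" for n A r
    using T2_imp_concentration[OF assms _ that] T2 by simp
  moreover have "sqrt (ln 2 / a) \<ge> 0" using assms(3) by simp
  ultimately show "\<exists>r\<^sub>o b. r\<^sub>o \<ge> 0 \<and> b \<ge> 0 \<and>
            (\<forall>n\<ge>1. \<forall>A\<in>sets (prodn n \<mu>). measure (prodn n \<mu>) A \<ge> 1/2 \<longrightarrow>
               (\<forall>r\<ge>r\<^sub>o. measure (completion (prodn n \<mu>)) (enlarge n A r)
                          \<ge> 1 - b * exp (- a * (r - r\<^sub>o)\<^sup>2)))"
    by (intro exI[of _ "sqrt (ln 2 / a)"] exI[of _ "1::real"]) auto
qed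

end
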